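(* Let $d\ge2$ and $n\ge1$ be integers, let $m_1\le\dots\le m_d$ be positive integers, and let $X_1,\dots,X_{n+m_d-1}$ be independent real-valued random variables with means $\mu_i=E[X_i]$ and finite fourth moments. For $1\le j\le d$ let $$F^{(m_j)}:=\sum_{i=1}^n a^{(m_j)}_{i,\dots,i+m_j-1}\big(X_i\cdots X_{i+m_j-1}-\mu_i\cdots\mu_{i+m_j-1}\big),$$ where $a^{(m_j)}_{i,\dots,i+m_j-1}$, $1\le i\le n$, $1\le j\le d$, are real numbers, and let $F:=(F^{(m_1)},\dots,F^{(m_d)})$. Let $Y$ be a centered $d$-dimensional Gaussian vector with the same covariance matrix as that of $F$. Then, for any $g\in\mathcal{C}^3(\mathbb{R}^d)$ with $\|g''\|_\infty+\|g'''\|_\infty<\infty$, $$|E[g(F)]-E[g(Y)]|\le \sqrt2\,\|g''\|_\infty d\sum_{i=1}^d m_i^3\sqrt{y_1^{m_i-1}y_2\sum_{k=1}^n|a^{(m_i)}_{k,\dots,k+m_i-1}|^4}+\frac{\|g'''\|_\infty d^2}{3}\sum_{i=1}^d m_i^3x_1^{m_i-1}x_2\sum_{k=1}^n|a^{(m_i)}_{k,\dots,k+m_i-1}|^3,$$ where $x_1:=\max_{1\le i\le n+m_d-1}E|X_i|^3$, $x_2:=\max_{1\le i\le n+m_d-1}E|X_i-\mu_i|^3$, $y_1:=\max_{1\le i\le n+m_d-1}E|X_i|^4$, $y_2:=\max_{1\le i\le n+m_d-1}E|X_i-\mu_i|^4$.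
   Context: $\mathcal{C}^3(\mathbb{R}^d)$ is the space of three times continuously differentiable real-valued functions on $\mathbb{R}^d$. For $g\in\mathcal{C}^k(\mathbb{R}^d)$, $\|g^{(k)}\|_\infty:=\max_{1\le i_1\le\dots\le i_k\le d}\sup_{x\in\mathbb{R}^d}\big|\frac{\partial^k g}{\partial x_{i_1}\cdots\partial x_{i_k}}(x)\big|$; $g''=g^{(2)}$, $g'''=g^{(3)}$. The coefficient $a^{(m_j)}_{i,\dots,i+m_j-1}$ is simply a real number attached to the window $\{i,\dots,i+m_j-1\}$ of length $m_j$. *)

theory Defs
  imports "HOL-Probability.Probability"
begin

text \<open>
  Coordinates of the Euclidean space are indexed by a finite linearly ordered type, i.e. (up to
  the unique order isomorphism) by the integers from 1 to \<open>CARD('d)\<close>.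
\<close>

definition partial_deriv :: "'d::finite \<Rightarrow> (real ^ 'd \<Rightarrow> real) \<Rightarrow> real ^ 'd \<Rightarrow> real" where
  "partial_deriv i g x = deriv (\<lambda>t. g (x + t *\<^sub>R axis i 1)) 0"

definition has_partial_derivs :: "(real ^ 'd::finite \<Rightarrow> real) \<Rightarrow> bool" where
  "has_partial_derivs g \<longleftrightarrow>
     (\<forall>i x. (\<lambda>t. g (x + t *\<^sub>R axis i 1)) field_differentiable (at 0))"

primrec C_k :: "nat \<Rightarrow> (real ^ 'd::finite \<Rightarrow> real) \<Rightarrow> bool" where
  "C_k 0 g \<longleftrightarrow> continuous_on UNIV g"
| "C_k (Suc k) g \<longleftrightarrow>
     continuous_on UNIV g \<and> has_partial_derivs g \<and> (\<forall>i. C_k k (partial_deriv i g))"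

text \<open>\<open>iter_partial [i\<^sub>1, \<dots>, i\<^sub>k] g\<close> is $\partial^k g / \partial x_{i_1} \cdots \partial x_{i_k}$.\<close>

definition iter_partial :: "'d::finite list \<Rightarrow> (real ^ 'd \<Rightarrow> real) \<Rightarrow> real ^ 'd \<Rightarrow> real" where
  "iter_partial is g = foldr partial_deriv is g"

text \<open>
  $\|g^{(k)}\|_\infty$, the maximum over $i_1 \le \dots \le i_k$ of the supremum norms of the
  partial derivatives of order \<open>k\<close>. It is extended-real valued because it may be infinite.
\<close>

definition deriv_norm :: "nat \<Rightarrow> (real ^ 'd::{finite,linorder} \<Rightarrow> real) \<Rightarrow> ereal" where
  "deriv_norm k g =
     (MAX is \<in> {is. length is = k \<and> sorted is}. SUP x. ereal \<bar>iter_partial is g x\<bar>)"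

definition cov_matrix :: "'a measure \<Rightarrow> ('a \<Rightarrow> real ^ 'd::finite) \<Rightarrow> real ^ 'd ^ 'd" where
  "cov_matrix M Z = (\<chi> i j. prob_space.expectation M (\<lambda>\<omega>.
     (Z \<omega> $ i - prob_space.expectation M (\<lambda>\<omega>. Z \<omega> $ i)) *
     (Z \<omega> $ j - prob_space.expectation M (\<lambda>\<omega>. Z \<omega> $ j))))"

text \<open>
  The covariance matrix of a Gaussian vector may be singular, so the Dirac measures are included
  among the univariate Gaussian laws, as those with standard deviation \<open>\<sigma> = 0\<close>
  (\<open>normal_density \<mu> 0\<close> is the zero function and hence cannot be used here).
\<close>

definition gaussian_law :: "real \<Rightarrow> real \<Rightarrow> real measure" where
  "gaussian_law \<mu> \<sigma> =
     (if \<sigma> = 0 then return borel \<mu> else density lborel (\<lambda>x. ennreal (normal_density \<mu> \<sigma> x)))"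

definition gaussian_vector :: "'a measure \<Rightarrow> ('a \<Rightarrow> real ^ 'd::finite) \<Rightarrow> bool" where
  "gaussian_vector M Y \<longleftrightarrow> Y \<in> borel_measurable M \<and>
     (\<forall>v. \<exists>\<mu> \<sigma>. 0 \<le> \<sigma> \<and>
        distr M borel (\<lambda>\<omega>. v \<bullet> Y \<omega>) = gaussian_law \<mu> \<sigma>)"

definition centered :: "'a measure \<Rightarrow> ('a \<Rightarrow> real ^ 'd::finite) \<Rightarrow> bool" where
  "centered M Y \<longleftrightarrow>
     (\<forall>i. integrable M (\<lambda>\<omega>. Y \<omega> $ i) \<and> prob_space.expectation M (\<lambda>\<omega>. Y \<omega> $ i) = 0)"

text \<open>
  The random variable $\sum_{i=1}^n a_i (X_i \cdots X_{i+m-1} - \mu_i \cdots \mu_{i+m-1})$;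
  a window $\{i, \dots, i+m-1\}$ is identified by its left end \<open>i\<close>.
\<close>

definition window_sum ::
  "nat \<Rightarrow> nat \<Rightarrow> (nat \<Rightarrow> real) \<Rightarrow> (nat \<Rightarrow> real) \<Rightarrow> (nat \<Rightarrow> 'a \<Rightarrow> real) \<Rightarrow> 'a \<Rightarrow> real" where
  "window_sum n m a \<mu> X \<omega> =
     (\<Sum>i = 1..n. a i * ((\<Prod>k = i..i + m - 1. X k \<omega>) - (\<Prod>k = i..i + m - 1. \<mu> k)))"

end

theory Submission
  imports Defs
begin

text \<open>
  For independent \<open>F\<close> and \<open>Y\<close>, the function \<open>g (sin \<theta> F + cos \<theta> Y)\<close> interpolates between \<open>g (Y)\<close> and
  \<open>g (F)\<close> on \<open>[0, \<pi>/2]\<close>. Its derivative has expectation \<open>E[\<nabla>g \<bullet> (cos \<theta> F - sin \<theta> Y)]\<close>. Gaussian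
  integration by parts turns the second term into \<open>sin \<theta> cos \<theta> \<Sum> C\<^sub>i\<^sub>j E[\<partial>\<^sub>i\<^sub>j g]\<close>. For the first term, write
  \<open>F\<^sub>j = \<Sum>\<^sub>l P\<^sub>j\<^sub>l\<close> as a sum of martingale differences and let \<open>D\<^sub>i\<^sub>l\<close> be the change of \<open>F\<^sub>i\<close> when \<open>X\<^sub>l\<close> is
  replaced by its mean; a second order Taylor expansion gives
  \<open>sin \<theta> cos \<theta> \<Sum> E[\<partial>\<^sub>i\<^sub>j g T\<^sub>j\<^sub>i]\<close> with \<open>T\<^sub>j\<^sub>i = \<Sum>\<^sub>l P\<^sub>j\<^sub>l D\<^sub>i\<^sub>l\<close>, up to a remainder controlled by third moments of
  \<open>P\<close> and \<open>D\<close>. Since \<open>E[T\<^sub>j\<^sub>i] = C\<^sub>i\<^sub>j\<close>, it remains to bound the variance of \<open>T\<^sub>j\<^sub>i\<close>, whose summands are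
  locally dependent.
\<close>

section \<open>Partial derivatives\<close>

text \<open>Two kinds of increments are needed because each has one decisive property: the
  martingale differences sum to \<open>F\<close> exactly, while subtracting the other kind removes
  \<open>X l\<close> from all components of \<open>F\<close> at once. The centered factor
  \<open>X l - \<mu> l\<close> is then independent of what remains, and the zeroth order term of the
  expansion has expectation zero. Expanding around \<open>F\<close>, not around the reduced vector,
  keeps the derivatives of \<open>g\<close> free of \<open>l\<close>; this lets the products be
  collected in one random matrix. The circular path is chosen so that both second order terms carry
  the same weight and can be compared; the integrals of this weight and of the weight of the
  remainder over the quarter circle are 1/2 and 1/3. On the Gaussian side the obstacle is a singular
  covariance matrix: \<open>Y\<close> need not have a density, so integration by parts goes through
  the uniqueness theorem for characteristic functions. As only derivatives of order two and three
  are bounded, \<open>g\<close> may grow quadratically and its gradient linearly; all domination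
  arguments rest on this.\<close>

lemma has_real_derivative_partial_deriv:
  assumes "has_partial_derivs g"
  shows "((\<lambda>t. g (x + t *\<^sub>R axis i 1)) has_real_derivative partial_deriv i g (x + t *\<^sub>R axis i 1)) (at t)"
proof -
  have "(\<lambda>u. g ((x + t *\<^sub>R axis i 1) + u *\<^sub>R axis i 1)) field_differentiable (at 0)"
    using assms unfolding has_partial_derivs_def by blast
  then have "((\<lambda>u. g (x + (t + u) *\<^sub>R axis i 1)) has_real_derivative
      partial_deriv i g (x + t *\<^sub>R axis i 1)) (at 0)"
    unfolding partial_deriv_def by (simp add: field_differentiable_derivI scaleR_add_left add.assoc)
  then show ?thesis
    using DERIV_at_within_shift[of "\<lambda>t. g (x + t *\<^sub>R axis i 1)" _ t 0 UNIV] by simp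
qed

lemma partial_deriv_mvt:
  assumes "has_partial_derivs g"
  obtains s where "0 \<le> s" "s \<le> 1"
    "g (x + h *\<^sub>R axis i 1) - g x = h * partial_deriv i g (x + (s * h) *\<^sub>R axis i 1)"
proof -
  \<comment> \<open>Rescaling the step to [0,1] avoids a case distinction on the sign of
    \<open>h\<close>.\<close>
  define \<phi> where "\<phi> u = g (x + (u * h) *\<^sub>R axis i 1)" for u
  have "(\<phi> has_real_derivative partial_deriv i g (x + (u * h) *\<^sub>R axis i 1) * h) (at u)" for u
    unfolding \<phi>_def
    by (rule DERIV_chain2[OF has_real_derivative_partial_deriv[OF assms]])
       (auto intro!: derivative_eq_intros)
  then obtain s where "0 < s" "s < 1"
      "\<phi> 1 - \<phi> 0 = (1 - 0) * (partial_deriv i g (x + (s * h) *\<^sub>R axis i 1) * h)"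
    using MVT2[of 0 1 \<phi> "\<lambda>u. partial_deriv i g (x + (u * h) *\<^sub>R axis i 1) * h"] by auto
  then show thesis
    using that[of s] by (simp add: \<phi>_def mult.commute)
qed

lemma has_partial_derivs_shift_diff:
  assumes "has_partial_derivs g"
  shows "has_partial_derivs (\<lambda>y. g (y + v) - g y)"
    and "partial_deriv i (\<lambda>y. g (y + v) - g y) x = partial_deriv i g (x + v) - partial_deriv i g x"
proof -
  have D: "((\<lambda>t. g (x + t *\<^sub>R axis i 1 + v) - g (x + t *\<^sub>R axis i 1)) has_real_derivative
      (partial_deriv i g (x + v) - partial_deriv i g x)) (at 0)" for i x
    using has_real_derivative_partial_deriv[OF assms, of "x + v" i 0]
      has_real_derivative_partial_deriv[OF assms, of x i 0]
    by (intro DERIV_diff) (simp_all add: algebra_simps)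
  show "has_partial_derivs (\<lambda>y. g (y + v) - g y)"
    unfolding has_partial_derivs_def field_differentiable_def using D by blast
  show "partial_deriv i (\<lambda>y. g (y + v) - g y) x = partial_deriv i g (x + v) - partial_deriv i g x"
    unfolding partial_deriv_def[of i "\<lambda>y. g (y + v) - g y"] using D by (rule DERIV_imp_deriv)
qed

text \<open>Both mixed derivatives are limits of the second difference quotient.\<close>

lemma second_difference_mvt:
  assumes "has_partial_derivs g" "has_partial_derivs (partial_deriv i g)"
  obtains s t where "0 \<le> s" "s \<le> 1" "0 \<le> t" "t \<le> 1"
    "g (x + h *\<^sub>R axis i 1 + h *\<^sub>R axis j 1) - g (x + h *\<^sub>R axis i 1) - g (x + h *\<^sub>R axis j 1) + g x
      = h * h * partial_deriv j (partial_deriv i g) (x + (s * h) *\<^sub>R axis i 1 + (t * h) *\<^sub>R axis j 1)"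
proof -
  \<comment> \<open>The second difference is the difference of \<open>?p\<close> in direction
    \<open>i\<close>; the mean value theorem is applied to \<open>?p\<close> and then, in direction
    \<open>j\<close>, to \<open>partial_deriv i g\<close>.\<close>
  let ?p = "\<lambda>y. g (y + h *\<^sub>R axis j 1) - g y"
  obtain s where s: "0 \<le> s" "s \<le> 1"
    "?p (x + h *\<^sub>R axis i 1) - ?p x = h * partial_deriv i ?p (x + (s * h) *\<^sub>R axis i 1)"
    using partial_deriv_mvt[OF has_partial_derivs_shift_diff(1)[OF assms(1)]] .
  obtain t where t: "0 \<le> t" "t \<le> 1"
    "partial_deriv i g (x + (s * h) *\<^sub>R axis i 1 + h *\<^sub>R axis j 1) - partial_deriv i g (x + (s * h) *\<^sub>R axis i 1)
      = h * partial_deriv j (partial_deriv i g) (x + (s * h) *\<^sub>R axis i 1 + (t * h) *\<^sub>R axis j 1)"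
    using partial_deriv_mvt[OF assms(2)] .
  show thesis
    using s t by (intro that[of s t]) (simp_all add: has_partial_derivs_shift_diff(2)[OF assms(1)])
qed

lemma partial_deriv_commute:
  assumes "C_k (Suc (Suc 0)) g"
  shows "partial_deriv i (partial_deriv j g) x = partial_deriv j (partial_deriv i g) x"
proof -
  have g: "has_partial_derivs g" "has_partial_derivs (partial_deriv k g)"
    and cont: "continuous_on UNIV (partial_deriv l (partial_deriv k g))" for k l
    using assms by auto
  have lim: "((\<lambda>h. (g (x + h *\<^sub>R axis i 1 + h *\<^sub>R axis j 1) - g (x + h *\<^sub>R axis i 1)
      - g (x + h *\<^sub>R axis j 1) + g x) / (h * h)) \<longlongrightarrow> partial_deriv j (partial_deriv i g) x) (at_right 0)"
    (is "(?q \<longlongrightarrow> _) _") for i j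
  proof (rule tendstoI)
    fix e :: real assume "0 < e"
    then obtain d where d: "0 < d" and
      close: "\<And>y. dist y x < d \<Longrightarrow> dist (partial_deriv j (partial_deriv i g) y) (partial_deriv j (partial_deriv i g) x) < e"
      using cont[of j i] unfolding continuous_on_iff by (metis UNIV_I)
    \<comment> \<open>The intermediate point is displaced by at most \<open>h\<close> in each of two
      directions, hence the radius \<open>d / 2\<close>.\<close>
    have "dist (?q h) (partial_deriv j (partial_deriv i g) x) < e" if h: "0 < h" "h < d / 2" for h
    proof -
      obtain s t where st: "0 \<le> s" "s \<le> 1" "0 \<le> t" "t \<le> 1"
        "?q h * (h * h) = h * h * partial_deriv j (partial_deriv i g) (x + (s * h) *\<^sub>R axis i 1 + (t * h) *\<^sub>R axis j 1)"
        using second_difference_mvt[OF g(1) g(2)[of i]] h by (metis less_irrefl mult_eq_0_iff nonzero_eq_divide_eq)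
      have "norm ((s * h) *\<^sub>R axis i 1 + (t * h) *\<^sub>R axis j (1::real)) \<le> s * h + t * h"
        using st h norm_triangle_ineq[of "(s * h) *\<^sub>R axis i (1::real)" "(t * h) *\<^sub>R axis j (1::real)"]
        by (simp add: norm_axis_1)
      also have "\<dots> \<le> h + h"
        using st h by (intro add_mono) (simp_all add: mult_le_cancel_right1)
      finally have "dist (x + (s * h) *\<^sub>R axis i 1 + (t * h) *\<^sub>R axis j 1) x < d"
        using h by (simp add: dist_norm add.assoc)
      then show ?thesis
        using close st(5) h by simp
    qed
    then show "\<forall>\<^sub>F h in at_right 0. dist (?q h) (partial_deriv j (partial_deriv i g) x) < e"
      using d by (intro eventually_at_rightI[of 0 "d / 2"]) auto
  qed
  \<comment> \<open>The quotient is symmetric in \<open>i\<close> and \<open>j\<close>, so its limit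
    is also the other mixed derivative.\<close>
  have "((\<lambda>h. (g (x + h *\<^sub>R axis i 1 + h *\<^sub>R axis j 1) - g (x + h *\<^sub>R axis i 1)
      - g (x + h *\<^sub>R axis j 1) + g x) / (h * h)) \<longlongrightarrow> partial_deriv i (partial_deriv j g) x) (at_right 0)"
    using lim[of j i] by (simp add: algebra_simps)
  then show ?thesis
    using lim[of i j] tendsto_unique trivial_limit_at_right_real by blast
qed

section \<open>Total derivative, chain rule and Taylor bounds\<close>

text \<open>Coordinates are moved one at a time: each move is a one-variable mean value step at a
  point so close to \<open>x\<close> that continuity of the partial derivative applies.\<close>

lemma C1_has_derivative:
  fixes g :: "real ^ 'd::finite \<Rightarrow> real"
  assumes "C_k (Suc 0) g"
  shows "(g has_derivative (\<lambda>h. \<Sum>i\<in>UNIV. h $ i * partial_deriv i g x)) (at x)"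
  unfolding has_derivative_at_alt
proof safe
  show "bounded_linear (\<lambda>h. \<Sum>i\<in>UNIV. h $ i * partial_deriv i g x)"
    by (intro bounded_linear_sum bounded_linear_mult_const bounded_linear_vec_nth)
  fix e :: real assume "0 < e"
  have g: "has_partial_derivs g" and cont: "\<And>i. continuous_on UNIV (partial_deriv i g)"
    using assms by auto
  \<comment> \<open>The errors add up to \<open>\<epsilon>\<close> times the l1 norm of
    \<open>h\<close>, which is at most \<open>CARD('d)\<close> times the Euclidean norm; the
    divisions here and in \<open>\<delta>\<close> pay for that factor.\<close>
  define \<epsilon> where "\<epsilon> = e / real CARD('d)"
  have \<epsilon>: "0 < \<epsilon>" using \<open>0 < e\<close> by (simp add: \<epsilon>_def)
  have "\<forall>i. \<exists>d>0. \<forall>y. dist y x < d \<longrightarrow> dist (partial_deriv i g y) (partial_deriv i g x) < \<epsilon>"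
    using cont \<epsilon> unfolding continuous_on_iff by (metis UNIV_I)
  then obtain d where d: "\<And>i. 0 < d i"
    and close: "\<And>i y. dist y x < d i \<Longrightarrow> dist (partial_deriv i g y) (partial_deriv i g x) < \<epsilon>"
    by metis
  define \<delta> where "\<delta> = Min (range d) / real CARD('d)"
  have \<delta>: "0 < \<delta>" unfolding \<delta>_def using d by (intro divide_pos_pos) (auto simp: Min_gr_iff)
  have *: "\<bar>g (x + h) - g x - (\<Sum>i\<in>UNIV. h $ i * partial_deriv i g x)\<bar> \<le> e * norm h"
    if "norm h < \<delta>" for h
  proof -
    have l1: "(\<Sum>i\<in>UNIV. \<bar>h $ i\<bar>) \<le> real CARD('d) * norm h"
      using sum_bounded_above[of UNIV "\<lambda>i. \<bar>h $ i\<bar>" "norm h"] component_le_norm_cart by force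
    have small: "(\<Sum>i\<in>UNIV. \<bar>h $ i\<bar>) < d i" for i
    proof -
      have "real CARD('d) * norm h < Min (range d)"
        using that by (simp add: \<delta>_def field_simps)
      also have "\<dots> \<le> d i" by simp
      finally show ?thesis using l1 by linarith
    qed
    \<comment> \<open>Induction over the set \<open>S\<close> of coordinates already moved.\<close>
    have "\<bar>g (x + (\<Sum>i\<in>S. h $ i *\<^sub>R axis i 1)) - g x - (\<Sum>i\<in>S. h $ i * partial_deriv i g x)\<bar>
        \<le> (\<Sum>i\<in>S. \<bar>h $ i\<bar> * \<epsilon>)" for S :: "'d set"
      using finite[of S]
    proof (induction S)
      case (insert a S)
      let ?y = "x + (\<Sum>i\<in>S. h $ i *\<^sub>R axis i 1)"
      obtain s where s: "0 \<le> s" "s \<le> 1"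
        "g (?y + h $ a *\<^sub>R axis a 1) - g ?y = h $ a * partial_deriv a g (?y + (s * h $ a) *\<^sub>R axis a 1)"
        using partial_deriv_mvt[OF g] .
      have "norm ((\<Sum>i\<in>S. h $ i *\<^sub>R axis i 1) + (s * h $ a) *\<^sub>R axis a (1::real))
          \<le> (\<Sum>i\<in>S. \<bar>h $ i\<bar>) + \<bar>s * h $ a\<bar>"
        by (rule norm_triangle_le, intro add_mono order_trans[OF norm_sum]) (simp_all add: norm_axis_1)
      also have "\<bar>s * h $ a\<bar> \<le> \<bar>h $ a\<bar>"
        using s by (simp add: abs_mult mult_left_le_one_le)
      also have "(\<Sum>i\<in>S. \<bar>h $ i\<bar>) + \<bar>h $ a\<bar> \<le> (\<Sum>i\<in>UNIV. \<bar>h $ i\<bar>)"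
        using insert sum_mono2[of UNIV "insert a S" "\<lambda>i. \<bar>h $ i\<bar>"] by (simp add: add.commute)
      finally have "dist (?y + (s * h $ a) *\<^sub>R axis a 1) x < d a"
        using small[of a] by (simp add: dist_norm add.assoc)
      then have "\<bar>partial_deriv a g (?y + (s * h $ a) *\<^sub>R axis a 1) - partial_deriv a g x\<bar> \<le> \<epsilon>"
        using close by (simp add: dist_real_def less_imp_le)
      then have "\<bar>h $ a * (partial_deriv a g (?y + (s * h $ a) *\<^sub>R axis a 1) - partial_deriv a g x)\<bar> \<le> \<bar>h $ a\<bar> * \<epsilon>"
        by (simp add: abs_mult mult_left_mono)
      moreover have "g (x + (\<Sum>i\<in>insert a S. h $ i *\<^sub>R axis i 1)) = g (?y + h $ a *\<^sub>R axis a 1)"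
        using insert by (simp add: algebra_simps)
      ultimately show ?case
        using insert s(3) by (simp add: algebra_simps)
    qed simp
    from this[of UNIV] have "\<bar>g (x + h) - g x - (\<Sum>i\<in>UNIV. h $ i * partial_deriv i g x)\<bar>
        \<le> (\<Sum>i\<in>UNIV. \<bar>h $ i\<bar>) * \<epsilon>"
      using basis_expansion[of h] by (simp add: sum_distrib_right scalar_mult_eq_scaleR)
    also have "\<dots> \<le> (real CARD('d) * norm h) * \<epsilon>"
      using l1 \<epsilon> by (intro mult_right_mono) auto
    finally show ?thesis by (simp add: \<epsilon>_def mult.commute)
  qed
  show "\<exists>\<delta>>0. \<forall>y. norm (y - x) < \<delta> \<longrightarrow>
      norm (g y - g x - (\<Sum>i\<in>UNIV. (y - x) $ i * partial_deriv i g x)) \<le> e * norm (y - x)"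
    using \<delta> *[of "_ - x"] by (intro exI[of _ \<delta>]) auto
qed

lemma C1_has_real_derivative_compose:
  fixes g :: "real ^ 'd::finite \<Rightarrow> real"
  assumes "C_k (Suc 0) g" "(p has_vector_derivative p') (at t)"
  shows "((\<lambda>t. g (p t)) has_real_derivative (\<Sum>i\<in>UNIV. p' $ i * partial_deriv i g (p t))) (at t)"
proof -
  have "((\<lambda>t. g (p t)) has_derivative (\<lambda>u. \<Sum>i\<in>UNIV. (u *\<^sub>R p') $ i * partial_deriv i g (p t))) (at t)"
    using diff_chain_at[OF assms(2)[unfolded has_vector_derivative_def] C1_has_derivative[OF assms(1)]]
    by (simp add: o_def)
  then show ?thesis
    unfolding has_field_derivative_def
    by (rule has_derivative_eq_rhs) (simp add: fun_eq_iff sum_distrib_left sum_distrib_right mult_ac)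
qed

text \<open>On the segment from \<open>x\<close> to \<open>x + h\<close> the second derivative of
  \<open>g\<close> is a quadratic form in \<open>h\<close> with coefficients bounded by
  \<open>B\<close>; this is why the l1 norm of \<open>h\<close> appears.\<close>

lemma C2_Taylor:
  fixes g :: "real ^ 'd::finite \<Rightarrow> real"
  assumes C: "C_k (Suc (Suc 0)) g"
    and B: "\<And>i j y. \<bar>partial_deriv i (partial_deriv j g) y\<bar> \<le> B"
  shows "\<bar>g (x + h) - g x - (\<Sum>i\<in>UNIV. h $ i * partial_deriv i g x)\<bar> \<le> B / 2 * (\<Sum>i\<in>UNIV. \<bar>h $ i\<bar>)\<^sup>2"
proof -
  have C1: "C_k (Suc 0) g" "C_k (Suc 0) (partial_deriv i g)" for i using C by auto
  have line: "((\<lambda>t. x + t *\<^sub>R h) has_vector_derivative h) (at t)" for t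
    by (auto intro!: derivative_eq_intros)
  \<comment> \<open>Orders 0, 1 and 2 of the derivative along the segment, in the format of
    Maclaurin's formula.\<close>
  define df where "df k t = (if k = 0 then g (x + t *\<^sub>R h)
    else if k = 1 then (\<Sum>i\<in>UNIV. h $ i * partial_deriv i g (x + t *\<^sub>R h))
    else (\<Sum>i\<in>UNIV. h $ i * (\<Sum>j\<in>UNIV. h $ j * partial_deriv j (partial_deriv i g) (x + t *\<^sub>R h))))"
    for k :: nat and t
  have "(df k has_real_derivative df (Suc k) t) (at t)" if "k < 2" for k t
  proof (cases "k = 0")
    case True
    then show ?thesis
      using C1_has_real_derivative_compose[OF C1(1) line[of t]] by (simp add: df_def[abs_def])
  next
    case False
    then have "k = 1" using that by simp
    then show ?thesis
      unfolding df_def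
      by (auto intro!: DERIV_sum DERIV_cmult C1_has_real_derivative_compose[OF C1(2) line] simp: df_def)
  qed
  then obtain t where t: "0 < t" "t \<le> 1" "df 0 1 = (\<Sum>k<2. df k 0 / fact k * 1 ^ k) + df 2 t / fact 2 * 1 ^ 2"
    using Maclaurin2[of 1 df "df 0" 2] by auto
  then have eq: "g (x + h) - g x - (\<Sum>i\<in>UNIV. h $ i * partial_deriv i g x) = df 2 t / 2"
    by (simp add: df_def numeral_2_eq_2)
  have "\<bar>df 2 t\<bar> \<le> (\<Sum>i\<in>UNIV. \<bar>h $ i\<bar> * (\<Sum>j\<in>UNIV. \<bar>h $ j\<bar> * B))"
    unfolding df_def using B
    by (auto simp: abs_mult intro!: order_trans[OF sum_abs] sum_mono mult_left_mono)
  also have "\<dots> = B * (\<Sum>i\<in>UNIV. \<bar>h $ i\<bar>)\<^sup>2"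
    by (simp add: power2_eq_square sum_distrib_left sum_distrib_right mult_ac)
  finally show ?thesis unfolding eq by simp
qed


lemma C1_lipschitz:
  fixes g :: "real ^ 'd::finite \<Rightarrow> real"
  assumes C: "C_k (Suc 0) g" and B: "\<And>i y. \<bar>partial_deriv i g y\<bar> \<le> B"
  shows "\<bar>g (x + h) - g x\<bar> \<le> B * (\<Sum>i\<in>UNIV. \<bar>h $ i\<bar>)"
proof -
  have line: "((\<lambda>t. x + t *\<^sub>R h) has_vector_derivative h) (at t)" for t
    by (auto intro!: derivative_eq_intros)
  obtain t where "g (x + 1 *\<^sub>R h) - g (x + 0 *\<^sub>R h)
      = (1 - 0) * (\<Sum>i\<in>UNIV. h $ i * partial_deriv i g (x + t *\<^sub>R h))"
    using MVT2[of 0 1 "\<lambda>t. g (x + t *\<^sub>R h)", OF _ C1_has_real_derivative_compose[OF C line]] by auto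
  then have "\<bar>g (x + h) - g x\<bar> \<le> (\<Sum>i\<in>UNIV. \<bar>h $ i\<bar> * B)"
    using B by (auto simp: abs_mult intro!: order_trans[OF sum_abs] sum_mono mult_left_mono)
  then show ?thesis by (simp add: sum_distrib_left mult.commute)
qed

section \<open>Pointwise bounds from the supremum norms of derivatives\<close>

lemma abs_iter_partial_le_deriv_norm:
  fixes g :: "real ^ 'd::{finite,linorder} \<Rightarrow> real"
  assumes "length is = k" "sorted is"
  shows "ereal \<bar>iter_partial is g x\<bar> \<le> deriv_norm k g"
proof -
  have "finite {is :: 'd list. length is = k \<and> sorted is}"
    using finite_lists_length_eq[of "UNIV :: 'd set" k] by (rule rev_finite_subset) auto
  then have "(SUP x. ereal \<bar>iter_partial is g x\<bar>) \<le> deriv_norm k g"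
    unfolding deriv_norm_def using assms by (intro Max_ge) auto
  moreover have "ereal \<bar>iter_partial is g x\<bar> \<le> (SUP x. ereal \<bar>iter_partial is g x\<bar>)"
    by (intro SUP_upper) auto
  ultimately show ?thesis by order
qed

lemma deriv_norm_nonneg: "0 \<le> deriv_norm k g"
proof -
  \<comment> \<open>A constant list is sorted, so the maximum runs over a nonempty family at every
    order \<open>k\<close>.\<close>
  have "0 \<le> ereal \<bar>iter_partial (replicate k undefined) g 0\<bar>" by simp
  also have "\<dots> \<le> deriv_norm k g"
    by (intro abs_iter_partial_le_deriv_norm) simp_all
  finally show ?thesis .
qed

lemma abs_iter_partial_le:
  assumes "deriv_norm k g < \<infinity>" "length is = k" "sorted is"
  shows "\<bar>iter_partial is g x\<bar> \<le> real_of_ereal (deriv_norm k g)"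
  using abs_iter_partial_le_deriv_norm[OF assms(2,3), of g x] assms(1) deriv_norm_nonneg[of k g]
  by (cases "deriv_norm k g") auto

text \<open>\<open>deriv_norm\<close> sees sorted index lists only; the symmetry of second
  derivatives covers the other order.\<close>

lemma abs_partial_deriv_2_le:
  fixes g :: "real ^ 'd::{finite,linorder} \<Rightarrow> real"
  assumes "C_k (Suc (Suc 0)) g" "deriv_norm 2 g < \<infinity>"
  shows "\<bar>partial_deriv i (partial_deriv j g) x\<bar> \<le> real_of_ereal (deriv_norm 2 g)"
proof -
  have *: "\<bar>partial_deriv i (partial_deriv j g) x\<bar> \<le> real_of_ereal (deriv_norm 2 g)" if "i \<le> j" for i j
    using abs_iter_partial_le[OF assms(2), of "[i, j]" x] that by (simp add: iter_partial_def)
  show ?thesis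
    using *[of i j] *[of j i] partial_deriv_commute[OF assms(1)] by (metis linear)
qed

lemma abs_partial_deriv_3_le:
  fixes g :: "real ^ 'd::{finite,linorder} \<Rightarrow> real"
  assumes "C_k (Suc (Suc (Suc 0))) g" "deriv_norm 3 g < \<infinity>"
  shows "\<bar>partial_deriv i (partial_deriv j (partial_deriv k g)) x\<bar> \<le> real_of_ereal (deriv_norm 3 g)"
proof -
  define D where "D i j k = partial_deriv i (partial_deriv j (partial_deriv k g)) x" for i j k
  have C: "C_k (Suc (Suc 0)) g" "C_k (Suc (Suc 0)) (partial_deriv k g)" for k
    using assms(1) by auto
  have 1: "D i j k = D j i k" for i j k
    unfolding D_def by (rule partial_deriv_commute[OF C(2)])
  have 2: "D i j k = D i k j" for i j k
  proof -
    have "partial_deriv j (partial_deriv k g) = partial_deriv k (partial_deriv j g)"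
      using partial_deriv_commute[OF C(1)] by blast
    then show ?thesis by (simp add: D_def)
  qed
  have sorted: "\<bar>D i j k\<bar> \<le> real_of_ereal (deriv_norm 3 g)" if "i \<le> j" "j \<le> k" for i j k
    using abs_iter_partial_le[OF assms(2), of "[i, j, k]" x] that by (simp add: iter_partial_def D_def)
  \<comment> \<open>With the smallest index in front, exchanging the last two sorts the list; the
    final case distinction brings the smallest index to the front by adjacent exchanges.\<close>
  have first: "\<bar>D i j k\<bar> \<le> real_of_ereal (deriv_norm 3 g)" if "i \<le> j" "i \<le> k" for i j k
    using sorted[of i j k] sorted[of i k j] 2[of i j k] that by (cases "j \<le> k") auto
  have "\<bar>D i j k\<bar> \<le> real_of_ereal (deriv_norm 3 g)"
  proof -
    consider "i \<le> j" "i \<le> k" | "j \<le> i" "j \<le> k" | "k \<le> i" "k \<le> j"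
      by (meson linear order.trans)
    then show ?thesis
      using first[of i j k] first[of j i k] first[of k i j] 1[of i j k] 2[of i j k] 1[of i k j]
      by cases auto
  qed
  then show ?thesis by (simp add: D_def)
qed

section \<open>Moment inequalities\<close>

lemma abs_mult_le_half_sum_squares: "\<bar>u * v\<bar> \<le> (u\<^sup>2 + v\<^sup>2) / 2" for u v :: real
  using sum_squares_bound[of "\<bar>u\<bar>" "\<bar>v\<bar>"] by (simp add: abs_mult)

text \<open>A crude constant suffices here: the bound only provides a dominating function for
  products of four variables.\<close>

lemma mult4_le_sum_pow4:
  fixes a b c d :: real
  shows "\<bar>a * b * c * d\<bar> \<le> a ^ 4 + b ^ 4 + c ^ 4 + d ^ 4"
proof -
  have "\<bar>a * b * c * d\<bar> = \<bar>(a * b) * (c * d)\<bar>" by (simp add: mult.assoc)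
  also have "\<dots> \<le> ((a * b)\<^sup>2 + (c * d)\<^sup>2) / 2" by (rule abs_mult_le_half_sum_squares)
  also have "\<dots> \<le> ((a\<^sup>2)\<^sup>2 + (b\<^sup>2)\<^sup>2 + ((c\<^sup>2)\<^sup>2 + (d\<^sup>2)\<^sup>2)) / 2"
  proof -
    have "(u * v)\<^sup>2 \<le> (u\<^sup>2)\<^sup>2 + (v\<^sup>2)\<^sup>2" for u v :: real
      using sum_squares_bound[of "u\<^sup>2" "v\<^sup>2"] mult_nonneg_nonneg[of "u\<^sup>2" "v\<^sup>2"]
      unfolding power_mult_distrib mult.assoc by (smt (verit) zero_le_power2)
    then show ?thesis by (intro divide_right_mono add_mono) auto
  qed
  also have "\<dots> \<le> a ^ 4 + b ^ 4 + c ^ 4 + d ^ 4" by simp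
  finally show ?thesis .
qed

lemma pow4_add_le: "(a + b) ^ 4 \<le> 8 * (a ^ 4 + b ^ 4)" for a b :: real
proof -
  have sq: "(u + v)\<^sup>2 \<le> 2 * (u\<^sup>2 + v\<^sup>2)" for u v :: real
    using zero_le_power2[of "u - v"] by (simp add: power2_sum power2_diff)
  have "((a + b)\<^sup>2)\<^sup>2 \<le> (2 * (a\<^sup>2 + b\<^sup>2))\<^sup>2" by (intro power_mono sq) auto
  also have "\<dots> = 4 * (a\<^sup>2 + b\<^sup>2)\<^sup>2" by (simp only: power_mult_distrib) simp
  also have "\<dots> \<le> 4 * (2 * ((a\<^sup>2)\<^sup>2 + (b\<^sup>2)\<^sup>2))" by (intro mult_left_mono sq) auto
  finally show ?thesis by simp
qed

text \<open>The arithmetic-geometric mean inequality, from the factorization of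
  \<open>a^3 + b^3 + c^3 - 3abc\<close>. Its constant enters the estimate of the Taylor
  remainder.\<close>

lemma mult3_le_sum_pow3:
  fixes a b c :: real
  assumes "0 \<le> a" "0 \<le> b" "0 \<le> c"
  shows "a * b * c \<le> (a ^ 3 + b ^ 3 + c ^ 3) / 3"
proof -
  have "a ^ 3 + b ^ 3 + c ^ 3 - 3 * (a * b * c) = (a + b + c) * ((a - b)\<^sup>2 + (b - c)\<^sup>2 + (a - c)\<^sup>2) / 2"
    by (simp add: power2_eq_square power3_eq_cube algebra_simps)
  moreover have "0 \<le> (a + b + c) * ((a - b)\<^sup>2 + (b - c)\<^sup>2 + (a - c)\<^sup>2) / 2"
    using assms by simp
  ultimately have "3 * (a * b * c) \<le> a ^ 3 + b ^ 3 + c ^ 3" by linarith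
  then show ?thesis by simp
qed

text \<open>Bernoulli's inequality for \<open>u / v\<close> says that the convex function
  \<open>u ^ p\<close> lies above its tangent at \<open>v\<close>. Both forms of Jensen's inequality
  below, for finite sums and for expectations, follow by taking \<open>v\<close> as the
  mean.\<close>

lemma power_ge_tangent:
  fixes u v :: real
  assumes "0 \<le> u" "0 \<le> v"
  shows "v ^ p + real p * v ^ (p - 1) * (u - v) \<le> u ^ p"
proof (cases "v = 0")
  case True
  then show ?thesis using assms by (cases p; cases "p - 1") auto
next
  case False
  then have v: "0 < v" using assms by simp
  have "1 + real p * (u / v - 1) \<le> (1 + (u / v - 1)) ^ p"
    by (rule Bernoulli_inequality) (use assms v in simp)
  then have "v ^ p * (1 + real p * (u / v - 1)) \<le> v ^ p * (u / v) ^ p"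
    using v by (intro mult_left_mono) auto
  also have "v ^ p * (u / v) ^ p = u ^ p" using v by (simp add: power_divide)
  also have "v ^ p * (1 + real p * (u / v - 1)) = v ^ p + real p * v ^ (p - 1) * (u - v)"
    using v by (cases p) (simp_all add: field_simps)
  finally show ?thesis .
qed

lemma power_sum_le:
  fixes b :: "'i \<Rightarrow> real"
  assumes "finite K" "card K \<le> m" "1 \<le> p"
  shows "\<bar>\<Sum>k\<in>K. b k\<bar> ^ p \<le> real m ^ (p - 1) * (\<Sum>k\<in>K. \<bar>b k\<bar> ^ p)"
proof (cases "K = {}")
  case True
  then show ?thesis using \<open>1 \<le> p\<close> by (simp add: power_0_left)
next
  case False
  define v where "v = (\<Sum>k\<in>K. \<bar>b k\<bar>) / card K"
  have c: "0 < real (card K)" using False assms by (simp add: card_gt_0_iff)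
  have "0 \<le> v" unfolding v_def by (intro divide_nonneg_nonneg sum_nonneg) auto
  have "(\<Sum>k\<in>K. v ^ p + real p * v ^ (p - 1) * (\<bar>b k\<bar> - v)) \<le> (\<Sum>k\<in>K. \<bar>b k\<bar> ^ p)"
    using \<open>0 \<le> v\<close> by (intro sum_mono power_ge_tangent) auto
  \<comment> \<open>The linear terms cancel because \<open>v\<close> is the mean of the
    \<open>\<bar>b k\<bar>\<close>.\<close>
  also have "(\<Sum>k\<in>K. v ^ p + real p * v ^ (p - 1) * (\<bar>b k\<bar> - v)) = card K * v ^ p"
    using c by (simp add: sum.distrib sum_distrib_left[symmetric] sum_subtractf v_def)
  finally have tangent: "card K * v ^ p \<le> (\<Sum>k\<in>K. \<bar>b k\<bar> ^ p)" .
  have "\<bar>\<Sum>k\<in>K. b k\<bar> ^ p \<le> (card K * v) ^ p"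
    using c by (intro power_mono) (simp_all add: v_def)
  also have "\<dots> = real (card K) ^ (p - 1) * (card K * v ^ p)"
    using \<open>1 \<le> p\<close> by (cases p) (simp_all add: power_mult_distrib)
  also have "\<dots> \<le> real m ^ (p - 1) * (\<Sum>k\<in>K. \<bar>b k\<bar> ^ p)"
    using assms tangent \<open>0 \<le> v\<close> by (intro mult_mono power_mono) auto
  finally show ?thesis .
qed

section \<open>Random variables with a fourth moment\<close>

text \<open>The class is closed under linear combinations, and products of up to four members are
  integrable; most integrability goals reduce to membership in it.\<close>

definition has_fourth_moment :: "'a measure \<Rightarrow> ('a \<Rightarrow> real) \<Rightarrow> bool" where
  "has_fourth_moment M f \<longleftrightarrow> f \<in> borel_measurable M \<and> integrable M (\<lambda>\<omega>. f \<omega> ^ 4)"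

context prob_space
begin

lemma fourth_moment_const: "has_fourth_moment M (\<lambda>_. c)"
  by (simp add: has_fourth_moment_def)

lemma fourth_moment_bound:
  assumes g: "has_fourth_moment M g" and f: "f \<in> borel_measurable M" and le: "\<And>\<omega>. \<bar>f \<omega>\<bar> \<le> g \<omega>"
  shows "has_fourth_moment M f"
  unfolding has_fourth_moment_def
proof (rule conjI[OF f], rule Bochner_Integration.integrable_bound)
  show "integrable M (\<lambda>\<omega>. g \<omega> ^ 4)" using g by (simp add: has_fourth_moment_def)
  have "\<bar>f \<omega>\<bar> ^ 4 \<le> g \<omega> ^ 4" for \<omega> using le by (intro power_mono) auto
  then show "AE \<omega> in M. norm (f \<omega> ^ 4) \<le> norm (g \<omega> ^ 4)" by (simp add: power_abs)
qed (use f in measurable)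

lemma fourth_moment_abs: "has_fourth_moment M f \<Longrightarrow> has_fourth_moment M (\<lambda>\<omega>. \<bar>f \<omega>\<bar>)"
  unfolding has_fourth_moment_def by (auto simp: power_even_abs intro: borel_measurable_abs)

lemma fourth_moment_cmult: "has_fourth_moment M f \<Longrightarrow> has_fourth_moment M (\<lambda>\<omega>. c * f \<omega>)"
  unfolding has_fourth_moment_def by (auto simp: power_mult_distrib)

lemma fourth_moment_add:
  assumes "has_fourth_moment M f" "has_fourth_moment M g"
  shows "has_fourth_moment M (\<lambda>\<omega>. f \<omega> + g \<omega>)"
  unfolding has_fourth_moment_def
proof (rule conjI, goal_cases)
  case 1
  show ?case using assms by (auto simp: has_fourth_moment_def)
next
  case 2
  show ?case
  proof (rule Bochner_Integration.integrable_bound)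
  have [measurable]: "f \<in> borel_measurable M" "g \<in> borel_measurable M"
    using assms by (auto simp: has_fourth_moment_def)
  show "(\<lambda>\<omega>. (f \<omega> + g \<omega>) ^ 4) \<in> borel_measurable M" by measurable
  show "integrable M (\<lambda>\<omega>. 8 * (f \<omega> ^ 4 + g \<omega> ^ 4))"
    using assms by (simp add: has_fourth_moment_def)
  show "AE \<omega> in M. norm ((f \<omega> + g \<omega>) ^ 4) \<le> norm (8 * (f \<omega> ^ 4 + g \<omega> ^ 4))"
    using pow4_add_le by (intro AE_I2) simp
  qed
qed

lemma fourth_moment_diff:
  assumes "has_fourth_moment M f" "has_fourth_moment M g"
  shows "has_fourth_moment M (\<lambda>\<omega>. f \<omega> - g \<omega>)"
  using fourth_moment_add[OF assms(1) fourth_moment_cmult[OF assms(2), of "-1"]] by simp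

lemma fourth_moment_sum:
  "(\<And>i. i \<in> I \<Longrightarrow> has_fourth_moment M (f i)) \<Longrightarrow> has_fourth_moment M (\<lambda>\<omega>. \<Sum>i\<in>I. f i \<omega>)"
  by (induction I rule: infinite_finite_induct) (auto intro: fourth_moment_add fourth_moment_const)

lemma integrable_mult4:
  assumes "has_fourth_moment M f" "has_fourth_moment M g" "has_fourth_moment M h" "has_fourth_moment M k"
  shows "integrable M (\<lambda>\<omega>. f \<omega> * g \<omega> * h \<omega> * k \<omega>)"
proof (rule Bochner_Integration.integrable_bound)
  have [measurable]: "f \<in> borel_measurable M" "g \<in> borel_measurable M" "h \<in> borel_measurable M" "k \<in> borel_measurable M"
    using assms by (auto simp: has_fourth_moment_def)
  show "(\<lambda>\<omega>. f \<omega> * g \<omega> * h \<omega> * k \<omega>) \<in> borel_measurable M" by measurable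
  show "integrable M (\<lambda>\<omega>. f \<omega> ^ 4 + g \<omega> ^ 4 + h \<omega> ^ 4 + k \<omega> ^ 4)"
    using assms by (simp add: has_fourth_moment_def)
  show "AE \<omega> in M. norm (f \<omega> * g \<omega> * h \<omega> * k \<omega>) \<le> norm (f \<omega> ^ 4 + g \<omega> ^ 4 + h \<omega> ^ 4 + k \<omega> ^ 4)"
    using mult4_le_sum_pow4 by (intro AE_I2) (simp add: order_trans[OF _ abs_ge_self])
qed

lemma integrable_mult3:
  "has_fourth_moment M f \<Longrightarrow> has_fourth_moment M g \<Longrightarrow> has_fourth_moment M h \<Longrightarrow>
    integrable M (\<lambda>\<omega>. f \<omega> * g \<omega> * h \<omega>)"
  using integrable_mult4[OF _ _ _ fourth_moment_const[of 1]] by simp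

lemma integrable_mult2:
  "has_fourth_moment M f \<Longrightarrow> has_fourth_moment M g \<Longrightarrow> integrable M (\<lambda>\<omega>. f \<omega> * g \<omega>)"
  using integrable_mult3[OF _ _ fourth_moment_const[of 1]] by simp

lemma fourth_moment_integrable: "has_fourth_moment M f \<Longrightarrow> integrable M f"
  using integrable_mult2[OF _ fourth_moment_const[of 1]] by simp

lemma fourth_moment_integrable_power:
  assumes "has_fourth_moment M f" "p \<le> 4"
  shows "integrable M (\<lambda>\<omega>. \<bar>f \<omega>\<bar> ^ p)"
proof -
  note f = fourth_moment_abs[OF assms(1)]
  consider "p = 0" | "p = 1" | "p = 2" | "p = 3" | "p = 4" using assms(2) by linarith
  then show ?thesis
  proof cases
    case 2
    then show ?thesis using fourth_moment_integrable[OF f] by simp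
  next
    case 3
    then show ?thesis using integrable_mult2[OF f f] by (simp only: power2_eq_square)
  next
    case 4
    then show ?thesis using integrable_mult3[OF f f f] by (simp only: power3_eq_cube)
  next
    case 5
    then show ?thesis using f by (simp only: has_fourth_moment_def)
  qed simp
qed

lemma abs_expectation_power_le:
  fixes f :: "'a \<Rightarrow> real"
  assumes "integrable M f" "integrable M (\<lambda>\<omega>. \<bar>f \<omega>\<bar> ^ p)"
  shows "\<bar>expectation f\<bar> ^ p \<le> expectation (\<lambda>\<omega>. \<bar>f \<omega>\<bar> ^ p)"
proof -
  let ?v = "expectation (\<lambda>\<omega>. \<bar>f \<omega>\<bar>)"
  have "0 \<le> ?v" by (rule Bochner_Integration.integral_nonneg) simp
  have "\<bar>expectation f\<bar> ^ p \<le> ?v ^ p" by (intro power_mono integral_abs_bound) simp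
  also have "\<dots> = expectation (\<lambda>\<omega>. ?v ^ p + real p * ?v ^ (p - 1) * (\<bar>f \<omega>\<bar> - ?v))"
    using assms by (simp add: prob_space)
  also have "\<dots> \<le> expectation (\<lambda>\<omega>. \<bar>f \<omega>\<bar> ^ p)"
    using assms \<open>0 \<le> ?v\<close> by (intro integral_mono power_ge_tangent) auto
  finally show ?thesis .
qed

text \<open>
  Only pairs \<open>l, l'\<close> with \<open>\<bar>l - l'\<bar> < r\<close> contribute to the variance, and each covariance is at most
  the mean of the two variances.
\<close>

lemma variance_local_dependence:
  fixes W :: "nat \<Rightarrow> 'a \<Rightarrow> real"
  assumes "finite L"
    and int: "\<And>l. l \<in> L \<Longrightarrow> integrable M (W l)" "\<And>l. l \<in> L \<Longrightarrow> integrable M (\<lambda>\<omega>. (W l \<omega>)\<^sup>2)"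
    and indep: "\<And>l l'. l \<in> L \<Longrightarrow> l' \<in> L \<Longrightarrow> l + r \<le> l' \<Longrightarrow> indep_var borel (W l) borel (W l')"
    and c: "2 * real r \<le> c"
  shows "(expectation (\<lambda>\<omega>. \<bar>(\<Sum>l\<in>L. W l \<omega>) - (\<Sum>l\<in>L. expectation (W l))\<bar>))\<^sup>2
    \<le> c * (\<Sum>l\<in>L. expectation (\<lambda>\<omega>. (W l \<omega>)\<^sup>2))"
proof -
  define V where "V l \<omega> = W l \<omega> - expectation (W l)" for l \<omega>
  have V_int: "integrable M (V l)" "integrable M (\<lambda>\<omega>. (V l \<omega>)\<^sup>2)" if "l \<in> L" for l
    using int[OF that] by (simp_all add: V_def[abs_def] power2_diff)
  have V_mult_int: "integrable M (\<lambda>\<omega>. V l \<omega> * V l' \<omega>)" if "l \<in> L" "l' \<in> L" for l l'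
  proof (rule Bochner_Integration.integrable_bound)
    show "integrable M (\<lambda>\<omega>. ((V l \<omega>)\<^sup>2 + (V l' \<omega>)\<^sup>2) / 2)" using V_int that by simp
    show "(\<lambda>\<omega>. V l \<omega> * V l' \<omega>) \<in> borel_measurable M"
      using V_int that borel_measurable_integrable by (intro borel_measurable_times) auto
    show "AE \<omega> in M. norm (V l \<omega> * V l' \<omega>) \<le> norm (((V l \<omega>)\<^sup>2 + (V l' \<omega>)\<^sup>2) / 2)"
      using abs_mult_le_half_sum_squares by (intro AE_I2) simp
  qed
  define e where "e l = expectation (\<lambda>\<omega>. (V l \<omega>)\<^sup>2)" for l
  have e_nonneg: "0 \<le> e l" for l by (simp add: e_def)
  have far: "expectation (\<lambda>\<omega>. V l \<omega> * V l' \<omega>) = 0" if "l \<in> L" "l' \<in> L" "l + r \<le> l'" for l l'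
  proof -
    have "indep_var borel (V l) borel (V l')"
      using indep_var_compose[OF indep[OF that], of "\<lambda>x. x - expectation (W l)" borel "\<lambda>x. x - expectation (W l')" borel]
      by (simp add: V_def[abs_def] o_def)
    then have "expectation (\<lambda>\<omega>. V l \<omega> * V l' \<omega>) = expectation (V l) * expectation (V l')"
      using V_int that by (intro indep_var_lebesgue_integral) auto
    moreover have "expectation (V l) = 0" using int(1)[OF that(1)] by (simp add: V_def[abs_def] prob_space)
    ultimately show ?thesis by simp
  qed
  \<comment> \<open>Indices at distance less than \<open>r\<close>. The relation is symmetric, and
    truncated subtraction in the interval of \<open>near_card\<close> can only lower the
    count.\<close>
  define near where "near l = {l' \<in> L. l < l' + r \<and> l' < l + r}" for l
  have near_card: "real (card (near l)) \<le> c" for l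
  proof -
    have "near l \<subseteq> {l + 1 - r..<l + r}" by (auto simp: near_def)
    then have "card (near l) \<le> card {l + 1 - r..<l + r}" by (intro card_mono) auto
    then show ?thesis using c by simp
  qed
  have pair: "expectation (\<lambda>\<omega>. V l \<omega> * V l' \<omega>) \<le> (if l' \<in> near l then (e l + e l') / 2 else 0)"
    if "l \<in> L" "l' \<in> L" for l l'
  proof (cases "l' \<in> near l")
    case True
    have "expectation (\<lambda>\<omega>. V l \<omega> * V l' \<omega>) \<le> expectation (\<lambda>\<omega>. ((V l \<omega>)\<^sup>2 + (V l' \<omega>)\<^sup>2) / 2)"
    proof (intro integral_mono V_mult_int that)
      show "integrable M (\<lambda>\<omega>. ((V l \<omega>)\<^sup>2 + (V l' \<omega>)\<^sup>2) / 2)" using V_int that by simp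
      show "V l \<omega> * V l' \<omega> \<le> ((V l \<omega>)\<^sup>2 + (V l' \<omega>)\<^sup>2) / 2" for \<omega>
        using sum_squares_bound[of "V l \<omega>" "V l' \<omega>"] by simp
    qed
    then show ?thesis using True V_int that by (simp add: e_def)
  next
    case False
    then have "l + r \<le> l' \<or> l' + r \<le> l" using that by (auto simp: near_def)
    then show ?thesis using far[of l l'] far[of l' l] that False by (auto simp: mult.commute)
  qed
  have sq: "(\<Sum>l\<in>L. V l \<omega>)\<^sup>2 = (\<Sum>l\<in>L. \<Sum>l'\<in>L. V l \<omega> * V l' \<omega>)" for \<omega>
    by (simp add: power2_eq_square sum_product)
  have V_sum: "(\<Sum>l\<in>L. W l \<omega>) - (\<Sum>l\<in>L. expectation (W l)) = (\<Sum>l\<in>L. V l \<omega>)" for \<omega>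
    by (simp add: V_def sum_subtractf)
  have "(expectation (\<lambda>\<omega>. \<bar>\<Sum>l\<in>L. V l \<omega>\<bar>))\<^sup>2 \<le> expectation (\<lambda>\<omega>. \<bar>\<Sum>l\<in>L. V l \<omega>\<bar> ^ 2)"
    using abs_expectation_power_le[of "\<lambda>\<omega>. \<bar>\<Sum>l\<in>L. V l \<omega>\<bar>" 2] V_int V_mult_int
    by (simp add: sq)
  also have "\<dots> = (\<Sum>l\<in>L. \<Sum>l'\<in>L. expectation (\<lambda>\<omega>. V l \<omega> * V l' \<omega>))"
    using V_mult_int by (simp add: sq)
  also have "\<dots> \<le> (\<Sum>l\<in>L. \<Sum>l'\<in>L. if l' \<in> near l then (e l + e l') / 2 else 0)"
    using pair by (intro sum_mono) auto
  \<comment> \<open>By symmetry of \<open>near\<close>, the half belonging to \<open>l'\<close> may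
    be charged to \<open>l'\<close>; exchanging the two sums then gives the same sum twice.\<close>
  also have "\<dots> = (\<Sum>l\<in>L. \<Sum>l'\<in>L. (if l' \<in> near l then e l / 2 else 0) + (if l \<in> near l' then e l' / 2 else 0))"
    by (intro sum.cong refl) (auto simp: near_def add_divide_distrib)
  also have "\<dots> = (\<Sum>l\<in>L. \<Sum>l'\<in>L. if l' \<in> near l then e l / 2 else 0) + (\<Sum>l\<in>L. \<Sum>l'\<in>L. if l' \<in> near l then e l / 2 else 0)"
    unfolding sum.distrib by (subst sum.swap[of "\<lambda>l l'. if l \<in> near l' then e l' / 2 else 0"]) simp
  also have "\<dots> = (\<Sum>l\<in>L. real (card (near l)) * e l)"
  proof -
    have "(\<Sum>l'\<in>L. if l' \<in> near l then e l / 2 else 0) = real (card (near l)) * e l / 2" for l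
    proof -
      have "L \<inter> near l = near l" by (auto simp: near_def)
      then show ?thesis using \<open>finite L\<close> by (simp add: sum.If_cases)
    qed
    then show ?thesis by (simp only: sum.distrib[symmetric]) (simp add: mult.commute)
  qed
  also have "\<dots> \<le> (\<Sum>l\<in>L. c * expectation (\<lambda>\<omega>. (W l \<omega>)\<^sup>2))"
  proof (rule sum_mono)
    fix l assume "l \<in> L"
    then have "e l = expectation (\<lambda>\<omega>. (W l \<omega>)\<^sup>2) - (expectation (W l))\<^sup>2"
      unfolding e_def V_def using int by (intro variance_eq) auto
    then have "e l \<le> expectation (\<lambda>\<omega>. (W l \<omega>)\<^sup>2)" by simp
    moreover have "0 \<le> c" using c by linarith
    ultimately show "real (card (near l)) * e l \<le> c * expectation (\<lambda>\<omega>. (W l \<omega>)\<^sup>2)"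
      using near_card[of l] e_nonneg[of l] by (intro mult_mono)
  qed
  finally show ?thesis by (simp only: V_sum sum_distrib_left)
qed

end

section \<open>Characteristic functions determine the law\<close>

text \<open>The phase \<open>c\<close> makes sines and constants special cases, so that sums of
  waves form an algebra.\<close>

inductive trig_poly :: "('a::euclidean_space \<Rightarrow> real) \<Rightarrow> bool" where
  wave: "trig_poly (\<lambda>x. r * cos (v \<bullet> x + c))"
| add: "trig_poly p \<Longrightarrow> trig_poly q \<Longrightarrow> trig_poly (\<lambda>x. p x + q x)"

lemma trig_poly_const: "trig_poly (\<lambda>x. r)"
  using trig_poly.wave[of r 0 0] by simp

lemma trig_poly_sum: "(\<And>i. i \<in> I \<Longrightarrow> trig_poly (p i)) \<Longrightarrow> trig_poly (\<lambda>x. \<Sum>i\<in>I. p i x)"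
  by (induction I rule: infinite_finite_induct) (auto intro: trig_poly.add trig_poly_const)

lemma trig_poly_mult:
  assumes "trig_poly p" "trig_poly q"
  shows "trig_poly (\<lambda>x. p x * q x)"
  using assms(1)
proof induction
  case (wave r v c)
  show ?case using assms(2)
  proof induction
    case (wave r' v' c')
    have "r * cos (v \<bullet> x + c) * (r' * cos (v' \<bullet> x + c'))
        = r * r' / 2 * cos ((v - v') \<bullet> x + (c - c')) + r * r' / 2 * cos ((v + v') \<bullet> x + (c + c'))" for x
    proof -
      have "(v - v') \<bullet> x + (c - c') = (v \<bullet> x + c) - (v' \<bullet> x + c')"
        "(v + v') \<bullet> x + (c + c') = (v \<bullet> x + c) + (v' \<bullet> x + c')"
        by (simp_all add: inner_add_left inner_diff_left)
      then show ?thesis by (simp only: cos_add cos_diff) (simp add: field_simps)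
    qed
    then show ?case by (simp only:) (intro trig_poly.intros)
  next
    case (add p q)
    then show ?case by (simp add: distrib_left trig_poly.add)
  qed
next
  case (add p q)
  then show ?case by (simp add: distrib_right trig_poly.add)
qed

lemma trig_poly_bounded_continuous:
  assumes "trig_poly p"
  shows "continuous_on UNIV p" "\<exists>B. \<forall>x. \<bar>p x\<bar> \<le> B"
  using assms
proof (induction)
  case (wave r v c)
  { case 1 show ?case by (intro continuous_intros) }
  { case 2
    have "\<bar>r * cos (v \<bullet> x + c)\<bar> \<le> \<bar>r\<bar>" for x by (simp add: abs_mult mult_left_le)
    then show ?case by blast }
next
  case (add p q)
  { case 1 then show ?case using add by (intro continuous_intros) }
  { case 2
    obtain B B' where "\<And>x. \<bar>p x\<bar> \<le> B" "\<And>x. \<bar>q x\<bar> \<le> B'" using add by blast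
    then have "\<bar>p x + q x\<bar> \<le> B + B'" for x by (metis abs_triangle_ineq add_mono order_trans)
    then show ?case by blast }
qed

text \<open>A sine is a cosine with phase \<open>- pi / 2\<close>; closure under sums and products
  does the rest.\<close>

lemma trig_poly_polynomial_sin:
  assumes "real_polynomial_function p"
  shows "trig_poly (\<lambda>x. p (\<Sum>b\<in>Basis. sin (k * (b \<bullet> x)) *\<^sub>R b))"
  using assms
proof induction
  case (linear f)
  have "f (\<Sum>b\<in>Basis. sin (k * (b \<bullet> x)) *\<^sub>R b) = (\<Sum>b\<in>Basis. f b * cos ((k *\<^sub>R b) \<bullet> x + (- pi / 2)))" for x
    by (simp add: linear_sum linear linear_scale[OF bounded_linear.linear[OF linear]]
        linear_sum[OF bounded_linear.linear[OF linear]] cos_diff mult.commute)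
  then show ?case by (simp only:) (intro trig_poly_sum trig_poly.wave)
qed (auto intro: trig_poly_const trig_poly.add trig_poly_mult)

lemma (in prob_space) integrable_bounded_continuous:
  fixes Y :: "'a \<Rightarrow> 'b::euclidean_space" and h :: "'b \<Rightarrow> real"
  assumes "random_variable borel Y" "continuous_on UNIV h" "\<And>x. \<bar>h x\<bar> \<le> B"
  shows "integrable M (\<lambda>\<omega>. h (Y \<omega>))"
  using assms borel_measurable_continuous_onI[OF assms(2)]
  by (intro integrable_const_bound[of _ B]) auto

lemma expectation_trig_poly_eq:
  fixes Y :: "'a \<Rightarrow> 'e::euclidean_space" and Y' :: "'b \<Rightarrow> 'e"
  assumes "prob_space M" "prob_space M'"
    and [measurable]: "Y \<in> borel_measurable M" "Y' \<in> borel_measurable M'"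
    and char: "\<And>v. (\<integral>\<omega>. iexp (v \<bullet> Y \<omega>) \<partial>M) = (\<integral>\<omega>. iexp (v \<bullet> Y' \<omega>) \<partial>M')"
    and "trig_poly p"
  shows "(\<integral>\<omega>. p (Y \<omega>) \<partial>M) = (\<integral>\<omega>. p (Y' \<omega>) \<partial>M')"
  using assms(6)
proof induction
  case (wave r v c)
  interpret M: prob_space M by fact
  interpret M': prob_space M' by fact
  have "(\<integral>\<omega>. r * cos (v \<bullet> Z \<omega> + c) \<partial>N) = r * Re (iexp c * (\<integral>\<omega>. iexp (v \<bullet> Z \<omega>) \<partial>N))"
    if "prob_space N" and [measurable]: "Z \<in> borel_measurable N" for N :: "'n measure" and Z :: "'n \<Rightarrow> 'e"
  proof -
    interpret prob_space N by fact
    have int: "integrable N (\<lambda>\<omega>. iexp (v \<bullet> Z \<omega>))"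
      by (intro integrable_const_bound[of _ 1]) auto
    have "(\<lambda>\<omega>. r * cos (v \<bullet> Z \<omega> + c)) = (\<lambda>\<omega>. r * Re (iexp c * iexp (v \<bullet> Z \<omega>)))"
      by (simp add: exp_add[symmetric] Re_exp add.commute del: times_complex.simps)
    then have "(\<integral>\<omega>. r * cos (v \<bullet> Z \<omega> + c) \<partial>N) = (\<integral>\<omega>. r * Re (iexp c * iexp (v \<bullet> Z \<omega>)) \<partial>N)"
      by (simp only:)
    also have "\<dots> = r * Re (\<integral>\<omega>. iexp c * iexp (v \<bullet> Z \<omega>) \<partial>N)"
      using int by (simp add: integral_Re[symmetric] del: times_complex.simps)
    also have "\<dots> = r * Re (iexp c * (\<integral>\<omega>. iexp (v \<bullet> Z \<omega>) \<partial>N))"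
      by (simp only: integral_mult_right_zero)
    finally show ?thesis .
  qed
  from this[OF assms(1,3)] this[OF assms(2,4)] show ?case by (simp only: char)
next
  case (add p q)
  interpret M: prob_space M by fact
  interpret M': prob_space M' by fact
  have "integrable M (\<lambda>\<omega>. p (Y \<omega>))" "integrable M' (\<lambda>\<omega>. p (Y' \<omega>))"
      "integrable M (\<lambda>\<omega>. q (Y \<omega>))" "integrable M' (\<lambda>\<omega>. q (Y' \<omega>))"
    using trig_poly_bounded_continuous[OF add.hyps(1)] trig_poly_bounded_continuous[OF add.hyps(2)]
    by (auto intro: M.integrable_bounded_continuous M'.integrable_bounded_continuous)
  then show ?case using add by simp
qed

text \<open>
  On the compact range of \<open>x \<mapsto> (sin (x\<^sub>i / L))\<^sub>i\<close> the function \<open>h (L z)\<close> is a uniform limit of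
  polynomials, and \<open>L sin (x\<^sub>i / L) \<longrightarrow> x\<^sub>i\<close> as \<open>L \<longrightarrow> \<infinity>\<close>.
\<close>

lemma expectation_bounded_continuous_eq:
  fixes Y :: "'a \<Rightarrow> 'e::euclidean_space" and Y' :: "'b \<Rightarrow> 'e" and h :: "'e \<Rightarrow> real"
  assumes M: "prob_space M" "prob_space M'"
    and Y[measurable]: "Y \<in> borel_measurable M" "Y' \<in> borel_measurable M'"
    and char: "\<And>v. (\<integral>\<omega>. iexp (v \<bullet> Y \<omega>) \<partial>M) = (\<integral>\<omega>. iexp (v \<bullet> Y' \<omega>) \<partial>M')"
    and h: "continuous_on UNIV h" "\<And>x. \<bar>h x\<bar> \<le> B"
  shows "(\<integral>\<omega>. h (Y \<omega>) \<partial>M) = (\<integral>\<omega>. h (Y' \<omega>) \<partial>M')"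
proof -
  define S where "S k x = (\<Sum>b\<in>Basis. sin (k * (b \<bullet> x)) *\<^sub>R b)" for k and x :: 'e
  have S_cont: "continuous_on UNIV (S k)" for k
    unfolding S_def by (intro continuous_intros)
  have S_bound: "norm (S k x) \<le> real DIM('e)" for k x
    unfolding S_def using sum_norm_le[of Basis "\<lambda>b. sin (k * (b \<bullet> x)) *\<^sub>R b" "\<lambda>_. 1"] by simp
  \<comment> \<open>\<open>H n\<close> sees \<open>x\<close> only through \<open>S\<close>, whose
    range lies in a fixed ball; this gives the Stone-Weierstrass theorem its compact set.\<close>
  define H where "H n x = h (real (Suc n) *\<^sub>R S (1 / real (Suc n)) x)" for n x
  have H_cont: "continuous_on UNIV (H n)" for n
    unfolding H_def by (intro continuous_on_compose2[OF h(1)] continuous_intros S_cont) auto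
  have H_bound: "\<bar>H n x\<bar> \<le> B" for n x unfolding H_def by (rule h(2))
  have H_int: "integrable N (\<lambda>\<omega>. H n (Z \<omega>))"
    if "prob_space N" "Z \<in> borel_measurable N" for N :: "'n measure" and Z n
    using that(2) by (rule prob_space.integrable_bounded_continuous[OF that(1) _ H_cont H_bound])
  have eq: "(\<integral>\<omega>. H n (Y \<omega>) \<partial>M) = (\<integral>\<omega>. H n (Y' \<omega>) \<partial>M')" for n
  proof -
    have "\<bar>(\<integral>\<omega>. H n (Y \<omega>) \<partial>M) - (\<integral>\<omega>. H n (Y' \<omega>) \<partial>M')\<bar> \<le> e" if "0 < e" for e
    proof -
      let ?k = "1 / real (Suc n)"
      have "continuous_on (cball 0 (real DIM('e))) (\<lambda>z. h (real (Suc n) *\<^sub>R z))"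
        by (intro continuous_on_compose2[OF h(1)] continuous_intros) auto
      then obtain p where p: "real_polynomial_function p"
        "\<And>z. z \<in> cball 0 (real DIM('e)) \<Longrightarrow> \<bar>h (real (Suc n) *\<^sub>R z) - p z\<bar> < e / 2"
        using Stone_Weierstrass_real_polynomial_function[OF compact_cball] \<open>0 < e\<close> by (metis half_gt_zero)
      define q where "q x = p (S ?k x)" for x
      have q: "trig_poly q"
        using trig_poly_polynomial_sin[OF p(1)] unfolding q_def S_def .
      have close: "\<bar>H n x - q x\<bar> \<le> e / 2" for x
        using p(2)[of "S ?k x"] S_bound by (simp add: H_def q_def less_imp_le)
      have near: "\<bar>(\<integral>\<omega>. H n (Z \<omega>) \<partial>N) - (\<integral>\<omega>. q (Z \<omega>) \<partial>N)\<bar> \<le> e / 2"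
        if N: "prob_space N" and Z: "Z \<in> borel_measurable N" for N :: "'n measure" and Z
      proof -
        interpret prob_space N by fact
        have qi: "integrable N (\<lambda>\<omega>. q (Z \<omega>))"
          using trig_poly_bounded_continuous[OF q] Z by (auto intro: integrable_bounded_continuous)
        have "\<bar>(\<integral>\<omega>. H n (Z \<omega>) - q (Z \<omega>) \<partial>N)\<bar> \<le> (\<integral>\<omega>. \<bar>H n (Z \<omega>) - q (Z \<omega>)\<bar> \<partial>N)"
          by (rule integral_abs_bound)
        also have "\<dots> \<le> (\<integral>\<omega>. e / 2 \<partial>N)"
          using qi H_int[OF N Z] close by (intro integral_mono) auto
        finally show ?thesis using qi H_int[OF N Z] by (simp add: prob_space)
      qed
      show ?thesis
        using near[OF M(1) Y(1)] near[OF M(2) Y(2)] expectation_trig_poly_eq[OF M Y char q] by linarith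
    qed
    then show ?thesis by (metis abs_ge_zero diff_0_right dense_ge eq_iff_diff_eq_0 abs_le_zero_iff)
  qed
  have lim: "(\<lambda>n. \<integral>\<omega>. H n (Z \<omega>) \<partial>N) \<longlonglongrightarrow> (\<integral>\<omega>. h (Z \<omega>) \<partial>N)"
    if N: "prob_space N" and Z: "Z \<in> borel_measurable N" for N :: "'n measure" and Z
  proof -
    interpret prob_space N by fact
    note [measurable] = Z borel_measurable_continuous_onI[OF h(1)] borel_measurable_continuous_onI[OF H_cont]
    have L: "(\<lambda>n. real (Suc n) * sin (1 / real (Suc n) * y)) \<longlonglongrightarrow> y" for y :: real
    proof -
      \<comment> \<open>This is the difference quotient of \<open>sin (t * y)\<close> at 0.\<close>
      have "((\<lambda>t. sin (t * y) / t) \<longlongrightarrow> y) (at 0)"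
        using has_field_derivative_iff[of "\<lambda>t. sin (t * y)" y 0 UNIV]
        by (auto intro!: derivative_eq_intros)
      moreover have "filterlim (\<lambda>n. 1 / real (Suc n)) (at 0) sequentially"
        by (rule filterlim_atI) (use LIMSEQ_inverse_real_of_nat in \<open>auto simp: inverse_eq_divide\<close>)
      ultimately have "(\<lambda>n. sin (1 / real (Suc n) * y) / (1 / real (Suc n))) \<longlonglongrightarrow> y"
        by (rule filterlim_compose)
      then show ?thesis by (simp add: mult.commute)
    qed
    have "(\<lambda>n. real (Suc n) *\<^sub>R S (1 / real (Suc n)) x) \<longlonglongrightarrow> x" for x
    proof -
      have "(\<lambda>n. \<Sum>b\<in>Basis. (real (Suc n) * sin (1 / real (Suc n) * (b \<bullet> x))) *\<^sub>R b) \<longlonglongrightarrow> (\<Sum>b\<in>Basis. (b \<bullet> x) *\<^sub>R b)"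
        by (intro tendsto_sum tendsto_scaleR L tendsto_const)
      then show ?thesis
        by (simp only: S_def scaleR_sum_right scaleR_scaleR inner_commute[of _ x] euclidean_representation)
    qed
    moreover have "isCont h x" for x using h(1) by (simp add: continuous_on_eq_continuous_at)
    ultimately have "(\<lambda>n. H n x) \<longlonglongrightarrow> h x" for x unfolding H_def using isCont_tendsto_compose by blast
    then show ?thesis
      using H_bound by (intro integral_dominated_convergence[where w = "\<lambda>_. B"]) auto
  qed
  show ?thesis
    using lim[OF M(1) Y(1)] lim[OF M(2) Y(2)] unfolding eq by (rule LIMSEQ_unique)
qed

text \<open>Indicators of open sets are pointwise limits of bounded continuous functions, and the
  open sets are an intersection-stable generator of the Borel sets.\<close>

theorem char_function_determines_distr:
  fixes Y :: "'a \<Rightarrow> 'e::euclidean_space" and Y' :: "'b \<Rightarrow> 'e"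
  assumes M: "prob_space M" "prob_space M'"
    and Y[measurable]: "Y \<in> borel_measurable M" "Y' \<in> borel_measurable M'"
    and char: "\<And>v. (\<integral>\<omega>. iexp (v \<bullet> Y \<omega>) \<partial>M) = (\<integral>\<omega>. iexp (v \<bullet> Y' \<omega>) \<partial>M')"
  shows "distr M borel Y = distr M' borel Y'"
proof -
  interpret D: prob_space "distr M borel Y" using M Y by (intro prob_space.prob_space_distr)
  interpret D': prob_space "distr M' borel Y'" using M Y by (intro prob_space.prob_space_distr)
  have eq: "measure (distr M borel Y) U = measure (distr M' borel Y') U" if U: "open U" for U
  \<comment> \<open>The whole space is treated separately because \<open>infdist\<close> to its
    empty complement is 0 by convention, so the functions \<open>h n\<close> would vanish
    identically.\<close>
  proof (cases "U = UNIV")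
    case True
    then show ?thesis using D.prob_space D'.prob_space by simp
  next
    case False
    define h where "h n x = min 1 (real n * infdist x (- U))" for n x
    have h: "continuous_on UNIV (h n)" "\<bar>h n x\<bar> \<le> 1" for n x
    proof -
      show "continuous_on UNIV (h n)" unfolding h_def by (intro continuous_intros)
      have "0 \<le> real n * infdist x (- U)" by (simp add: infdist_nonneg)
      then show "\<bar>h n x\<bar> \<le> 1" by (simp add: h_def)
    qed
    have lim: "(\<lambda>n. h n x) \<longlonglongrightarrow> indicator U x" for x
    proof (cases "x \<in> U")
      case True
      then have pos: "0 < infdist x (- U)"
        using U False by (metis Compl_iff closed_Compl in_closed_iff_infdist_zero infdist_nonneg less_eq_real_def Compl_empty_eq double_compl)
      obtain n0 where "1 < real n0 * infdist x (- U)"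
        using reals_Archimedean3[OF pos] by blast
      then have "1 \<le> real n * infdist x (- U)" if "n \<ge> n0" for n
        using that pos by (meson less_imp_le mult_right_mono of_nat_le_iff order_trans)
      then have "eventually (\<lambda>n. h n x = 1) sequentially"
        unfolding h_def eventually_sequentially by (auto simp: min_def)
      then show ?thesis using True by (simp add: tendsto_eventually)
    qed (simp add: h_def)
    have "(\<lambda>n. \<integral>\<omega>. h n (Z \<omega>) \<partial>N) \<longlonglongrightarrow> measure (distr N borel Z) U"
      if N: "prob_space N" and Z[measurable]: "Z \<in> borel_measurable N" for N :: "'n measure" and Z
    proof -
      interpret prob_space N by fact
      note [measurable] = borel_measurable_continuous_onI[OF h(1)] borel_open[OF U]
      have "(\<lambda>n. \<integral>\<omega>. h n (Z \<omega>) \<partial>N) \<longlonglongrightarrow> (\<integral>\<omega>. indicator U (Z \<omega>) \<partial>N)"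
        using h lim U by (intro integral_dominated_convergence[where w = "\<lambda>_. 1"]) auto
      also have "(\<integral>\<omega>. indicator U (Z \<omega>) \<partial>N) = (\<integral>x. indicator U x \<partial>distr N borel Z :: real)"
        using U by (subst integral_distr) auto
      finally show ?thesis using U by simp
    qed
    from this[OF M(1) Y(1)] this[OF M(2) Y(2)] show ?thesis
      unfolding expectation_bounded_continuous_eq[OF M Y char h] by (rule LIMSEQ_unique)
  qed
  show ?thesis
  proof (rule measure_eqI_generator_eq[where E = "{S. open S}" and \<Omega> = UNIV and A = "\<lambda>_. UNIV"])
    show "Int_stable {S :: 'e set. open S}" by (auto simp: Int_stable_def)
    show "sets (distr M borel Y) = sigma_sets UNIV {S. open S}"
      "sets (distr M' borel Y') = sigma_sets UNIV {S. open S}"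
      by (simp_all add: borel_def)
  qed (auto simp: D.emeasure_eq_measure D'.emeasure_eq_measure eq)
qed

section \<open>Gaussian integration by parts\<close>

lemma borel_measurable_vec_nth[measurable]: "(\<lambda>x :: real ^ 'd::finite. x $ i) \<in> borel_measurable borel"
  by (intro borel_measurable_continuous_onI continuous_intros)

lemma has_real_derivative_std_normal_density:
  "(std_normal_density has_real_derivative - z * std_normal_density z) (at z)"
  unfolding std_normal_density_def[abs_def]
  by (auto intro!: derivative_eq_intros simp: field_simps)

text \<open>The fundamental theorem on the whole line for \<open>std_normal_density z * f z\<close>:
  a bounded derivative lets \<open>f\<close> grow at most linearly, so the boundary terms
  vanish.\<close>

lemma std_normal_integration_by_parts:
  assumes f: "\<And>z. (f has_real_derivative f' z) (at z)"
    and cont: "continuous_on UNIV f'" and B: "\<And>z. \<bar>f' z\<bar> \<le> B"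
  shows "(\<integral>z. std_normal_density z * (z * f z) \<partial>lborel) = (\<integral>z. std_normal_density z * f' z \<partial>lborel)"
proof -
  have f_cont: "continuous_on UNIV f" 
    using f by (meson DERIV_isCont continuous_at_imp_continuous_on)
  note [measurable] = borel_measurable_continuous_onI[OF f_cont] borel_measurable_continuous_onI[OF cont]
  have growth: "\<bar>f z\<bar> \<le> \<bar>f 0\<bar> + B * \<bar>z\<bar>" for z
    using field_differentiable_bound[of UNIV f f' B z 0] f B by auto
  have int1: "integrable lborel (\<lambda>z. std_normal_density z * (z * f z))"
  proof (rule Bochner_Integration.integrable_bound)
    show "integrable lborel (\<lambda>z. \<bar>f 0\<bar> * (std_normal_density z * \<bar>z\<bar> ^ 1) + B * (std_normal_density z * \<bar>z\<bar> ^ 2))"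
      by (intro Bochner_Integration.integrable_add integrable_mult_right integrable_std_normal_moment_abs)
    show "AE z in lborel. norm (std_normal_density z * (z * f z))
        \<le> norm (\<bar>f 0\<bar> * (std_normal_density z * \<bar>z\<bar> ^ 1) + B * (std_normal_density z * \<bar>z\<bar> ^ 2))"
    proof (rule AE_I2)
      fix z
      have "norm (std_normal_density z * (z * f z)) = std_normal_density z * \<bar>z\<bar> * \<bar>f z\<bar>"
        by (simp add: abs_mult)
      also have "\<dots> \<le> std_normal_density z * \<bar>z\<bar> * (\<bar>f 0\<bar> + B * \<bar>z\<bar>)"
        using growth by (intro mult_left_mono) auto
      finally show "norm (std_normal_density z * (z * f z))
          \<le> norm (\<bar>f 0\<bar> * (std_normal_density z * \<bar>z\<bar> ^ 1) + B * (std_normal_density z * \<bar>z\<bar> ^ 2))"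
        by (simp add: algebra_simps power2_eq_square)
    qed
  qed simp
  have int2: "integrable lborel (\<lambda>z. std_normal_density z * f' z)"
  proof (rule Bochner_Integration.integrable_bound)
    show "integrable lborel (\<lambda>z. B * std_normal_density z)" by simp
    show "AE z in lborel. norm (std_normal_density z * f' z) \<le> norm (B * std_normal_density z)"
      using B by (auto simp: abs_mult mult.commute intro!: AE_I2 mult_right_mono order_trans[OF B])
  qed simp
  have std_cont: "continuous_on UNIV std_normal_density"
    by (meson DERIV_isCont continuous_at_imp_continuous_on has_real_derivative_std_normal_density)
  have D: "((\<lambda>z. std_normal_density z * f z) has_real_derivative
      (std_normal_density z * f' z - std_normal_density z * (z * f z))) (at z)" for z
    by (rule DERIV_cong[OF DERIV_mult[OF has_real_derivative_std_normal_density f]]) (simp add: algebra_simps)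
  have bound: "norm (std_normal_density z * f z) \<le> std_normal_density z * (\<bar>f 0\<bar> + B * \<bar>z\<bar>)" for z
    using growth by (simp add: abs_mult mult_left_mono)
  have "((\<lambda>z. std_normal_density z * (\<bar>f 0\<bar> + B * \<bar>z\<bar>)) \<longlongrightarrow> 0) at_top"
    "((\<lambda>z. std_normal_density z * (\<bar>f 0\<bar> + B * \<bar>z\<bar>)) \<longlongrightarrow> 0) at_bot"
    unfolding std_normal_density_def by real_asymp+
  from this[THEN Lim_null_comparison[OF always_eventually[OF allI[OF bound]]]]
  have lim: "((\<lambda>z. std_normal_density z * f z) \<longlongrightarrow> 0) at_top"
    "((\<lambda>z. std_normal_density z * f z) \<longlongrightarrow> 0) at_bot" .
  have "(LBINT z=-\<infinity>..\<infinity>. std_normal_density z * f' z - std_normal_density z * (z * f z)) = 0 - 0"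
  proof (rule interval_integral_FTC_integrable)
    show "((\<lambda>z. std_normal_density z * f z) has_vector_derivative
        std_normal_density x * f' x - std_normal_density x * (x * f x)) (at x)" for x
      using D by (simp add: has_real_derivative_iff_has_vector_derivative)
    show "isCont (\<lambda>z. std_normal_density z * f' z - std_normal_density z * (z * f z)) x" for x
      using std_cont cont f_cont by (intro continuous_intros) (auto simp: continuous_on_eq_continuous_at)
    show "set_integrable lborel (einterval (- \<infinity>) \<infinity>) (\<lambda>z. std_normal_density z * f' z - std_normal_density z * (z * f z))"
      using int1 int2 by (simp add: set_integrable_def)
    show "(((\<lambda>z. std_normal_density z * f z) \<circ> real_of_ereal) \<longlongrightarrow> 0) (at_right (- \<infinity>))"
      "(((\<lambda>z. std_normal_density z * f z) \<circ> real_of_ereal) \<longlongrightarrow> 0) (at_left \<infinity>)"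
      using lim by (simp_all add: ereal_tendsto_simps1)
  qed simp
  then have "(\<integral>z. std_normal_density z * f' z - std_normal_density z * (z * f z) \<partial>lborel) = 0"
    by (simp add: interval_lebesgue_integral_def set_lebesgue_integral_def)
  then show ?thesis using int1 int2 by simp
qed

locale centered_gaussian = prob_space M for M :: "'a measure" +
  fixes Y :: "'a \<Rightarrow> real ^ 'd::finite"
  assumes gaussian: "gaussian_vector M Y" and centered: "centered M Y"
begin

lemma measurable_Y[measurable]: "Y \<in> borel_measurable M"
  using gaussian by (simp add: gaussian_vector_def)

lemma inner_integrable: "integrable M (\<lambda>\<omega>. v \<bullet> Y \<omega>)"
  and inner_expectation: "expectation (\<lambda>\<omega>. v \<bullet> Y \<omega>) = 0"
  using centered by (auto simp: centered_def inner_vec_def)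

text \<open>The law enters only through its variance: since the mean is zero, the degenerate and the
  nondegenerate case lead to the same formula for the characteristic function.\<close>

lemma inner_law:
  shows inner_square_integrable: "integrable M (\<lambda>\<omega>. (v \<bullet> Y \<omega>)\<^sup>2)"
    and inner_char: "expectation (\<lambda>\<omega>. iexp (v \<bullet> Y \<omega>)) = exp (- (expectation (\<lambda>\<omega>. (v \<bullet> Y \<omega>)\<^sup>2) / 2))"
proof -
  obtain \<mu> \<sigma> where "0 \<le> \<sigma>" and law: "distr M borel (\<lambda>\<omega>. v \<bullet> Y \<omega>) = gaussian_law \<mu> \<sigma>"
    using gaussian unfolding gaussian_vector_def by blast
  have "integrable M (\<lambda>\<omega>. (v \<bullet> Y \<omega>)\<^sup>2) \<and>
    expectation (\<lambda>\<omega>. iexp (v \<bullet> Y \<omega>)) = exp (- (expectation (\<lambda>\<omega>. (v \<bullet> Y \<omega>)\<^sup>2) / 2))"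
  proof (cases "\<sigma> = 0")
    \<comment> \<open>A constant variable with mean zero is zero almost surely.\<close>
    case True
    then have law0: "distr M borel (\<lambda>\<omega>. v \<bullet> Y \<omega>) = return borel \<mu>"
      using law by (simp add: gaussian_law_def)
    have "AE x in return borel \<mu>. x = \<mu>" by (subst AE_return) auto
    then have "AE \<omega> in M. v \<bullet> Y \<omega> = \<mu>"
      unfolding law0[symmetric] by (subst (asm) AE_distr_iff) auto
    moreover from this have "expectation (\<lambda>\<omega>. v \<bullet> Y \<omega>) = expectation (\<lambda>_. \<mu>)"
      by (intro integral_cong_AE) auto
    ultimately have AE0: "AE \<omega> in M. v \<bullet> Y \<omega> = 0"
      using inner_expectation by (simp add: prob_space)
    then have "integrable M (\<lambda>\<omega>. (v \<bullet> Y \<omega>)\<^sup>2) \<longleftrightarrow> integrable M (\<lambda>\<omega>. 0 :: real)"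
      by (intro integrable_cong_AE) auto
    moreover have "expectation (\<lambda>\<omega>. (v \<bullet> Y \<omega>)\<^sup>2) = expectation (\<lambda>\<omega>. 0)"
      using AE0 by (intro integral_cong_AE) auto
    moreover have "expectation (\<lambda>\<omega>. iexp (v \<bullet> Y \<omega>)) = expectation (\<lambda>\<omega>. 1)"
      using AE0 by (intro integral_cong_AE) auto
    ultimately show ?thesis by (simp add: prob_space)
  next
    case False
    then have \<sigma>: "0 < \<sigma>" using \<open>0 \<le> \<sigma>\<close> by simp
    have "distr M lborel (\<lambda>\<omega>. v \<bullet> Y \<omega>) = distr M borel (\<lambda>\<omega>. v \<bullet> Y \<omega>)"
      by (rule distr_cong) auto
    then have D: "distributed M lborel (\<lambda>\<omega>. v \<bullet> Y \<omega>) (normal_density \<mu> \<sigma>)"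
      using law False by (simp add: distributed_def gaussian_law_def)
    then have \<mu>: "\<mu> = 0"
      using normal_distributed_expectation[OF \<sigma> D] inner_expectation[of v] by simp
    then have var: "expectation (\<lambda>\<omega>. (v \<bullet> Y \<omega>)\<^sup>2) = \<sigma>\<^sup>2"
      using normal_distributed_variance[OF \<sigma> D] inner_expectation by simp
    have std: "distributed M lborel (\<lambda>\<omega>. (v \<bullet> Y \<omega> - \<mu>) / \<sigma>) std_normal_density"
      using D by (simp only: normal_standard_normal_convert[OF \<sigma>, of "\<lambda>\<omega>. v \<bullet> Y \<omega>" \<mu>])
    have "expectation (\<lambda>\<omega>. iexp (v \<bullet> Y \<omega>)) = (\<integral>\<omega>. iexp (\<sigma> * ((v \<bullet> Y \<omega> - \<mu>) / \<sigma>)) \<partial>M)"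
      using \<sigma> \<mu> by simp
    also have "\<dots> = (\<integral>x. iexp (\<sigma> * x) \<partial>distr M lborel (\<lambda>\<omega>. (v \<bullet> Y \<omega> - \<mu>) / \<sigma>))"
      by (subst integral_distr) auto
    also have "\<dots> = char std_normal_distribution \<sigma>"
      using std by (simp add: distributed_def char_def)
    also have "\<dots> = exp (- (expectation (\<lambda>\<omega>. (v \<bullet> Y \<omega>)\<^sup>2) / 2))"
      by (simp add: char_std_normal_distribution var exp_of_real)
    finally have "expectation (\<lambda>\<omega>. iexp (v \<bullet> Y \<omega>)) = exp (- (expectation (\<lambda>\<omega>. (v \<bullet> Y \<omega>)\<^sup>2) / 2))" .
    moreover have "integrable M (\<lambda>\<omega>. (v \<bullet> Y \<omega>)\<^sup>2)"
      using distributed_integrable[OF D, of "\<lambda>x. x\<^sup>2"] integrable_normal_moment[OF \<sigma>, of 0 2] \<mu> by simp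
    ultimately show ?thesis by blast
  qed
  then show "integrable M (\<lambda>\<omega>. (v \<bullet> Y \<omega>)\<^sup>2)"
    "expectation (\<lambda>\<omega>. iexp (v \<bullet> Y \<omega>)) = exp (- (expectation (\<lambda>\<omega>. (v \<bullet> Y \<omega>)\<^sup>2) / 2))" by auto
qed

lemma component_square_integrable: "integrable M (\<lambda>\<omega>. (Y \<omega> $ i)\<^sup>2)"
  using inner_square_integrable[of "axis i 1"] by (simp add: inner_axis')


lemma component_integrable: "integrable M (\<lambda>\<omega>. Y \<omega> $ i)"
  using inner_integrable[of "axis i 1"] by (simp add: inner_axis')

lemma component_mult_integrable: "integrable M (\<lambda>\<omega>. Y \<omega> $ i * Y \<omega> $ j)"
proof (rule Bochner_Integration.integrable_bound)
  show "integrable M (\<lambda>\<omega>. ((Y \<omega> $ i)\<^sup>2 + (Y \<omega> $ j)\<^sup>2) / 2)"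
    by (intro integrable_divide Bochner_Integration.integrable_add component_square_integrable)
  show "AE \<omega> in M. norm (Y \<omega> $ i * Y \<omega> $ j) \<le> norm (((Y \<omega> $ i)\<^sup>2 + (Y \<omega> $ j)\<^sup>2) / 2)"
    using abs_mult_le_half_sum_squares by (intro AE_I2) simp
qed simp

definition cov :: "'d \<Rightarrow> 'd \<Rightarrow> real" where
  "cov i j = expectation (\<lambda>\<omega>. Y \<omega> $ i * Y \<omega> $ j)"

lemma cov_matrix_eq: "cov_matrix M Y $ i $ j = cov i j"
  using centered by (simp add: cov_matrix_def cov_def centered_def)

lemma cov_inner:
  shows inner_mult_component_integrable: "integrable M (\<lambda>\<omega>. (v \<bullet> Y \<omega>) * Y \<omega> $ j)"
    and expectation_inner_mult_component: "expectation (\<lambda>\<omega>. (v \<bullet> Y \<omega>) * Y \<omega> $ j) = v \<bullet> (\<chi> i. cov i j)"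
  using component_mult_integrable
  by (simp_all add: inner_vec_def sum_distrib_right mult.assoc cov_def)

text \<open>
  The residual of the regression of \<open>Y\<close> on \<open>Y\<^sub>j\<close> plus an independent multiple of \<open>b\<close> has the law of
  \<open>Y\<close>, and its \<open>j\<close>-th component is the new variable alone; this reduces the multivariate integration
  by parts to the univariate one and also covers a singular covariance matrix.
\<close>

lemma distr_regression:
  assumes s: "0 < s" "s\<^sup>2 = cov j j"
  defines "N \<equiv> M \<Otimes>\<^sub>M density lborel std_normal_density"
    and "b \<equiv> (\<chi> i. cov i j)"
  shows "distr N borel (\<lambda>(\<omega>, z). Y \<omega> - (Y \<omega> $ j / s\<^sup>2) *\<^sub>R b + (z / s) *\<^sub>R b) = distr M borel Y"
proof -
  interpret G: prob_space "density lborel std_normal_density"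
    by (rule prob_space_normal_density) simp
  interpret N: pair_prob_space M "density lborel std_normal_density" ..
  have N: "N = M \<Otimes>\<^sub>M density lborel std_normal_density" by (simp add: N_def)
  have [measurable]: "(\<lambda>\<omega>. Y \<omega> $ j) \<in> borel_measurable M" by simp
  have [measurable]: "(\<lambda>p. Y (fst p) - (Y (fst p) $ j / s\<^sup>2) *\<^sub>R b + (snd p / s) *\<^sub>R b) \<in> borel_measurable N"
    unfolding N by measurable
  have "(\<integral>p. iexp (v \<bullet> (Y (fst p) - (Y (fst p) $ j / s\<^sup>2) *\<^sub>R b + (snd p / s) *\<^sub>R b)) \<partial>N)
      = expectation (\<lambda>\<omega>. iexp (v \<bullet> Y \<omega>))" for v
  proof -
    \<comment> \<open>\<open>w \<bullet> Y\<close> is \<open>v \<bullet> Y\<close> minus its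
      regression on component \<open>j\<close>; the regression has variance
      \<open>k\<^sup>2\<close>, exactly that of the added variable \<open>k * z\<close>.\<close>
    define k where "k = (v \<bullet> b) / s"
    define w where "w = v - (k / s) *\<^sub>R axis j 1"
    have split: "v \<bullet> (Y \<omega> - (Y \<omega> $ j / s\<^sup>2) *\<^sub>R b + (z / s) *\<^sub>R b) = w \<bullet> Y \<omega> + k * z" for \<omega> z
      by (simp add: w_def k_def inner_add_right inner_diff_right inner_diff_left inner_axis' power2_eq_square mult.commute)
    have int: "integrable N (\<lambda>p. iexp (w \<bullet> Y (fst p)) * iexp (k * snd p))"
      unfolding N by (intro N.integrable_const_bound[of _ 1]) (auto simp: norm_mult)
    have "(w \<bullet> Y \<omega>)\<^sup>2 = (v \<bullet> Y \<omega>)\<^sup>2 - (2 * k / s) * ((v \<bullet> Y \<omega>) * Y \<omega> $ j) + (k / s)\<^sup>2 * (Y \<omega> $ j * Y \<omega> $ j)" for \<omega>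
      by (simp add: w_def inner_diff_left inner_axis' power2_eq_square algebra_simps)
    then have "expectation (\<lambda>\<omega>. (w \<bullet> Y \<omega>)\<^sup>2)
        = expectation (\<lambda>\<omega>. (v \<bullet> Y \<omega>)\<^sup>2) - (2 * k / s) * (v \<bullet> b) + (k / s)\<^sup>2 * s\<^sup>2"
      using inner_square_integrable[of v] inner_mult_component_integrable[of v j] component_mult_integrable[of j j]
      by (simp add: expectation_inner_mult_component b_def s(2) cov_def)
    also have "\<dots> = expectation (\<lambda>\<omega>. (v \<bullet> Y \<omega>)\<^sup>2) - k\<^sup>2"
    proof -
      have "v \<bullet> b = k * s" using s(1) by (simp add: k_def)
      then show ?thesis using s(1) by (simp add: power2_eq_square)
    qed
    finally have var: "expectation (\<lambda>\<omega>. (w \<bullet> Y \<omega>)\<^sup>2) = expectation (\<lambda>\<omega>. (v \<bullet> Y \<omega>)\<^sup>2) - k\<^sup>2" .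
    have "(\<integral>p. iexp (v \<bullet> (Y (fst p) - (Y (fst p) $ j / s\<^sup>2) *\<^sub>R b + (snd p / s) *\<^sub>R b)) \<partial>N)
        = (\<integral>p. iexp (w \<bullet> Y (fst p)) * iexp (k * snd p) \<partial>N)"
      unfolding split by (simp add: exp_add[symmetric] distrib_left)
    also have "\<dots> = (\<integral>\<omega>. \<integral>z. iexp (w \<bullet> Y \<omega>) * iexp (k * z) \<partial>density lborel std_normal_density \<partial>M)"
      using N.integral_fst'[OF int[unfolded N]] by (simp add: N)
    also have "\<dots> = expectation (\<lambda>\<omega>. iexp (w \<bullet> Y \<omega>)) * char std_normal_distribution k"
      by (simp only: integral_mult_right_zero integral_mult_left_zero char_def)
    also have "\<dots> = expectation (\<lambda>\<omega>. iexp (v \<bullet> Y \<omega>))"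
      unfolding inner_char var char_std_normal_distribution exp_of_real[symmetric] exp_add[symmetric]
      by (simp add: diff_divide_distrib)
    finally show ?thesis .
  qed
  then have "distr N borel (\<lambda>p. Y (fst p) - (Y (fst p) $ j / s\<^sup>2) *\<^sub>R b + (snd p / s) *\<^sub>R b) = distr M borel Y"
    by (intro char_function_determines_distr)
       (auto simp: N N.prob_space_axioms prob_space_axioms)
  then show ?thesis by (simp add: case_prod_unfold)
qed

text \<open>For fixed \<open>\<omega>\<close> the regression representation turns the integrand into
  \<open>s * z\<close> times a function of \<open>z\<close> whose derivative is \<open>c / s\<close>
  times the derivative of \<open>\<psi>\<close> in direction \<open>b\<close>. The univariate
  identity is applied inside the integral over \<open>\<omega>\<close>, and the factors
  \<open>s\<close> cancel.\<close>

theorem integration_by_parts: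
  fixes \<psi> :: "real ^ 'd \<Rightarrow> real"
  assumes C: "C_k (Suc 0) \<psi>" and B: "\<And>i y. \<bar>partial_deriv i \<psi> y\<bar> \<le> B"
  shows "expectation (\<lambda>\<omega>. Y \<omega> $ j * \<psi> (x + c *\<^sub>R Y \<omega>))
      = c * (\<Sum>i\<in>UNIV. cov i j * expectation (\<lambda>\<omega>. partial_deriv i \<psi> (x + c *\<^sub>R Y \<omega>)))"
proof -
  have \<psi>_cont: "continuous_on UNIV \<psi>" and d_cont: "\<And>i. continuous_on UNIV (partial_deriv i \<psi>)"
    using C by auto
  note [measurable] = borel_measurable_continuous_onI[OF \<psi>_cont] borel_measurable_continuous_onI[OF d_cont]
  have d_int: "integrable M (\<lambda>\<omega>. partial_deriv i \<psi> (x + c *\<^sub>R Y \<omega>))" for i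
    using B by (intro integrable_const_bound[of _ B]) auto
  define H where "H y = y $ j * \<psi> (x + c *\<^sub>R y)" for y
  have H_meas[measurable]: "H \<in> borel_measurable borel" unfolding H_def by measurable
  have H_int: "integrable M (\<lambda>\<omega>. H (Y \<omega>))"
  proof (rule Bochner_Integration.integrable_bound)
    show "integrable M (\<lambda>\<omega>. \<bar>\<psi> x\<bar> * \<bar>Y \<omega> $ j\<bar> + B * \<bar>c\<bar> * (\<Sum>i\<in>UNIV. \<bar>Y \<omega> $ j * Y \<omega> $ i\<bar>))"
      by (intro Bochner_Integration.integrable_add integrable_mult_right Bochner_Integration.integrable_sum
          integrable_abs component_integrable component_mult_integrable)
    have "\<bar>H y\<bar> \<le> \<bar>\<psi> x\<bar> * \<bar>y $ j\<bar> + B * \<bar>c\<bar> * (\<Sum>i\<in>UNIV. \<bar>y $ j * y $ i\<bar>)" for y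
    proof -
      have "\<bar>\<psi> (x + c *\<^sub>R y)\<bar> \<le> \<bar>\<psi> x\<bar> + B * (\<Sum>i\<in>UNIV. \<bar>c * y $ i\<bar>)"
        using C1_lipschitz[OF C B, of x "c *\<^sub>R y"] by simp
      then have "\<bar>y $ j\<bar> * \<bar>\<psi> (x + c *\<^sub>R y)\<bar> \<le> \<bar>y $ j\<bar> * (\<bar>\<psi> x\<bar> + B * (\<Sum>i\<in>UNIV. \<bar>c * y $ i\<bar>))"
        by (intro mult_left_mono) auto
      then show ?thesis
        by (simp add: H_def abs_mult distrib_left sum_distrib_left mult_ac)
    qed
    then show "AE \<omega> in M. norm (H (Y \<omega>)) \<le> norm (\<bar>\<psi> x\<bar> * \<bar>Y \<omega> $ j\<bar> + B * \<bar>c\<bar> * (\<Sum>i\<in>UNIV. \<bar>Y \<omega> $ j * Y \<omega> $ i\<bar>))"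
      by (intro AE_I2) (simp add: order_trans[OF _ abs_ge_self])
  qed simp
  show ?thesis
  proof (cases "cov j j = 0")
    \<comment> \<open>With zero variance the component vanishes almost surely, and so do all
      covariances with it: both sides are 0.\<close>
    case True
    then have "AE \<omega> in M. (Y \<omega> $ j)\<^sup>2 = 0"
      using integral_nonneg_eq_0_iff_AE[OF component_square_integrable[of j]]
      by (simp add: cov_def power2_eq_square)
    then have zero: "AE \<omega> in M. Y \<omega> $ j = 0" by simp
    then have "cov i j = expectation (\<lambda>_. 0)" for i
      unfolding cov_def by (intro integral_cong_AE) auto
    moreover have "expectation (\<lambda>\<omega>. Y \<omega> $ j * \<psi> (x + c *\<^sub>R Y \<omega>)) = expectation (\<lambda>_. 0)"
      using zero by (intro integral_cong_AE) auto
    ultimately show ?thesis by simp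
  next
    case False
    moreover have "0 \<le> cov j j" unfolding cov_def by simp
    ultimately obtain s where s: "0 < s" "s\<^sup>2 = cov j j"
      by (metis less_eq_real_def real_sqrt_gt_0_iff real_sqrt_pow2)
    define b where "b = (\<chi> i. cov i j)"
    have bj: "b $ j = s\<^sup>2" by (simp add: b_def s(2))
    interpret G: prob_space "density lborel std_normal_density"
      by (rule prob_space_normal_density) simp
    interpret N: pair_prob_space M "density lborel std_normal_density" ..
    let ?N = "M \<Otimes>\<^sub>M density lborel std_normal_density"
    define W where "W \<omega> = Y \<omega> - (Y \<omega> $ j / s\<^sup>2) *\<^sub>R b" for \<omega>
    define V where "V p = W (fst p) + (snd p / s) *\<^sub>R b" for p
    have [measurable]: "(\<lambda>\<omega>. Y \<omega> $ j) \<in> borel_measurable M" by simp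
    have W_meas[measurable]: "W \<in> borel_measurable M" unfolding W_def by measurable
    have V_meas[measurable]: "V \<in> borel_measurable ?N" unfolding V_def by measurable
    have law: "distr ?N borel V = distr M borel Y"
      using distr_regression[OF s] by (simp add: V_def[abs_def] W_def b_def case_prod_unfold)
    have transfer: "integrable ?N (\<lambda>p. f (V p))" "(\<integral>p. f (V p) \<partial>?N) = expectation (\<lambda>\<omega>. f (Y \<omega>))"
      if "integrable M (\<lambda>\<omega>. f (Y \<omega>))" and [measurable]: "f \<in> borel_measurable borel" for f :: "real ^ 'd \<Rightarrow> real"
      using that integrable_distr_eq[OF V_meas, of f] integrable_distr_eq[OF measurable_Y, of f]
        integral_distr[OF V_meas, of f] integral_distr[OF measurable_Y, of f] by (simp_all add: law)
    \<comment> \<open>Since \<open>b $ j = s\<^sup>2\<close>, the residual has \<open>j\<close>-th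
      component 0.\<close>
    have Vj: "V p $ j = s * snd p" for p
      using s(1) by (simp add: V_def W_def bj power2_eq_square)
    define f where "f \<omega> z = \<psi> (x + c *\<^sub>R V (\<omega>, z))" for \<omega> z
    define f' where "f' \<omega> z = (\<Sum>i\<in>UNIV. (c / s * b $ i) * partial_deriv i \<psi> (x + c *\<^sub>R V (\<omega>, z)))" for \<omega> z
    have f: "(f \<omega> has_real_derivative f' \<omega> z) (at z)" for \<omega> z
    proof -
      have "((\<lambda>z. x + c *\<^sub>R V (\<omega>, z)) has_vector_derivative (c / s) *\<^sub>R b) (at z)"
        unfolding V_def using s(1) by (auto intro!: derivative_eq_intros)
      from C1_has_real_derivative_compose[OF C this] show ?thesis
        by (simp add: f_def[abs_def] f'_def)
    qed
    have f'_cont: "continuous_on UNIV (f' \<omega>)" for \<omega>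
      unfolding f'_def V_def using s(1) by (intro continuous_intros continuous_on_compose2[OF d_cont]) auto
    have f'_bound: "\<bar>f' \<omega> z\<bar> \<le> (\<Sum>i\<in>UNIV. \<bar>c / s * b $ i\<bar> * B)" for \<omega> z
      unfolding f'_def using B by (auto simp only: abs_mult intro!: order_trans[OF sum_abs] sum_mono mult_left_mono mult_nonneg_nonneg abs_ge_zero)
    have parts: "(\<integral>z. z * f \<omega> z \<partial>density lborel std_normal_density) = (\<integral>z. f' \<omega> z \<partial>density lborel std_normal_density)" for \<omega>
    proof -
      have "continuous_on UNIV (f \<omega>)" using f by (meson DERIV_isCont continuous_at_imp_continuous_on)
      then have [measurable]: "f \<omega> \<in> borel_measurable borel" "f' \<omega> \<in> borel_measurable borel"
        using f'_cont borel_measurable_continuous_onI by auto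
      show ?thesis
        using std_normal_integration_by_parts[OF f f'_cont f'_bound, of \<omega>]
        by (simp add: integral_density)
    qed
    have f'_int: "integrable ?N (\<lambda>p. f' (fst p) (snd p))"
      using transfer(1)[OF d_int] by (simp add: f'_def)
    have "expectation (\<lambda>\<omega>. H (Y \<omega>)) = (\<integral>p. H (V p) \<partial>?N)"
      using transfer(2)[OF H_int] by simp
    also have "\<dots> = (\<integral>\<omega>. \<integral>z. s * (z * f \<omega> z) \<partial>density lborel std_normal_density \<partial>M)"
      using N.integral_fst'[OF transfer(1)[OF H_int H_meas], symmetric] by (simp add: H_def Vj f_def mult.assoc)
    also have "\<dots> = s * (\<integral>\<omega>. \<integral>z. f' \<omega> z \<partial>density lborel std_normal_density \<partial>M)"
      by (simp only: integral_mult_right_zero parts)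
    also have "\<dots> = s * (\<integral>p. f' (fst p) (snd p) \<partial>?N)"
      using N.integral_fst'[OF f'_int] by simp
    also have "\<dots> = s * (\<Sum>i\<in>UNIV. (c / s * b $ i) * expectation (\<lambda>\<omega>. partial_deriv i \<psi> (x + c *\<^sub>R Y \<omega>)))"
      using transfer[OF d_int] by (simp add: f'_def)
    also have "\<dots> = c * (\<Sum>i\<in>UNIV. cov i j * expectation (\<lambda>\<omega>. partial_deriv i \<psi> (x + c *\<^sub>R Y \<omega>)))"
      using s(1) by (simp add: b_def sum_distrib_left mult.assoc)
    finally show ?thesis by (simp add: H_def)
  qed
qed

end

section \<open>Window sums\<close>

text \<open>Independence is available for the restrictions of \<open>X\<close> to disjoint index
  sets; invariance under \<open>restrict\<close> transfers it to functions evaluated at the whole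
  sequence. Values in any topological space admit vectors as well as reals.\<close>

definition cylinder :: "nat set \<Rightarrow> ((nat \<Rightarrow> real) \<Rightarrow> 'b::topological_space) \<Rightarrow> bool" where
  "cylinder S f \<longleftrightarrow> f \<in> borel_measurable (Pi\<^sub>M S (\<lambda>_. borel)) \<and> (\<forall>x. f (restrict x S) = f x)"

lemma cylinder_coordinate: "k \<in> S \<Longrightarrow> cylinder S (\<lambda>x. x k)"
  by (simp add: cylinder_def)

lemma cylinder_const: "cylinder S (\<lambda>x. c)"
  by (simp add: cylinder_def)

lemma cylinder_compose: "cylinder S f \<Longrightarrow> g \<in> borel_measurable borel \<Longrightarrow> cylinder S (\<lambda>x. g (f x))"
  by (auto simp: cylinder_def)

lemma cylinder_add:
  fixes f g :: "(nat \<Rightarrow> real) \<Rightarrow> real"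
  shows "cylinder S f \<Longrightarrow> cylinder S g \<Longrightarrow> cylinder S (\<lambda>x. f x + g x)"
  by (auto simp: cylinder_def)

lemma cylinder_diff:
  fixes f g :: "(nat \<Rightarrow> real) \<Rightarrow> real"
  shows "cylinder S f \<Longrightarrow> cylinder S g \<Longrightarrow> cylinder S (\<lambda>x. f x - g x)"
  by (auto simp: cylinder_def)

lemma cylinder_mult:
  fixes f g :: "(nat \<Rightarrow> real) \<Rightarrow> real"
  shows "cylinder S f \<Longrightarrow> cylinder S g \<Longrightarrow> cylinder S (\<lambda>x. f x * g x)"
  by (auto simp: cylinder_def)

lemma cylinder_sum:
  fixes f :: "'i \<Rightarrow> (nat \<Rightarrow> real) \<Rightarrow> real"
  shows "(\<And>i. i \<in> I \<Longrightarrow> cylinder S (f i)) \<Longrightarrow> cylinder S (\<lambda>x. \<Sum>i\<in>I. f i x)"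
  by (induction I rule: infinite_finite_induct) (auto intro: cylinder_add cylinder_const)

lemma cylinder_prod:
  fixes f :: "'i \<Rightarrow> (nat \<Rightarrow> real) \<Rightarrow> real"
  shows "(\<And>i. i \<in> I \<Longrightarrow> cylinder S (f i)) \<Longrightarrow> cylinder S (\<lambda>x. \<Prod>i\<in>I. f i x)"
  by (induction I rule: infinite_finite_induct) (auto intro: cylinder_mult cylinder_const)

lemma cylinder_vec_lambda:
  fixes f :: "'d::finite \<Rightarrow> (nat \<Rightarrow> real) \<Rightarrow> real"
  assumes "\<And>i. cylinder S (f i)"
  shows "cylinder S (\<lambda>x. \<chi> i. f i x)"
proof -
  have "(\<lambda>x. \<chi> i. f i x) = (\<lambda>x. \<Sum>i\<in>UNIV. f i x *\<^sub>R axis i 1)"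
    by (simp add: fun_eq_iff vec_eq_iff axis_def if_distrib cong: if_cong)
  moreover have "(\<lambda>x. \<Sum>i\<in>UNIV. f i x *\<^sub>R axis i (1::real)) \<in> borel_measurable (Pi\<^sub>M S (\<lambda>_. borel))"
    using assms by (intro borel_measurable_sum borel_measurable_scaleR) (auto simp: cylinder_def)
  ultimately show ?thesis using assms by (simp add: cylinder_def)
qed

lemma (in prob_space) indep_var_cylinder:
  fixes X :: "nat \<Rightarrow> 'a \<Rightarrow> real"
  assumes "indep_vars (\<lambda>_. borel) X I" "S \<inter> T = {}" "S \<subseteq> I" "T \<subseteq> I"
    and f: "cylinder S f" and g: "cylinder T g"
  shows "indep_var borel (\<lambda>\<omega>. f (\<lambda>k. X k \<omega>)) borel (\<lambda>\<omega>. g (\<lambda>k. X k \<omega>))"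
  using indep_var_compose[OF indep_var_restrict[OF assms(1-4)], of f borel g borel] f g
  by (auto simp: cylinder_def o_def)

section \<open>Telescoping and counting of windows\<close>

text \<open>One passes from \<open>y\<close> to \<open>x\<close> coordinate by coordinate in
  increasing order. In the induction, a new maximum \<open>b\<close> multiplies the old terms by
  \<open>y b\<close> and contributes one term with \<open>x\<close> at all other places.\<close>

lemma prod_diff_telescope:
  fixes x y :: "'i::linorder \<Rightarrow> real"
  assumes "finite A"
  shows "(\<Prod>i\<in>A. x i) - (\<Prod>i\<in>A. y i)
    = (\<Sum>l\<in>A. (x l - y l) * (\<Prod>i\<in>A - {l}. if i < l then x i else y i))"
  using assms
proof (induction A rule: finite_linorder_max_induct)
  case (insert b A)
  then have b: "b \<notin> A" by auto
  have "(\<Prod>i\<in>insert b A - {b}. if i < b then x i else y i) = (\<Prod>i\<in>A. x i)"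
    using insert b by (intro prod.cong) auto
  moreover have "(\<Prod>i\<in>insert b A - {l}. if i < l then x i else y i)
      = y b * (\<Prod>i\<in>A - {l}. if i < l then x i else y i)" if "l \<in> A" for l
  proof -
    have "insert b A - {l} = insert b (A - {l})" "\<not> b < l" using that b insert by auto
    then show ?thesis using insert b by simp
  qed
  ultimately have "(\<Sum>l\<in>insert b A. (x l - y l) * (\<Prod>i\<in>insert b A - {l}. if i < l then x i else y i))
      = (x b - y b) * (\<Prod>i\<in>A. x i) + y b * (\<Sum>l\<in>A. (x l - y l) * (\<Prod>i\<in>A - {l}. if i < l then x i else y i))"
    using insert b by (simp add: sum_distrib_left mult_ac)
  then show ?case
    unfolding insert.IH[symmetric] using insert b by (simp add: algebra_simps)
qed simp

text \<open>The second vector fills the places after \<open>l\<close>: with \<open>y = \<mu>\<close>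
  this is the factor in the telescoping sum, with \<open>y = x\<close> it is the partial derivative
  of the window sum in coordinate \<open>l\<close>.\<close>

definition window_part ::
  "nat \<Rightarrow> nat \<Rightarrow> (nat \<Rightarrow> real) \<Rightarrow> nat \<Rightarrow> (nat \<Rightarrow> real) \<Rightarrow> (nat \<Rightarrow> real) \<Rightarrow> real" where
  "window_part n m a l x y =
    (\<Sum>k | k \<in> {1..n} \<and> l \<in> {k..k + m - 1}. a k * (\<Prod>i\<in>{k..k + m - 1} - {l}. if i < l then x i else y i))"

text \<open>\<open>N\<close> may exceed the last index that occurs, so that components with
  different window lengths are split over one index set.\<close>

lemma window_sum_telescope:
  assumes "n + m - 1 \<le> N"
  shows "window_sum n m a \<mu> (\<lambda>k x. x k) x = (\<Sum>l\<in>{1..N}. (x l - \<mu> l) * window_part n m a l x \<mu>)"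
proof -
  let ?t = "\<lambda>k l. (x l - \<mu> l) * (\<Prod>i\<in>{k..k + m - 1} - {l}. if i < l then x i else \<mu> i)"
  have "window_sum n m a \<mu> (\<lambda>k x. x k) x = (\<Sum>k = 1..n. \<Sum>l\<in>{k..k + m - 1}. a k * ?t k l)"
    unfolding window_sum_def prod_diff_telescope[OF finite_atLeastAtMost] by (simp add: sum_distrib_left)
  also have "\<dots> = (\<Sum>k = 1..n. \<Sum>l\<in>{1..N}. if l \<in> {k..k + m - 1} then a k * ?t k l else 0)"
  proof (rule sum.cong)
    fix k assume "k \<in> {1..n}"
    then have "{1..N} \<inter> {k..k + m - 1} = {k..k + m - 1}" using assms by auto
    then show "(\<Sum>l\<in>{k..k + m - 1}. a k * ?t k l) = (\<Sum>l\<in>{1..N}. if l \<in> {k..k + m - 1} then a k * ?t k l else 0)"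
      using sum.inter_restrict[of "{1..N}" "\<lambda>l. a k * ?t k l" "{k..k + m - 1}"]
      by (simp only: finite_atLeastAtMost)
  qed simp
  also have "\<dots> = (\<Sum>l\<in>{1..N}. \<Sum>k = 1..n. if l \<in> {k..k + m - 1} then a k * ?t k l else 0)"
    by (rule sum.swap)
  also have "\<dots> = (\<Sum>l\<in>{1..N}. \<Sum>k | k \<in> {1..n} \<and> l \<in> {k..k + m - 1}. a k * ?t k l)"
    by (intro sum.cong refl sum.inter_filter[symmetric]) simp
  finally show ?thesis
    by (simp add: window_part_def sum_distrib_left mult_ac)
qed

text \<open>A product of distinct coordinates is affine in each of them, so the first difference has
  no higher order term.\<close>

lemma window_sum_update:
  "window_sum n m a \<mu> (\<lambda>k x. x k) x - window_sum n m a \<mu> (\<lambda>k x. x k) (x(l := \<mu> l))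
    = (x l - \<mu> l) * window_part n m a l x x"
proof -
  have "(\<Prod>i\<in>A. x i) - (\<Prod>i\<in>A. (x(l := \<mu> l)) i)
      = (if l \<in> A then (x l - \<mu> l) * (\<Prod>i\<in>A - {l}. x i) else 0)" if "finite A" for A
  proof (cases "l \<in> A")
    case True
    have "(\<Prod>i\<in>A - {l}. (x(l := \<mu> l)) i) = (\<Prod>i\<in>A - {l}. x i)" by (intro prod.cong) auto
    then show ?thesis
      using True prod.remove[OF that True, of x] prod.remove[OF that True, of "x(l := \<mu> l)"]
      by (simp add: left_diff_distrib)
  next
    case False
    then have "(\<Prod>i\<in>A. (x(l := \<mu> l)) i) = (\<Prod>i\<in>A. x i)" by (intro prod.cong) auto
    then show ?thesis using False by simp
  qed
  then have "window_sum n m a \<mu> (\<lambda>k x. x k) x - window_sum n m a \<mu> (\<lambda>k x. x k) (x(l := \<mu> l))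
      = (\<Sum>k = 1..n. if l \<in> {k..k + m - 1} then a k * ((x l - \<mu> l) * (\<Prod>i\<in>{k..k + m - 1} - {l}. x i)) else 0)"
    unfolding window_sum_def sum_subtractf[symmetric] right_diff_distrib[symmetric]
    by (intro sum.cong) (auto simp del: fun_upd_apply)
  also have "\<dots> = (\<Sum>k | k \<in> {1..n} \<and> l \<in> {k..k + m - 1}. a k * ((x l - \<mu> l) * (\<Prod>i\<in>{k..k + m - 1} - {l}. x i)))"
    by (intro sum.inter_filter[symmetric]) simp
  finally show ?thesis
    by (simp add: window_part_def sum_distrib_left mult_ac)
qed

lemma cylinder_window_part:
  assumes S: "\<And>k. k \<in> {1..n} \<Longrightarrow> l \<in> {k..k + m - 1} \<Longrightarrow> {k..k + m - 1} - {l} \<subseteq> S"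
    and y: "\<And>i. i \<in> S \<Longrightarrow> cylinder S (\<lambda>x. y x i)"
  shows "cylinder S (\<lambda>x. window_part n m a l x (y x))"
  unfolding window_part_def
proof (intro cylinder_sum cylinder_mult cylinder_const cylinder_prod)
  fix k i assume "k \<in> {k. k \<in> {1..n} \<and> l \<in> {k..k + m - 1}}" "i \<in> {k..k + m - 1} - {l}"
  then have "k \<in> {1..n}" "l \<in> {k..k + m - 1}" "i \<in> {k..k + m - 1} - {l}" by auto
  then have "i \<in> S" using S by blast
  then show "cylinder S (\<lambda>x. if i < l then x i else y x i)"
    using y cylinder_coordinate by (cases "i < l") auto
qed

lemma card_windows_containing: "card {k. k \<in> {1..n} \<and> l \<in> {k..k + m - 1}} \<le> m"
proof (cases "m = 0")
  case False
  then have "{k. k \<in> {1..n} \<and> l \<in> {k..k + m - 1}} \<subseteq> {l + 1 - m..l}" by auto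
  then have "card {k. k \<in> {1..n} \<and> l \<in> {k..k + m - 1}} \<le> card {l + 1 - m..l}" by (intro card_mono) auto
  then show ?thesis by simp
qed (auto simp: card_eq_0_iff)

text \<open>Double counting: a window of length \<open>m\<close> is met by at most \<open>m\<close>
  indices \<open>l\<close>.\<close>

lemma sum_windows_containing_le:
  fixes f :: "nat \<Rightarrow> real"
  assumes "1 \<le> m" "\<And>k. 0 \<le> f k"
  shows "(\<Sum>l\<in>{1..N}. \<Sum>k | k \<in> {1..n} \<and> l \<in> {k..k + m - 1}. f k) \<le> real m * (\<Sum>k = 1..n. f k)"
proof -
  have "(\<Sum>l\<in>{1..N}. \<Sum>k | k \<in> {1..n} \<and> l \<in> {k..k + m - 1}. f k)
      = (\<Sum>l\<in>{1..N}. \<Sum>k = 1..n. if l \<in> {k..k + m - 1} then f k else 0)"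
    by (intro sum.cong refl sum.inter_filter) simp
  also have "\<dots> = (\<Sum>k = 1..n. \<Sum>l\<in>{1..N}. if l \<in> {k..k + m - 1} then f k else 0)"
    by (rule sum.swap)
  also have "\<dots> \<le> (\<Sum>k = 1..n. real m * f k)"
  proof (rule sum_mono)
    fix k
    have "card ({1..N} \<inter> {k..k + m - 1}) \<le> card {k..k + m - 1}" by (intro card_mono) auto
    then have "card ({1..N} \<inter> {k..k + m - 1}) \<le> m" using assms(1) by simp
    then have "real (card ({1..N} \<inter> {k..k + m - 1})) * f k \<le> real m * f k"
      using assms(2) by (intro mult_right_mono) auto
    then show "(\<Sum>l\<in>{1..N}. if l \<in> {k..k + m - 1} then f k else 0) \<le> real m * f k"
      by (simp only: sum.inter_restrict[symmetric] finite_atLeastAtMost sum_constant)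
  qed
  finally show ?thesis by (simp add: sum_distrib_left)
qed

section \<open>Moments of the increments\<close>

locale independent_family = prob_space M for M :: "'a measure" +
  fixes X :: "nat \<Rightarrow> 'a \<Rightarrow> real" and N :: nat and \<mu> :: "nat \<Rightarrow> real"
  assumes indep: "indep_vars (\<lambda>_. borel) X {1..N}"
    and integrable_X4: "\<And>i. i \<in> {1..N} \<Longrightarrow> integrable M (\<lambda>\<omega>. X i \<omega> ^ 4)"
    and \<mu>_eq: "\<And>i. i \<in> {1..N} \<Longrightarrow> \<mu> i = expectation (X i)"
begin

lemma X_fourth_moment: "i \<in> {1..N} \<Longrightarrow> has_fourth_moment M (X i)"
  using indep integrable_X4 by (auto simp: has_fourth_moment_def indep_vars_def)

lemma prod_moment:
  fixes h :: "nat \<Rightarrow> real \<Rightarrow> real"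
  assumes A: "A \<subseteq> {1..N}" and h: "\<And>i. i \<in> A \<Longrightarrow> h i \<in> borel_measurable borel"
    and int: "\<And>i. i \<in> A \<Longrightarrow> integrable M (\<lambda>\<omega>. \<bar>h i (X i \<omega>)\<bar> ^ p)"
  shows prod_moment_integrable: "integrable M (\<lambda>\<omega>. \<bar>\<Prod>i\<in>A. h i (X i \<omega>)\<bar> ^ p)"
    and prod_moment_eq: "expectation (\<lambda>\<omega>. \<bar>\<Prod>i\<in>A. h i (X i \<omega>)\<bar> ^ p)
      = (\<Prod>i\<in>A. expectation (\<lambda>\<omega>. \<bar>h i (X i \<omega>)\<bar> ^ p))"
proof -
  have fin: "finite A" using A finite_subset by blast
  have "indep_vars (\<lambda>_. borel) (\<lambda>i \<omega>. \<bar>h i (X i \<omega>)\<bar> ^ p) A"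
    by (rule indep_vars_compose2[OF indep_vars_subset[OF indep A], where Y = "\<lambda>i x. \<bar>h i x\<bar> ^ p"])
       (use h in \<open>simp add: borel_measurable_power borel_measurable_abs\<close>)
  from indep_vars_integrable[OF fin this int] indep_vars_lebesgue_integral[OF fin this int]
  show "integrable M (\<lambda>\<omega>. \<bar>\<Prod>i\<in>A. h i (X i \<omega>)\<bar> ^ p)"
    "expectation (\<lambda>\<omega>. \<bar>\<Prod>i\<in>A. h i (X i \<omega>)\<bar> ^ p) = (\<Prod>i\<in>A. expectation (\<lambda>\<omega>. \<bar>h i (X i \<omega>)\<bar> ^ p))"
    by (simp_all add: abs_prod prod_power_distrib)
qed

lemma prod_fourth_moment:
  fixes h :: "nat \<Rightarrow> real \<Rightarrow> real"
  assumes "A \<subseteq> {1..N}" "\<And>i. i \<in> A \<Longrightarrow> h i \<in> borel_measurable borel"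
    and "\<And>i. i \<in> A \<Longrightarrow> has_fourth_moment M (\<lambda>\<omega>. h i (X i \<omega>))"
  shows "has_fourth_moment M (\<lambda>\<omega>. \<Prod>i\<in>A. h i (X i \<omega>))"
  using prod_moment_integrable[OF assms(1,2), where p = 4] assms(3)
  by (auto simp: has_fourth_moment_def intro!: borel_measurable_prod)

text \<open>The flag selects the second vector of \<open>window_part\<close>, so that the moment
  bounds are proved once for both kinds of increments.\<close>

definition tail :: "bool \<Rightarrow> 'a \<Rightarrow> nat \<Rightarrow> real" where
  "tail b \<omega> i = (if b then X i \<omega> else \<mu> i)"

definition part :: "nat \<Rightarrow> nat \<Rightarrow> (nat \<Rightarrow> real) \<Rightarrow> bool \<Rightarrow> nat \<Rightarrow> 'a \<Rightarrow> real" where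
  "part n m a b l \<omega> = window_part n m a l (\<lambda>k. X k \<omega>) (tail b \<omega>)"

text \<open>
  For \<open>b = False\<close> this is the martingale difference \<open>E[F | X\<^sub>1, \<dots>, X\<^sub>l] - E[F | X\<^sub>1, \<dots>, X\<^sub>l\<^sub>-\<^sub>1]\<close> of
  the window sum \<open>F\<close>; for \<open>b = True\<close> it is the change of \<open>F\<close> when \<open>X\<^sub>l\<close> is replaced by its mean.
\<close>

definition increment :: "nat \<Rightarrow> nat \<Rightarrow> (nat \<Rightarrow> real) \<Rightarrow> bool \<Rightarrow> nat \<Rightarrow> 'a \<Rightarrow> real" where
  "increment n m a b l \<omega> = (X l \<omega> - \<mu> l) * part n m a b l \<omega>"

lemma factor_fourth_moment:
  "i \<in> {1..N} \<Longrightarrow> has_fourth_moment M (\<lambda>\<omega>. if i < l then X i \<omega> else tail b \<omega> i)"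
  using X_fourth_moment fourth_moment_const by (cases "i < l"; cases b) (auto simp: tail_def)

lemma part_fourth_moment:
  assumes "n + m - 1 \<le> N"
  shows "has_fourth_moment M (part n m a b l)"
proof -
  have "has_fourth_moment M (\<lambda>\<omega>. \<Prod>i\<in>{k..k + m - 1} - {l}. if i < l then X i \<omega> else tail b \<omega> i)"
    if "k \<in> {1..n}" for k
  proof -
    have A: "{k..k + m - 1} - {l} \<subseteq> {1..N}" using that assms by auto
    have "has_fourth_moment M (\<lambda>\<omega>. \<Prod>i\<in>{k..k + m - 1} - {l}. (\<lambda>i y. if i < l then y else if b then y else \<mu> i) i (X i \<omega>))"
    proof (intro prod_fourth_moment A)
      fix i assume "i \<in> {k..k + m - 1} - {l}"
      then have "i \<in> {1..N}" using A by blast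
      then show "has_fourth_moment M (\<lambda>\<omega>. if i < l then X i \<omega> else if b then X i \<omega> else \<mu> i)"
        using factor_fourth_moment[of i l b] unfolding tail_def by blast
    qed simp
    then show ?thesis unfolding tail_def .
  qed
  then show ?thesis
    unfolding part_def[abs_def] window_part_def
    by (intro fourth_moment_sum fourth_moment_cmult) auto
qed

text \<open>By independence the moment is a product over the window. A factor \<open>X i\<close> or
  \<open>\<mu> i\<close> contributes at most \<open>x\<close>, the latter by Jensen's inequality, so
  both values of \<open>b\<close> obey the same bound.\<close>

lemma monomial_moment:
  fixes b :: bool
  assumes k: "l \<in> {k..k + m - 1}" "{k..k + m - 1} \<subseteq> {1..N}" and p: "p \<le> 4"
    and x: "\<And>i. i \<in> {1..N} \<Longrightarrow> expectation (\<lambda>\<omega>. \<bar>X i \<omega>\<bar> ^ p) \<le> x"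
    and c: "\<And>i. i \<in> {1..N} \<Longrightarrow> expectation (\<lambda>\<omega>. \<bar>X i \<omega> - \<mu> i\<bar> ^ p) \<le> c"
  defines "mon \<equiv> \<lambda>\<omega>. (X l \<omega> - \<mu> l) * (\<Prod>i\<in>{k..k + m - 1} - {l}. if i < l then X i \<omega> else tail b \<omega> i)"
  shows "has_fourth_moment M mon" and "expectation (\<lambda>\<omega>. \<bar>mon \<omega>\<bar> ^ p) \<le> x ^ (m - 1) * c"
proof -
  define A where "A = {k..k + m - 1}"
  define h where "h i y = (if i = l then y - \<mu> l else if i < l then y else if b then y else \<mu> i)" for i y
  have A: "A \<subseteq> {1..N}" "finite A" "l \<in> A" using k by (auto simp: A_def)
  have mon: "mon = (\<lambda>\<omega>. \<Prod>i\<in>A. h i (X i \<omega>))"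
  proof
    fix \<omega>
    have "(\<Prod>i\<in>A - {l}. h i (X i \<omega>)) = (\<Prod>i\<in>A - {l}. if i < l then X i \<omega> else tail b \<omega> i)"
      by (intro prod.cong) (auto simp: h_def tail_def)
    then show "mon \<omega> = (\<Prod>i\<in>A. h i (X i \<omega>))"
      using prod.remove[OF A(2,3), of "\<lambda>i. h i (X i \<omega>)"] by (simp add: mon_def A_def h_def)
  qed
  have h_meas: "h i \<in> borel_measurable borel" for i
    unfolding h_def by (cases "i = l"; cases "i < l"; cases b) auto
  have h4: "has_fourth_moment M (\<lambda>\<omega>. h i (X i \<omega>))" if "i \<in> A" for i
  proof -
    have "has_fourth_moment M (X i)" using X_fourth_moment[of i] that A by blast
    then show ?thesis
      by (cases "i = l"; cases "i < l"; cases b) (auto simp: h_def intro: fourth_moment_const fourth_moment_diff)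
  qed
  show "has_fourth_moment M mon"
    unfolding mon using A h_meas h4 by (intro prod_fourth_moment) auto
  have "expectation (\<lambda>\<omega>. \<bar>mon \<omega>\<bar> ^ p) = (\<Prod>i\<in>A. expectation (\<lambda>\<omega>. \<bar>h i (X i \<omega>)\<bar> ^ p))"
    unfolding mon using A h_meas h4 p by (intro prod_moment_eq fourth_moment_integrable_power) auto
  also have "\<dots> \<le> (\<Prod>i\<in>A. if i = l then c else x)"
  proof (intro prod_mono conjI)
    fix i assume "i \<in> A"
    then have i: "i \<in> {1..N}" using A by auto
    show "0 \<le> expectation (\<lambda>\<omega>. \<bar>h i (X i \<omega>)\<bar> ^ p)" by simp
    have "\<bar>\<mu> i\<bar> ^ p \<le> expectation (\<lambda>\<omega>. \<bar>X i \<omega>\<bar> ^ p)"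
      unfolding \<mu>_eq[OF i]
      using X_fourth_moment[OF i] p
      by (intro abs_expectation_power_le fourth_moment_integrable fourth_moment_integrable_power) auto
    then show "expectation (\<lambda>\<omega>. \<bar>h i (X i \<omega>)\<bar> ^ p) \<le> (if i = l then c else x)"
      using x[OF i] c[OF i] by (cases "i = l"; cases "i < l"; cases b) (auto simp: h_def prob_space)
  qed
  also have "\<dots> = c * x ^ card (A - {l})"
    using prod.remove[OF A(2,3), of "\<lambda>i. if i = l then c else x"] by simp
  also have "card (A - {l}) = m - 1" using A(3) by (simp add: A_def)
  finally show "expectation (\<lambda>\<omega>. \<bar>mon \<omega>\<bar> ^ p) \<le> x ^ (m - 1) * c" by (simp add: mult.commute)
qed

lemma increment_eq_sum:
  "increment n m a b l \<omega> = (\<Sum>k | k \<in> {1..n} \<and> l \<in> {k..k + m - 1}.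
    a k * ((X l \<omega> - \<mu> l) * (\<Prod>i\<in>{k..k + m - 1} - {l}. if i < l then X i \<omega> else tail b \<omega> i)))"
  by (simp add: increment_def part_def window_part_def sum_distrib_left mult_ac)

lemma increment_fourth_moment:
  assumes "n + m - 1 \<le> N"
  shows "has_fourth_moment M (increment n m a b l)"
  \<comment> \<open>Only the first conclusion of \<open>monomial_moment\<close> is wanted; exponent
    0 makes its moment hypotheses trivial.\<close>
  unfolding increment_eq_sum[abs_def]
  using assms by (intro fourth_moment_sum fourth_moment_cmult monomial_moment(1)[where p = 0 and x = 1 and c = 1]) (auto simp: prob_space)

text \<open>The factor \<open>m ^ p\<close> has two sources: Jensen's inequality for the at most
  \<open>m\<close> windows through \<open>l\<close> costs \<open>m ^ (p - 1)\<close>, and each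
  window is counted for at most \<open>m\<close> values of \<open>l\<close>.\<close>

lemma sum_increment_moment_le:
  assumes N: "n + m - 1 \<le> N" "1 \<le> m" and p: "1 \<le> p" "p \<le> 4"
    and x: "\<And>i. i \<in> {1..N} \<Longrightarrow> expectation (\<lambda>\<omega>. \<bar>X i \<omega>\<bar> ^ p) \<le> x"
    and c: "\<And>i. i \<in> {1..N} \<Longrightarrow> expectation (\<lambda>\<omega>. \<bar>X i \<omega> - \<mu> i\<bar> ^ p) \<le> c"
    and nonneg: "0 \<le> x" "0 \<le> c"
  shows "(\<Sum>l\<in>{1..N}. expectation (\<lambda>\<omega>. \<bar>increment n m a b l \<omega>\<bar> ^ p))
    \<le> real m ^ p * (x ^ (m - 1) * c * (\<Sum>k = 1..n. \<bar>a k\<bar> ^ p))"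
proof -
  define mon where "mon k l \<omega> = (X l \<omega> - \<mu> l) * (\<Prod>i\<in>{k..k + m - 1} - {l}. if i < l then X i \<omega> else tail b \<omega> i)" for k l \<omega>
  define K where "K l = {k. k \<in> {1..n} \<and> l \<in> {k..k + m - 1}}" for l
  have mon: "has_fourth_moment M (mon k l)" "expectation (\<lambda>\<omega>. \<bar>mon k l \<omega>\<bar> ^ p) \<le> x ^ (m - 1) * c"
    if "k \<in> K l" for k l
  proof -
    have k: "l \<in> {k..k + m - 1}" "{k..k + m - 1} \<subseteq> {1..N}" using that N by (auto simp: K_def)
    show "has_fourth_moment M (mon k l)" "expectation (\<lambda>\<omega>. \<bar>mon k l \<omega>\<bar> ^ p) \<le> x ^ (m - 1) * c"
      unfolding mon_def[abs_def] using monomial_moment[OF k p(2) x c] by auto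
  qed
  have "expectation (\<lambda>\<omega>. \<bar>increment n m a b l \<omega>\<bar> ^ p)
      \<le> real m ^ (p - 1) * (\<Sum>k\<in>K l. \<bar>a k\<bar> ^ p * (x ^ (m - 1) * c))" for l
  proof -
    have "expectation (\<lambda>\<omega>. \<bar>increment n m a b l \<omega>\<bar> ^ p)
        \<le> expectation (\<lambda>\<omega>. real m ^ (p - 1) * (\<Sum>k\<in>K l. \<bar>a k\<bar> ^ p * \<bar>mon k l \<omega>\<bar> ^ p))"
    proof (rule integral_mono)
      show "integrable M (\<lambda>\<omega>. \<bar>increment n m a b l \<omega>\<bar> ^ p)"
        using increment_fourth_moment[OF N(1)] p by (intro fourth_moment_integrable_power)
      show "integrable M (\<lambda>\<omega>. real m ^ (p - 1) * (\<Sum>k\<in>K l. \<bar>a k\<bar> ^ p * \<bar>mon k l \<omega>\<bar> ^ p))"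
        using mon p by (intro integrable_mult_right Bochner_Integration.integrable_sum fourth_moment_integrable_power) auto
      show "\<bar>increment n m a b l \<omega>\<bar> ^ p \<le> real m ^ (p - 1) * (\<Sum>k\<in>K l. \<bar>a k\<bar> ^ p * \<bar>mon k l \<omega>\<bar> ^ p)" for \<omega>
        using power_sum_le[of "K l" m p "\<lambda>k. a k * mon k l \<omega>"] card_windows_containing[of n l m] p(1)
        by (simp add: increment_eq_sum K_def mon_def abs_mult power_mult_distrib)
    qed
    also have "\<dots> = real m ^ (p - 1) * (\<Sum>k\<in>K l. \<bar>a k\<bar> ^ p * expectation (\<lambda>\<omega>. \<bar>mon k l \<omega>\<bar> ^ p))"
      using mon p fourth_moment_integrable_power by (subst integral_mult_right_zero, subst Bochner_Integration.integral_sum) auto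
    also have "\<dots> \<le> real m ^ (p - 1) * (\<Sum>k\<in>K l. \<bar>a k\<bar> ^ p * (x ^ (m - 1) * c))"
      using mon by (intro mult_left_mono sum_mono) auto
    finally show ?thesis .
  qed
  then have "(\<Sum>l\<in>{1..N}. expectation (\<lambda>\<omega>. \<bar>increment n m a b l \<omega>\<bar> ^ p))
      \<le> (\<Sum>l\<in>{1..N}. real m ^ (p - 1) * (\<Sum>k\<in>K l. \<bar>a k\<bar> ^ p * (x ^ (m - 1) * c)))"
    by (rule sum_mono)
  also have "\<dots> = real m ^ (p - 1) * (\<Sum>l\<in>{1..N}. \<Sum>k\<in>K l. \<bar>a k\<bar> ^ p * (x ^ (m - 1) * c))"
    by (simp add: sum_distrib_left)
  also have "\<dots> \<le> real m ^ (p - 1) * (real m * (\<Sum>k = 1..n. \<bar>a k\<bar> ^ p * (x ^ (m - 1) * c)))"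
    unfolding K_def using nonneg N(2) by (intro mult_left_mono sum_windows_containing_le) auto
  also have "\<dots> = real m ^ p * (x ^ (m - 1) * c * (\<Sum>k = 1..n. \<bar>a k\<bar> ^ p))"
    using p(1) by (cases p) (simp_all add: sum_distrib_left mult_ac)
  finally show ?thesis .
qed

end

section \<open>Approximate integration by parts for the window sums\<close>

locale window_vector = independent_family M X N \<mu>
  for M :: "'a measure" and X :: "nat \<Rightarrow> 'a \<Rightarrow> real" and N :: nat and \<mu> :: "nat \<Rightarrow> real" +
  fixes n :: nat and m :: "'d::finite \<Rightarrow> nat" and a :: "'d \<Rightarrow> nat \<Rightarrow> real"
  assumes windows: "\<And>j. n + m j - 1 \<le> N" and m_pos: "\<And>j. 1 \<le> m j"
begin

definition F :: "'a \<Rightarrow> real ^ 'd" where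
  "F \<omega> = (\<chi> j. window_sum n (m j) (a j) \<mu> X \<omega>)"

definition P :: "'d \<Rightarrow> nat \<Rightarrow> 'a \<Rightarrow> real" where
  "P j = increment n (m j) (a j) False"

definition D :: "'d \<Rightarrow> nat \<Rightarrow> 'a \<Rightarrow> real" where
  "D j = increment n (m j) (a j) True"

definition T :: "'d \<Rightarrow> 'd \<Rightarrow> 'a \<Rightarrow> real" where
  "T j i \<omega> = (\<Sum>l\<in>{1..N}. P j l \<omega> * D i l \<omega>)"

text \<open>This is \<open>F\<close> with \<open>X l\<close> replaced by its mean, as
  \<open>G_component\<close> shows, hence a function of the other variables.\<close>

definition G :: "nat \<Rightarrow> 'a \<Rightarrow> real ^ 'd" where
  "G l \<omega> = F \<omega> - (\<chi> i. D i l \<omega>)"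

lemma P_fourth_moment: "has_fourth_moment M (P j l)"
  unfolding P_def by (rule increment_fourth_moment[OF windows])

lemma D_fourth_moment: "has_fourth_moment M (D j l)"
  unfolding D_def by (rule increment_fourth_moment[OF windows])

lemma F_component: "F \<omega> $ j = (\<Sum>l\<in>{1..N}. P j l \<omega>)"
proof -
  have "window_sum n (m j) (a j) \<mu> X \<omega> = window_sum n (m j) (a j) \<mu> (\<lambda>k x. x k) (\<lambda>k. X k \<omega>)"
    by (simp add: window_sum_def)
  then show ?thesis
    by (simp add: F_def P_def increment_def[abs_def] part_def[abs_def] tail_def[abs_def]
        window_sum_telescope[OF windows])
qed

lemma F_fourth_moment: "has_fourth_moment M (\<lambda>\<omega>. F \<omega> $ j)"
  unfolding F_component by (intro fourth_moment_sum P_fourth_moment)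

lemma G_component: "G l \<omega> $ j = window_sum n (m j) (a j) \<mu> (\<lambda>k x. x k) ((\<lambda>k. X k \<omega>)(l := \<mu> l))"
proof -
  have "window_sum n (m j) (a j) \<mu> X \<omega> = window_sum n (m j) (a j) \<mu> (\<lambda>k x. x k) (\<lambda>k. X k \<omega>)"
    by (simp add: window_sum_def)
  then show ?thesis
    using window_sum_update[of n "m j" "a j" \<mu> "\<lambda>k. X k \<omega>" l]
    by (simp add: G_def F_def D_def increment_def part_def tail_def[abs_def] algebra_simps)
qed

lemma measurable_vec:
  assumes "\<And>j. has_fourth_moment M (\<lambda>\<omega>. Z \<omega> $ j)"
  shows "(Z :: 'a \<Rightarrow> real ^ 'd) \<in> borel_measurable M"
proof -
  have "Z = (\<lambda>\<omega>. \<Sum>j\<in>UNIV. Z \<omega> $ j *\<^sub>R axis j 1)"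
    using basis_expansion[of "Z _"] by (simp add: fun_eq_iff scalar_mult_eq_scaleR)
  moreover have "(\<lambda>\<omega>. \<Sum>j\<in>UNIV. Z \<omega> $ j *\<^sub>R axis j (1::real)) \<in> borel_measurable M"
    using assms by (intro borel_measurable_sum borel_measurable_scaleR) (auto simp: has_fourth_moment_def)
  ultimately show ?thesis by simp
qed

lemma F_measurable[measurable]: "F \<in> borel_measurable M"
  by (intro measurable_vec F_fourth_moment)

lemma G_fourth_moment: "has_fourth_moment M (\<lambda>\<omega>. G l \<omega> $ j)"
  unfolding G_def by (simp add: fourth_moment_diff F_fourth_moment D_fourth_moment)

text \<open>\<open>X\<^sub>l - \<mu>\<^sub>l\<close> is centered and independent of the other two factors.\<close>

lemma expectation_P_mult_G:
  assumes l: "l \<in> {1..N}" and h: "h \<in> borel_measurable borel"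
    and int: "has_fourth_moment M (\<lambda>\<omega>. h (G l \<omega>))"
  shows "expectation (\<lambda>\<omega>. P j l \<omega> * h (G l \<omega>)) = 0"
proof -
  let ?S = "{1..N} - {l}"
  define K where "K x = window_part n (m j) (a j) l x \<mu> *
    h (\<chi> j. window_sum n (m j) (a j) \<mu> (\<lambda>k x. x k) (x(l := \<mu> l)))" for x
  have S: "{k..k + m i - 1} \<subseteq> {1..N}" if "k \<in> {1..n}" for k i
    using that windows[of i] by auto
  \<comment> \<open>Overwriting coordinate \<open>l\<close> by a constant removes the dependence on
    it.\<close>
  have "cylinder ?S (\<lambda>x. (x(l := \<mu> l)) i)" if "i \<in> {1..N}" for i
    using that by (cases "i = l") (auto intro: cylinder_const cylinder_coordinate)
  then have "cylinder ?S (\<lambda>x. window_sum n (m i) (a i) \<mu> (\<lambda>k x. x k) (x(l := \<mu> l)))" for i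
    unfolding window_sum_def using S
    by (intro cylinder_sum cylinder_mult cylinder_diff cylinder_prod cylinder_const) blast
  moreover have "cylinder ?S (\<lambda>x. window_part n (m j) (a j) l x \<mu>)"
    using S[of _ j] by (intro cylinder_window_part cylinder_const) blast
  ultimately have K: "cylinder ?S K"
    unfolding K_def by (intro cylinder_mult cylinder_compose[OF cylinder_vec_lambda h])
  have KX: "K (\<lambda>k. X k \<omega>) = part n (m j) (a j) False l \<omega> * h (G l \<omega>)" for \<omega>
  proof -
    have "(\<chi> j. window_sum n (m j) (a j) \<mu> (\<lambda>k x. x k) ((\<lambda>k. X k \<omega>)(l := \<mu> l))) = G l \<omega>"
      by (simp add: vec_eq_iff G_component)
    then show ?thesis by (simp add: K_def part_def tail_def[abs_def])
  qed
  have K_int: "integrable M (\<lambda>\<omega>. K (\<lambda>k. X k \<omega>))"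
    unfolding KX by (intro integrable_mult2 part_fourth_moment windows int)
  have X_int: "integrable M (X l)" using X_fourth_moment[OF l] by (rule fourth_moment_integrable)
  have "indep_var borel (\<lambda>\<omega>. (\<lambda>x. x l - \<mu> l) (\<lambda>k. X k \<omega>)) borel (\<lambda>\<omega>. K (\<lambda>k. X k \<omega>))"
    using l by (intro indep_var_cylinder[OF indep, of "{l}" ?S] K cylinder_diff cylinder_coordinate cylinder_const) auto
  then have "expectation (\<lambda>\<omega>. (X l \<omega> - \<mu> l) * K (\<lambda>k. X k \<omega>))
      = expectation (\<lambda>\<omega>. X l \<omega> - \<mu> l) * expectation (\<lambda>\<omega>. K (\<lambda>k. X k \<omega>))"
    using X_int K_int by (intro indep_var_lebesgue_integral) auto
  moreover have "expectation (\<lambda>\<omega>. X l \<omega> - \<mu> l) = 0"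
    using X_int \<mu>_eq[OF l] by (simp add: prob_space)
  ultimately show ?thesis
    by (simp add: KX P_def increment_def[abs_def] mult.assoc)
qed

lemma F_expectation: "expectation (\<lambda>\<omega>. F \<omega> $ j) = 0"
proof -
  have "expectation (P j l) = 0" if "l \<in> {1..N}" for l
    using expectation_P_mult_G[OF that, of "\<lambda>_. 1" j] fourth_moment_const by simp
  then show ?thesis
    unfolding F_component using P_fourth_moment fourth_moment_integrable by simp
qed

lemma T_integrable: "integrable M (T j i)"
  unfolding T_def[abs_def]
  by (intro Bochner_Integration.integrable_sum integrable_mult2 P_fourth_moment D_fourth_moment)

text \<open>\<open>F\<close> splits into \<open>G l\<close> and the vector of the
  \<open>D i l\<close>, and \<open>P j l\<close> is orthogonal to the components of
  \<open>G l\<close>; so \<open>F\<close> may be replaced by \<open>D\<close> in each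
  \<open>E[P j l * F i]\<close>.\<close>

lemma T_expectation: "expectation (T j i) = cov_matrix M F $ i $ j"
proof -
  have "expectation (\<lambda>\<omega>. F \<omega> $ i * F \<omega> $ j) = (\<Sum>l\<in>{1..N}. expectation (\<lambda>\<omega>. P j l \<omega> * F \<omega> $ i))"
    unfolding F_component[of _ j] sum_distrib_left
    using integrable_mult2[OF P_fourth_moment F_fourth_moment] by (simp add: mult.commute)
  also have "\<dots> = (\<Sum>l\<in>{1..N}. expectation (\<lambda>\<omega>. P j l \<omega> * D i l \<omega>))"
  proof (rule sum.cong)
    fix l assume l: "l \<in> {1..N}"
    have "expectation (\<lambda>\<omega>. P j l \<omega> * G l \<omega> $ i) = 0"
      by (rule expectation_P_mult_G[OF l, of "\<lambda>x. x $ i"])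
         (auto intro: G_fourth_moment borel_measurable_continuous_onI continuous_intros)
    moreover have "P j l \<omega> * F \<omega> $ i = P j l \<omega> * G l \<omega> $ i + P j l \<omega> * D i l \<omega>" for \<omega>
      by (simp add: G_def algebra_simps)
    ultimately show "expectation (\<lambda>\<omega>. P j l \<omega> * F \<omega> $ i) = expectation (\<lambda>\<omega>. P j l \<omega> * D i l \<omega>)"
      using integrable_mult2[OF P_fourth_moment G_fourth_moment] integrable_mult2[OF P_fourth_moment D_fourth_moment]
      by simp
  qed simp
  also have "\<dots> = expectation (T j i)"
    unfolding T_def using integrable_mult2[OF P_fourth_moment D_fourth_moment] by simp
  finally show ?thesis by (simp add: cov_matrix_def F_expectation)
qed

text \<open>A bounded gradient allows at most linear growth, so fourth moments pass from
  \<open>Z\<close> to \<open>h\<close>.\<close>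

lemma smooth_fourth_moment:
  fixes h :: "real ^ 'd \<Rightarrow> real" and Z :: "'a \<Rightarrow> real ^ 'd"
  assumes C: "C_k (Suc 0) h" and B: "\<And>i y. \<bar>partial_deriv i h y\<bar> \<le> B"
    and Z: "\<And>i. has_fourth_moment M (\<lambda>\<omega>. Z \<omega> $ i)"
  shows "has_fourth_moment M (\<lambda>\<omega>. h (y + s *\<^sub>R Z \<omega>))"
proof (rule fourth_moment_bound)
  show "has_fourth_moment M (\<lambda>\<omega>. \<bar>h y\<bar> + B * (\<Sum>i\<in>UNIV. \<bar>s\<bar> * \<bar>Z \<omega> $ i\<bar>))"
    by (intro fourth_moment_add fourth_moment_const fourth_moment_cmult fourth_moment_sum fourth_moment_abs Z)
  have [measurable]: "Z \<in> borel_measurable M" "h \<in> borel_measurable borel"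
    using measurable_vec[OF Z] C by (auto intro: borel_measurable_continuous_onI)
  show "(\<lambda>\<omega>. h (y + s *\<^sub>R Z \<omega>)) \<in> borel_measurable M" by measurable
  show "\<bar>h (y + s *\<^sub>R Z \<omega>)\<bar> \<le> \<bar>h y\<bar> + B * (\<Sum>i\<in>UNIV. \<bar>s\<bar> * \<bar>Z \<omega> $ i\<bar>)" for \<omega>
    using C1_lipschitz[OF C B, of y "s *\<^sub>R Z \<omega>"] by (simp add: abs_mult)
qed

text \<open>The term \<open>E[P j l * h (y + s G l)]\<close> is zero and may be subtracted; Taylor's
  formula at \<open>y + s F\<close> then yields a second order term whose derivatives do not depend
  on \<open>l\<close>. The shift \<open>y\<close> will be a fixed value of the Gaussian
  part.\<close>

lemma stein_approximation:
  assumes C: "C_k (Suc (Suc 0)) h" and B2: "\<And>i y. \<bar>partial_deriv i h y\<bar> \<le> B2"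
    and B3: "\<And>i j y. \<bar>partial_deriv i (partial_deriv j h) y\<bar> \<le> B3"
  shows "\<bar>expectation (\<lambda>\<omega>. F \<omega> $ j * h (y + s *\<^sub>R F \<omega>))
      - s * (\<Sum>i\<in>UNIV. expectation (\<lambda>\<omega>. partial_deriv i h (y + s *\<^sub>R F \<omega>) * T j i \<omega>))\<bar>
    \<le> s\<^sup>2 * (B3 / 2 * (\<Sum>l\<in>{1..N}. expectation (\<lambda>\<omega>. \<bar>P j l \<omega>\<bar> * (\<Sum>i\<in>UNIV. \<bar>D i l \<omega>\<bar>)\<^sup>2)))"
proof -
  have C1: "C_k (Suc 0) h" and d_cont: "\<And>i. continuous_on UNIV (partial_deriv i h)"
    using C by auto
  have hF: "has_fourth_moment M (\<lambda>\<omega>. h (y + s *\<^sub>R F \<omega>))"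
    and hG: "\<And>l. has_fourth_moment M (\<lambda>\<omega>. h (y + s *\<^sub>R G l \<omega>))"
    by (intro smooth_fourth_moment[OF C1 B2] F_fourth_moment G_fourth_moment)+
  have [measurable]: "\<And>i. partial_deriv i h \<in> borel_measurable borel"
    using d_cont borel_measurable_continuous_onI by blast
  have h_meas[measurable]: "h \<in> borel_measurable borel"
    using C1 by (auto intro: borel_measurable_continuous_onI)
  have dF: "has_fourth_moment M (\<lambda>\<omega>. partial_deriv i h (y + s *\<^sub>R F \<omega>))" for i
    by (rule fourth_moment_bound[OF fourth_moment_const[of B2]]) (use B2 in auto)
  define R where "R l \<omega> = P j l \<omega> * (h (y + s *\<^sub>R F \<omega>) - h (y + s *\<^sub>R G l \<omega>)
      - s * (\<Sum>i\<in>UNIV. D i l \<omega> * partial_deriv i h (y + s *\<^sub>R F \<omega>)))" for l \<omega>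
  have R_int: "integrable M (R l)" and
    R_eq: "l \<in> {1..N} \<Longrightarrow> expectation (R l) = expectation (\<lambda>\<omega>. P j l \<omega> * h (y + s *\<^sub>R F \<omega>))
      - s * (\<Sum>i\<in>UNIV. expectation (\<lambda>\<omega>. P j l \<omega> * D i l \<omega> * partial_deriv i h (y + s *\<^sub>R F \<omega>)))" for l
  proof -
    have R: "R l = (\<lambda>\<omega>. P j l \<omega> * h (y + s *\<^sub>R F \<omega>) - P j l \<omega> * h (y + s *\<^sub>R G l \<omega>)
      - s * (\<Sum>i\<in>UNIV. P j l \<omega> * D i l \<omega> * partial_deriv i h (y + s *\<^sub>R F \<omega>)))"
      by (simp add: R_def fun_eq_iff algebra_simps sum_distrib_left)
    note int = integrable_mult2[OF P_fourth_moment[of j l] hF] integrable_mult2[OF P_fourth_moment[of j l] hG[of l]]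
      integrable_mult3[OF P_fourth_moment[of j l] D_fourth_moment[of _ l] dF]
    show "integrable M (R l)" unfolding R using int by simp
    assume "l \<in> {1..N}"
    then have "expectation (\<lambda>\<omega>. P j l \<omega> * h (y + s *\<^sub>R G l \<omega>)) = 0"
      using hG by (intro expectation_P_mult_G[where h = "\<lambda>x. h (y + s *\<^sub>R x)"]) auto
    then show "expectation (R l) = expectation (\<lambda>\<omega>. P j l \<omega> * h (y + s *\<^sub>R F \<omega>))
      - s * (\<Sum>i\<in>UNIV. expectation (\<lambda>\<omega>. P j l \<omega> * D i l \<omega> * partial_deriv i h (y + s *\<^sub>R F \<omega>)))"
      unfolding R using int by simp
  qed
  have Q_int: "integrable M (\<lambda>\<omega>. \<bar>P j l \<omega>\<bar> * (\<Sum>i\<in>UNIV. \<bar>D i l \<omega>\<bar>)\<^sup>2)" for l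
    unfolding power2_eq_square mult.assoc[symmetric]
    by (intro integrable_mult3 fourth_moment_sum fourth_moment_abs P_fourth_moment D_fourth_moment)
  have R_bound: "\<bar>R l \<omega>\<bar> \<le> s\<^sup>2 * (B3 / 2) * (\<bar>P j l \<omega>\<bar> * (\<Sum>i\<in>UNIV. \<bar>D i l \<omega>\<bar>)\<^sup>2)" for l \<omega>
  proof -
    let ?k = "- (s *\<^sub>R (\<chi> i. D i l \<omega>))"
    have G_eq: "y + s *\<^sub>R G l \<omega> = (y + s *\<^sub>R F \<omega>) + ?k"
      by (simp add: G_def scaleR_diff_right)
    have "\<bar>h (y + s *\<^sub>R G l \<omega>) - h (y + s *\<^sub>R F \<omega>) - (\<Sum>i\<in>UNIV. ?k $ i * partial_deriv i h (y + s *\<^sub>R F \<omega>))\<bar>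
        \<le> B3 / 2 * (\<Sum>i\<in>UNIV. \<bar>?k $ i\<bar>)\<^sup>2"
      using C2_Taylor[OF C B3, of "y + s *\<^sub>R F \<omega>" ?k] by (simp only: G_eq)
    also have "(\<Sum>i\<in>UNIV. \<bar>?k $ i\<bar>) = \<bar>s\<bar> * (\<Sum>i\<in>UNIV. \<bar>D i l \<omega>\<bar>)"
      by (simp add: abs_mult sum_distrib_left)
    also have "(\<Sum>i\<in>UNIV. ?k $ i * partial_deriv i h (y + s *\<^sub>R F \<omega>))
        = - (s * (\<Sum>i\<in>UNIV. D i l \<omega> * partial_deriv i h (y + s *\<^sub>R F \<omega>)))"
      by (simp add: sum_distrib_left sum_negf mult.assoc)
    finally have "\<bar>h (y + s *\<^sub>R F \<omega>) - h (y + s *\<^sub>R G l \<omega>) - s * (\<Sum>i\<in>UNIV. D i l \<omega> * partial_deriv i h (y + s *\<^sub>R F \<omega>))\<bar>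
        \<le> B3 / 2 * (\<bar>s\<bar> * (\<Sum>i\<in>UNIV. \<bar>D i l \<omega>\<bar>))\<^sup>2" by linarith
    then have "\<bar>P j l \<omega>\<bar> * \<bar>h (y + s *\<^sub>R F \<omega>) - h (y + s *\<^sub>R G l \<omega>) - s * (\<Sum>i\<in>UNIV. D i l \<omega> * partial_deriv i h (y + s *\<^sub>R F \<omega>))\<bar>
        \<le> \<bar>P j l \<omega>\<bar> * (B3 / 2 * (\<bar>s\<bar> * (\<Sum>i\<in>UNIV. \<bar>D i l \<omega>\<bar>))\<^sup>2)"
      by (intro mult_left_mono) auto
    then show ?thesis by (simp add: R_def abs_mult power_mult_distrib mult_ac)
  qed
  have "expectation (\<lambda>\<omega>. F \<omega> $ j * h (y + s *\<^sub>R F \<omega>)) = (\<Sum>l\<in>{1..N}. expectation (\<lambda>\<omega>. P j l \<omega> * h (y + s *\<^sub>R F \<omega>)))"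
    unfolding F_component[of _ j] sum_distrib_right
    using integrable_mult2[OF P_fourth_moment hF] by simp
  moreover have "expectation (\<lambda>\<omega>. partial_deriv i h (y + s *\<^sub>R F \<omega>) * T j i \<omega>)
      = (\<Sum>l\<in>{1..N}. expectation (\<lambda>\<omega>. P j l \<omega> * D i l \<omega> * partial_deriv i h (y + s *\<^sub>R F \<omega>)))" for i
    unfolding T_def sum_distrib_left
    using integrable_mult3[OF P_fourth_moment D_fourth_moment dF] by (simp add: mult_ac)
  ultimately have "expectation (\<lambda>\<omega>. F \<omega> $ j * h (y + s *\<^sub>R F \<omega>))
      - s * (\<Sum>i\<in>UNIV. expectation (\<lambda>\<omega>. partial_deriv i h (y + s *\<^sub>R F \<omega>) * T j i \<omega>))
      = (\<Sum>l\<in>{1..N}. expectation (R l))"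
    by (simp add: R_eq sum_subtractf sum_distrib_left) (rule sum.swap)
  moreover have "\<bar>expectation (R l)\<bar> \<le> s\<^sup>2 * (B3 / 2) * expectation (\<lambda>\<omega>. \<bar>P j l \<omega>\<bar> * (\<Sum>i\<in>UNIV. \<bar>D i l \<omega>\<bar>)\<^sup>2)" for l
  proof -
    have "\<bar>expectation (R l)\<bar> \<le> expectation (\<lambda>\<omega>. \<bar>R l \<omega>\<bar>)" by (rule integral_abs_bound)
    also have "\<dots> \<le> expectation (\<lambda>\<omega>. s\<^sup>2 * (B3 / 2) * (\<bar>P j l \<omega>\<bar> * (\<Sum>i\<in>UNIV. \<bar>D i l \<omega>\<bar>)\<^sup>2))"
      using R_int Q_int R_bound by (intro integral_mono) auto
    finally show ?thesis by simp
  qed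
  ultimately show ?thesis
    by (auto simp: sum_distrib_left mult.assoc intro!: order_trans[OF sum_abs] sum_mono)
qed

text \<open>Expanding the square gives products of three increments, each at most the mean of their
  cubes. For every index the other two are free, hence the factor \<open>CARD('d) ^ 2\<close>; the
  weights 1/3 for \<open>P\<close> and 2/3 for \<open>D\<close> add up to one.\<close>

lemma third_order_sum_le:
  assumes "\<And>j. (\<Sum>l\<in>{1..N}. expectation (\<lambda>\<omega>. \<bar>P j l \<omega>\<bar> ^ 3)) \<le> Q j"
    and "\<And>j. (\<Sum>l\<in>{1..N}. expectation (\<lambda>\<omega>. \<bar>D j l \<omega>\<bar> ^ 3)) \<le> Q j"
  shows "(\<Sum>j\<in>UNIV. \<Sum>l\<in>{1..N}. expectation (\<lambda>\<omega>. \<bar>P j l \<omega>\<bar> * (\<Sum>i\<in>UNIV. \<bar>D i l \<omega>\<bar>)\<^sup>2))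
    \<le> real CARD('d) ^ 2 * (\<Sum>j\<in>UNIV. Q j)"
proof -
  define p q where "p j l = expectation (\<lambda>\<omega>. \<bar>P j l \<omega>\<bar> ^ 3)"
    and "q j l = expectation (\<lambda>\<omega>. \<bar>D j l \<omega>\<bar> ^ 3)" for j l
  let ?d = "real CARD('d)"
  have int3: "integrable M (\<lambda>\<omega>. \<bar>P j l \<omega>\<bar> ^ 3)" "integrable M (\<lambda>\<omega>. \<bar>D j l \<omega>\<bar> ^ 3)" for j l
    using P_fourth_moment D_fourth_moment by (auto intro: fourth_moment_integrable_power)
  have int: "integrable M (\<lambda>\<omega>. \<bar>P j l \<omega>\<bar> * \<bar>D i l \<omega>\<bar> * \<bar>D k l \<omega>\<bar>)" for i j k l
    by (intro integrable_mult3 fourth_moment_abs P_fourth_moment D_fourth_moment)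
  have triple: "expectation (\<lambda>\<omega>. \<bar>P j l \<omega>\<bar> * \<bar>D i l \<omega>\<bar> * \<bar>D k l \<omega>\<bar>) \<le> (p j l + q i l + q k l) / 3" for i j k l
  proof -
    have "expectation (\<lambda>\<omega>. \<bar>P j l \<omega>\<bar> * \<bar>D i l \<omega>\<bar> * \<bar>D k l \<omega>\<bar>)
        \<le> expectation (\<lambda>\<omega>. (\<bar>P j l \<omega>\<bar> ^ 3 + \<bar>D i l \<omega>\<bar> ^ 3 + \<bar>D k l \<omega>\<bar> ^ 3) / 3)"
      using int int3 by (intro integral_mono mult3_le_sum_pow3) auto
    also have "\<dots> = (p j l + q i l + q k l) / 3"
      using int3 by (simp add: p_def q_def)
    finally show ?thesis .
  qed
  have "\<bar>P j l \<omega>\<bar> * (\<Sum>i\<in>UNIV. \<bar>D i l \<omega>\<bar>)\<^sup>2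
      = (\<Sum>i\<in>UNIV. \<Sum>k\<in>UNIV. \<bar>P j l \<omega>\<bar> * \<bar>D i l \<omega>\<bar> * \<bar>D k l \<omega>\<bar>)" for j l \<omega>
    by (simp only: power2_eq_square sum_product) (simp only: sum_distrib_left mult.assoc)
  then have "expectation (\<lambda>\<omega>. \<bar>P j l \<omega>\<bar> * (\<Sum>i\<in>UNIV. \<bar>D i l \<omega>\<bar>)\<^sup>2)
      = (\<Sum>i\<in>UNIV. \<Sum>k\<in>UNIV. expectation (\<lambda>\<omega>. \<bar>P j l \<omega>\<bar> * \<bar>D i l \<omega>\<bar> * \<bar>D k l \<omega>\<bar>))" for j l
    using int by simp
  then have "(\<Sum>j\<in>UNIV. \<Sum>l\<in>{1..N}. expectation (\<lambda>\<omega>. \<bar>P j l \<omega>\<bar> * (\<Sum>i\<in>UNIV. \<bar>D i l \<omega>\<bar>)\<^sup>2))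
      \<le> (\<Sum>j\<in>UNIV. \<Sum>l\<in>{1..N}. \<Sum>i\<in>UNIV. \<Sum>k\<in>UNIV. (p j l + q i l + q k l) / 3)"
    by (simp only:) (intro sum_mono triple)
  also have "\<dots> = (\<Sum>l\<in>{1..N}. ?d\<^sup>2 * ((\<Sum>j\<in>UNIV. p j l) + 2 * (\<Sum>j\<in>UNIV. q j l)) / 3)"
    by (subst sum.swap, intro sum.cong refl)
       (simp add: sum.distrib sum_divide_distrib[symmetric] sum_distrib_left[symmetric] power2_eq_square algebra_simps)
  also have "\<dots> = ?d\<^sup>2 * ((\<Sum>j\<in>UNIV. \<Sum>l\<in>{1..N}. p j l) + 2 * (\<Sum>j\<in>UNIV. \<Sum>l\<in>{1..N}. q j l)) / 3"
    by (subst (1 2) sum.swap) (simp add: sum_divide_distrib[symmetric] sum_distrib_left[symmetric] sum.distrib)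
  also have "\<dots> \<le> ?d\<^sup>2 * ((\<Sum>j\<in>UNIV. Q j) + 2 * (\<Sum>j\<in>UNIV. Q j)) / 3"
    using assms unfolding p_def q_def
    by (intro divide_right_mono mult_left_mono add_mono sum_mono) auto
  finally show ?thesis by simp
qed

text \<open>
  Each summand of \<open>T\<close> depends on fewer than \<open>4 max m\<^sub>i m\<^sub>j \<le> 4 m\<^sub>i m\<^sub>j\<close> others. The weight \<open>m\<^sub>j / m\<^sub>i\<close> in the
  AM-GM inequality for \<open>P\<^sup>2 D\<^sup>2\<close> makes this factor split into \<open>m\<^sub>i\<^sup>2\<close> and \<open>m\<^sub>j\<^sup>2\<close>.
\<close>

lemma T_deviation_le:
  assumes R: "(\<Sum>l\<in>{1..N}. expectation (\<lambda>\<omega>. \<bar>P j l \<omega>\<bar> ^ 4)) \<le> Rj"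
      "(\<Sum>l\<in>{1..N}. expectation (\<lambda>\<omega>. \<bar>D i l \<omega>\<bar> ^ 4)) \<le> Ri"
    and nonneg: "0 \<le> Ri" "0 \<le> Rj"
  shows "expectation (\<lambda>\<omega>. \<bar>T j i \<omega> - cov_matrix M F $ i $ j\<bar>)
    \<le> sqrt 2 * (real (m j) * sqrt Rj + real (m i) * sqrt Ri)"
proof -
  \<comment> \<open>Windows of the two lengths through \<open>l\<close> stay at distance less than
    \<open>q\<close> from \<open>l\<close>, so a summand uses only variables in
    \<open>{l + 1 - q..<l + q}\<close>; two such ranges are disjoint once
    \<open>l + (2 * q - 1) \<le> l'\<close>.\<close>
  define q where "q = max (m i) (m j)"
  define W where "W l \<omega> = P j l \<omega> * D i l \<omega>" for l \<omega>
  define w where "w l x = ((x l - \<mu> l) * window_part n (m j) (a j) l x \<mu>) *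
    ((x l - \<mu> l) * window_part n (m i) (a i) l x x)" for l x
  have W_eq: "W l \<omega> = w l (\<lambda>k. X k \<omega>)" for l \<omega>
    by (simp add: W_def w_def P_def D_def increment_def part_def tail_def[abs_def])
  have w_cyl: "cylinder ({l + 1 - q..<l + q} \<inter> {1..N}) (w l)" if "l \<in> {1..N}" for l
  proof -
    let ?S = "{l + 1 - q..<l + q} \<inter> {1..N}"
    have l: "l \<in> ?S" using that m_pos[of i] by (auto simp: q_def)
    have sub: "{k..k + m h - 1} - {l} \<subseteq> ?S"
      if "h = i \<or> h = j" "k \<in> {1..n}" "l \<in> {k..k + m h - 1}" for h k
    proof -
      have "m h \<le> q" using that(1) by (auto simp: q_def)
      then show ?thesis using that windows[of h] m_pos[of h] by auto
    qed
    show ?thesis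
      unfolding w_def using l sub
      by (intro cylinder_mult cylinder_diff cylinder_const cylinder_coordinate cylinder_window_part) auto
  qed
  have W_int: "integrable M (W l)" "integrable M (\<lambda>\<omega>. (W l \<omega>)\<^sup>2)" for l
  proof -
    show "integrable M (W l)"
      unfolding W_def[abs_def] by (intro integrable_mult2 P_fourth_moment D_fourth_moment)
    have "(W l \<omega>)\<^sup>2 = P j l \<omega> * D i l \<omega> * P j l \<omega> * D i l \<omega>" for \<omega>
      by (simp add: W_def power2_eq_square)
    then show "integrable M (\<lambda>\<omega>. (W l \<omega>)\<^sup>2)"
      by (simp only:) (intro integrable_mult4 P_fourth_moment D_fourth_moment)
  qed
  have c: "2 * real (2 * q - 1) \<le> 4 * real (m i) * real (m j)"
  proof -
    have "m i * 1 \<le> m i * m j" "1 * m j \<le> m i * m j"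
      using m_pos by (intro mult_le_mono; simp)+
    then have "q \<le> m i * m j" by (simp add: q_def)
    then have "2 * (2 * q - 1) \<le> 4 * m i * m j" by linarith
    then show ?thesis by (simp only: of_nat_le_iff[symmetric, where 'a = real]) simp
  qed
  have indep_W: "indep_var borel (W l) borel (W l')"
    if "l \<in> {1..N}" "l' \<in> {1..N}" "l + (2 * q - 1) \<le> l'" for l l'
    unfolding W_eq[abs_def]
    by (rule indep_var_cylinder[OF indep _ _ _ w_cyl w_cyl]) (use that in auto)
  have Wsq: "expectation (\<lambda>\<omega>. (W l \<omega>)\<^sup>2) \<le> (real (m j) / real (m i) * expectation (\<lambda>\<omega>. \<bar>P j l \<omega>\<bar> ^ 4)
      + real (m i) / real (m j) * expectation (\<lambda>\<omega>. \<bar>D i l \<omega>\<bar> ^ 4)) / 2" for l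
  proof -
    let ?c = "real (m j) / real (m i)"
    have m: "0 < real (m i)" "0 < real (m j)" using m_pos[of i] m_pos[of j] by auto
    have int4: "integrable M (\<lambda>\<omega>. \<bar>P j l \<omega>\<bar> ^ 4)" "integrable M (\<lambda>\<omega>. \<bar>D i l \<omega>\<bar> ^ 4)"
      using fourth_moment_integrable_power[OF P_fourth_moment, of 4]
        fourth_moment_integrable_power[OF D_fourth_moment, of 4] by auto
    have amgm: "u\<^sup>2 * v\<^sup>2 \<le> (?c * u ^ 4 + real (m i) / real (m j) * v ^ 4) / 2" for u v :: real
    proof -
      have "0 \<le> (real (m j) * u\<^sup>2 - real (m i) * v\<^sup>2)\<^sup>2 / (2 * real (m i) * real (m j))"
        using m by simp
      also have "\<dots> = (?c * u ^ 4 + real (m i) / real (m j) * v ^ 4) / 2 - u\<^sup>2 * v\<^sup>2"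
        using m by (simp add: field_simps power2_eq_square power4_eq_xxxx)
      finally show ?thesis by simp
    qed
    have "expectation (\<lambda>\<omega>. (W l \<omega>)\<^sup>2)
        \<le> expectation (\<lambda>\<omega>. (?c * \<bar>P j l \<omega>\<bar> ^ 4 + real (m i) / real (m j) * \<bar>D i l \<omega>\<bar> ^ 4) / 2)"
    proof (rule integral_mono[OF W_int(2)])
      show "integrable M (\<lambda>\<omega>. (?c * \<bar>P j l \<omega>\<bar> ^ 4 + real (m i) / real (m j) * \<bar>D i l \<omega>\<bar> ^ 4) / 2)"
        using int4 by (intro integrable_divide Bochner_Integration.integrable_add integrable_mult_right)
      show "(W l \<omega>)\<^sup>2 \<le> (?c * \<bar>P j l \<omega>\<bar> ^ 4 + real (m i) / real (m j) * \<bar>D i l \<omega>\<bar> ^ 4) / 2" for \<omega>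
        using amgm[of "P j l \<omega>" "D i l \<omega>"] by (simp add: W_def power_mult_distrib)
    qed
    also have "\<dots> = (?c * expectation (\<lambda>\<omega>. \<bar>P j l \<omega>\<bar> ^ 4) + real (m i) / real (m j) * expectation (\<lambda>\<omega>. \<bar>D i l \<omega>\<bar> ^ 4)) / 2"
      using int4 by (simp only: integral_divide_zero Bochner_Integration.integral_add integrable_mult_right integral_mult_right_zero)
    finally show ?thesis .
  qed
  have "T j i \<omega> - cov_matrix M F $ i $ j = (\<Sum>l\<in>{1..N}. W l \<omega>) - (\<Sum>l\<in>{1..N}. expectation (W l))" for \<omega>
    using W_int unfolding T_expectation[symmetric] T_def[abs_def] W_def[symmetric] by simp
  then have "(expectation (\<lambda>\<omega>. \<bar>T j i \<omega> - cov_matrix M F $ i $ j\<bar>))\<^sup>2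
      \<le> 4 * real (m i) * real (m j) * (\<Sum>l\<in>{1..N}. expectation (\<lambda>\<omega>. (W l \<omega>)\<^sup>2))"
    using variance_local_dependence[OF finite_atLeastAtMost W_int indep_W c] by simp
  also have "\<dots> \<le> 4 * real (m i) * real (m j) * ((real (m j) / real (m i) * Rj + real (m i) / real (m j) * Ri) / 2)"
  proof (rule mult_left_mono)
    have "(\<Sum>l\<in>{1..N}. expectation (\<lambda>\<omega>. (W l \<omega>)\<^sup>2))
        \<le> (\<Sum>l\<in>{1..N}. (real (m j) / real (m i) * expectation (\<lambda>\<omega>. \<bar>P j l \<omega>\<bar> ^ 4)
          + real (m i) / real (m j) * expectation (\<lambda>\<omega>. \<bar>D i l \<omega>\<bar> ^ 4)) / 2)"
      by (rule sum_mono[OF Wsq])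
    also have "\<dots> = (real (m j) / real (m i) * (\<Sum>l\<in>{1..N}. expectation (\<lambda>\<omega>. \<bar>P j l \<omega>\<bar> ^ 4))
          + real (m i) / real (m j) * (\<Sum>l\<in>{1..N}. expectation (\<lambda>\<omega>. \<bar>D i l \<omega>\<bar> ^ 4))) / 2"
      by (simp only: sum_divide_distrib[symmetric] sum.distrib sum_distrib_left)
    also have "\<dots> \<le> (real (m j) / real (m i) * Rj + real (m i) / real (m j) * Ri) / 2"
      using R by (intro divide_right_mono add_mono mult_left_mono) auto
    finally show "(\<Sum>l\<in>{1..N}. expectation (\<lambda>\<omega>. (W l \<omega>)\<^sup>2))
        \<le> (real (m j) / real (m i) * Rj + real (m i) / real (m j) * Ri) / 2" .
  qed simp
  also have "\<dots> = 2 * ((real (m j))\<^sup>2 * Rj + (real (m i))\<^sup>2 * Ri)"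
    using m_pos[of i] m_pos[of j] by (simp add: field_simps power2_eq_square)
  also have "\<dots> = 2 * ((real (m j) * sqrt Rj)\<^sup>2 + (real (m i) * sqrt Ri)\<^sup>2)"
    using nonneg by (simp add: power_mult_distrib)
  \<comment> \<open>For nonnegative numbers the sum of squares is at most the square of the sum;
    this separates the contributions of \<open>i\<close> and \<open>j\<close> after taking the
    root.\<close>
  also have "\<dots> \<le> 2 * (real (m j) * sqrt Rj + real (m i) * sqrt Ri)\<^sup>2"
    using nonneg by (simp add: power2_sum)
  also have "\<dots> = (sqrt 2 * (real (m j) * sqrt Rj + real (m i) * sqrt Ri))\<^sup>2"
    by (simp add: power_mult_distrib)
  finally show ?thesis
    by (rule power2_le_imp_le) (use nonneg in simp)
qed

end

section \<open>Interpolation\<close>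

lemma integrable_pair_fst:
  fixes f :: "'a \<Rightarrow> real"
  assumes "prob_space M1" "prob_space M2" "integrable M1 f"
  shows "integrable (M1 \<Otimes>\<^sub>M M2) (\<lambda>p. f (fst p))"
proof -
  interpret M1: prob_space M1 by fact
  interpret M2: prob_space M2 by fact
  interpret pair_prob_space M1 M2 ..
  have [measurable]: "f \<in> borel_measurable M1" using assms(3) by (rule borel_measurable_integrable)
  show ?thesis
    using assms(3) by (intro Fubini_integrable) (auto simp: M2.prob_space)
qed

lemma integrable_pair_snd:
  fixes f :: "'b \<Rightarrow> real"
  assumes "prob_space M1" "prob_space M2" "integrable M2 f"
  shows "integrable (M1 \<Otimes>\<^sub>M M2) (\<lambda>p. f (snd p))"
proof -
  interpret M1: prob_space M1 by fact
  interpret M2: prob_space M2 by fact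
  interpret pair_prob_space M1 M2 ..
  have [measurable]: "f \<in> borel_measurable M2" using assms(3) by (rule borel_measurable_integrable)
  show ?thesis
    using assms(3) by (intro Fubini_integrable) auto
qed

section \<open>Comparison on the product space\<close>

text \<open>\<open>F\<close> and \<open>Y\<close> may live on different spaces. Only their laws
  enter the claim, so the coupling is a free choice, and the product measure makes them
  independent.\<close>

locale gaussian_comparison =
  window_vector M X N \<mu> n m a + Y: centered_gaussian M' Y
  for M :: "'a measure" and X :: "nat \<Rightarrow> 'a \<Rightarrow> real" and N :: nat and \<mu> :: "nat \<Rightarrow> real"
    and n :: nat and m :: "'d::finite \<Rightarrow> nat" and a :: "'d \<Rightarrow> nat \<Rightarrow> real"
    and M' :: "'b measure" and Y :: "'b \<Rightarrow> real ^ 'd" +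
  fixes g :: "real ^ 'd \<Rightarrow> real" and B2 B3 :: real
  assumes cov_eq: "cov_matrix M' Y = cov_matrix M F"
    and C3: "C_k (Suc (Suc (Suc 0))) g"
    and B2: "\<And>i j y. \<bar>partial_deriv i (partial_deriv j g) y\<bar> \<le> B2"
    and B3: "\<And>i j k y. \<bar>partial_deriv i (partial_deriv j (partial_deriv k g)) y\<bar> \<le> B3"
begin

sublocale pair: pair_prob_space M M' ..

abbreviation "MM \<equiv> M \<Otimes>\<^sub>M M'"

lemma B2_nonneg: "0 \<le> B2" and B3_nonneg: "0 \<le> B3"
  using B2[of undefined undefined 0] B3[of undefined undefined undefined 0] by linarith+

lemma C2_partial: "C_k (Suc (Suc 0)) (partial_deriv j g)"
  and C1_partial: "C_k (Suc 0) (partial_deriv j g)"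
  and C2_g: "C_k (Suc (Suc 0)) g" and C1_g: "C_k (Suc 0) g"
  using C3 by auto

lemma g_measurable[measurable]: "g \<in> borel_measurable borel"
  using C3 by (auto intro: borel_measurable_continuous_onI)

lemma partial_cont: "continuous_on UNIV (partial_deriv j g)"
  using C3 by auto

lemma partial_measurable[measurable]: "partial_deriv j g \<in> borel_measurable borel"
  by (intro borel_measurable_continuous_onI partial_cont)

lemma partial2_measurable[measurable]: "partial_deriv i (partial_deriv j g) \<in> borel_measurable borel"
  using C3 by (auto intro: borel_measurable_continuous_onI)

text \<open>The l1 size of the pair. The integrands built from \<open>g\<close> and its gradient are
  dominated by polynomials in \<open>S\<close> of degree at most two, uniformly along the
  path.\<close>

definition S :: "'a \<times> 'b \<Rightarrow> real" where
  "S p = (\<Sum>i\<in>UNIV. \<bar>F (fst p) $ i\<bar> + \<bar>Y (snd p) $ i\<bar>)"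

definition A :: real where
  "A = (\<Sum>j\<in>UNIV. \<bar>partial_deriv j g 0\<bar>)"

lemma S_nonneg: "0 \<le> S p"
  unfolding S_def by (intro sum_nonneg) auto

lemma component_le_S: "\<bar>F (fst p) $ i\<bar> \<le> S p" "\<bar>Y (snd p) $ i\<bar> \<le> S p"
proof -
  have "\<bar>F (fst p) $ i\<bar> + \<bar>Y (snd p) $ i\<bar> \<le> S p"
    unfolding S_def by (rule member_le_sum) auto
  then show "\<bar>F (fst p) $ i\<bar> \<le> S p" "\<bar>Y (snd p) $ i\<bar> \<le> S p" by linarith+
qed

lemma S_integrable: "integrable MM S" and S_square_integrable: "integrable MM (\<lambda>p. (S p)\<^sup>2)"
proof -
  have [measurable]: "S \<in> borel_measurable MM"
    unfolding S_def by measurable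
  have F1: "integrable M (\<lambda>\<omega>. \<bar>F \<omega> $ i\<bar>)" and F2: "integrable M (\<lambda>\<omega>. (F \<omega> $ i)\<^sup>2)" for i
    using fourth_moment_integrable[OF F_fourth_moment] fourth_moment_integrable_power[OF F_fourth_moment, of 2] by auto
  have Y1: "integrable M' (\<lambda>\<omega>. \<bar>Y \<omega> $ i\<bar>)" and Y2: "integrable M' (\<lambda>\<omega>. (Y \<omega> $ i)\<^sup>2)" for i
    using Y.component_integrable Y.component_square_integrable by auto
  note fst = integrable_pair_fst[OF prob_space_axioms Y.prob_space_axioms]
    and snd = integrable_pair_snd[OF prob_space_axioms Y.prob_space_axioms]
  show "integrable MM S"
    unfolding S_def[abs_def]
    by (intro Bochner_Integration.integrable_sum Bochner_Integration.integrable_add fst[OF F1] snd[OF Y1])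
  let ?d = "real CARD('d)"
  have bound: "(S p)\<^sup>2 \<le> ?d * (\<Sum>i\<in>UNIV. 2 * ((F (fst p) $ i)\<^sup>2 + (Y (snd p) $ i)\<^sup>2))" for p
  proof -
    have "(S p)\<^sup>2 \<le> ?d ^ (2 - 1) * (\<Sum>i\<in>UNIV. \<bar>\<bar>F (fst p) $ i\<bar> + \<bar>Y (snd p) $ i\<bar>\<bar> ^ 2)"
      using power_sum_le[of "UNIV :: 'd set" "CARD('d)" 2 "\<lambda>i. \<bar>F (fst p) $ i\<bar> + \<bar>Y (snd p) $ i\<bar>"]
      by (simp add: S_def)
    also have "\<dots> \<le> ?d ^ (2 - 1) * (\<Sum>i\<in>UNIV. 2 * ((F (fst p) $ i)\<^sup>2 + (Y (snd p) $ i)\<^sup>2))"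
    proof (intro mult_left_mono sum_mono)
      fix i
      have "(u + v)\<^sup>2 \<le> 2 * (u\<^sup>2 + v\<^sup>2)" for u v :: real
        using zero_le_power2[of "u - v"] by (simp add: power2_sum power2_diff)
      from this[of "\<bar>F (fst p) $ i\<bar>" "\<bar>Y (snd p) $ i\<bar>"]
      show "\<bar>\<bar>F (fst p) $ i\<bar> + \<bar>Y (snd p) $ i\<bar>\<bar> ^ 2 \<le> 2 * ((F (fst p) $ i)\<^sup>2 + (Y (snd p) $ i)\<^sup>2)" by simp
    qed simp
    finally show ?thesis by simp
  qed
  show "integrable MM (\<lambda>p. (S p)\<^sup>2)"
  proof (rule Bochner_Integration.integrable_bound)
    show "integrable MM (\<lambda>p. ?d * (\<Sum>i\<in>UNIV. 2 * ((F (fst p) $ i)\<^sup>2 + (Y (snd p) $ i)\<^sup>2)))"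
      by (intro integrable_mult_right Bochner_Integration.integrable_sum Bochner_Integration.integrable_add fst[OF F2] snd[OF Y2])
    show "AE p in MM. norm ((S p)\<^sup>2) \<le> norm (?d * (\<Sum>i\<in>UNIV. 2 * ((F (fst p) $ i)\<^sup>2 + (Y (snd p) $ i)\<^sup>2)))"
      using bound by (intro AE_I2) (simp add: order_trans[OF _ abs_ge_self])
  qed simp
qed

lemma gradient_bound:
  assumes "\<bar>s\<bar> \<le> 1" "\<bar>c\<bar> \<le> 1"
  shows "\<bar>partial_deriv j g (s *\<^sub>R F (fst p) + c *\<^sub>R Y (snd p))\<bar> \<le> A + B2 * S p"
proof -
  let ?z = "s *\<^sub>R F (fst p) + c *\<^sub>R Y (snd p)"
  have "(\<Sum>i\<in>UNIV. \<bar>?z $ i\<bar>) \<le> S p"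
    unfolding S_def
  proof (rule sum_mono)
    fix i
    have "\<bar>s\<bar> * \<bar>F (fst p) $ i\<bar> \<le> \<bar>F (fst p) $ i\<bar>" "\<bar>c\<bar> * \<bar>Y (snd p) $ i\<bar> \<le> \<bar>Y (snd p) $ i\<bar>"
      using assms by (simp_all add: mult_left_le_one_le)
    then show "\<bar>?z $ i\<bar> \<le> \<bar>F (fst p) $ i\<bar> + \<bar>Y (snd p) $ i\<bar>"
      using abs_triangle_ineq[of "s * F (fst p) $ i" "c * Y (snd p) $ i"] by (simp add: abs_mult)
  qed
  then have "B2 * (\<Sum>i\<in>UNIV. \<bar>?z $ i\<bar>) \<le> B2 * S p" by (intro mult_left_mono B2_nonneg)
  moreover have "\<bar>partial_deriv j g ?z - partial_deriv j g 0\<bar> \<le> B2 * (\<Sum>i\<in>UNIV. \<bar>?z $ i\<bar>)"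
    using C1_lipschitz[OF C1_partial B2, of j 0 ?z] by simp
  moreover have "\<bar>partial_deriv j g 0\<bar> \<le> A"
    unfolding A_def by (rule member_le_sum) auto
  ultimately show ?thesis by linarith
qed

lemma integrable_component_gradient:
  assumes "\<bar>s\<bar> \<le> 1" "\<bar>c\<bar> \<le> 1"
  shows "integrable MM (\<lambda>p. F (fst p) $ j * partial_deriv i g (s *\<^sub>R F (fst p) + c *\<^sub>R Y (snd p)))"
    and "integrable MM (\<lambda>p. Y (snd p) $ j * partial_deriv i g (s *\<^sub>R F (fst p) + c *\<^sub>R Y (snd p)))"
proof -
  have dom: "integrable MM (\<lambda>p. A * S p + B2 * (S p)\<^sup>2)"
    using S_integrable S_square_integrable by simp
  have le: "\<bar>u * partial_deriv i g (s *\<^sub>R F (fst p) + c *\<^sub>R Y (snd p))\<bar> \<le> A * S p + B2 * (S p)\<^sup>2"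
    if "\<bar>u\<bar> \<le> S p" for u p
  proof -
    have "\<bar>u * partial_deriv i g (s *\<^sub>R F (fst p) + c *\<^sub>R Y (snd p))\<bar> \<le> S p * (A + B2 * S p)"
      unfolding abs_mult by (rule mult_mono[OF that gradient_bound[OF assms] S_nonneg]) simp
    then show ?thesis by (simp add: algebra_simps power2_eq_square)
  qed
  show "integrable MM (\<lambda>p. F (fst p) $ j * partial_deriv i g (s *\<^sub>R F (fst p) + c *\<^sub>R Y (snd p)))"
    by (rule Bochner_Integration.integrable_bound[OF dom], measurable)
       (use le component_le_S in \<open>simp add: order_trans[OF _ abs_ge_self]\<close>)
  show "integrable MM (\<lambda>p. Y (snd p) $ j * partial_deriv i g (s *\<^sub>R F (fst p) + c *\<^sub>R Y (snd p)))"
    by (rule Bochner_Integration.integrable_bound[OF dom], measurable)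
       (use le component_le_S in \<open>simp add: order_trans[OF _ abs_ge_self]\<close>)
qed

text \<open>Taylor's formula at 0 gives \<open>g\<close> at most quadratic growth, so second moments
  of \<open>F\<close> and \<open>Y\<close> suffice.\<close>

lemma integrable_g: "integrable MM (\<lambda>p. g (F (fst p)))" "integrable MM (\<lambda>p. g (Y (snd p)))"
proof -
  have dom: "integrable MM (\<lambda>p. \<bar>g 0\<bar> + (real CARD('d) * A * S p + B2 / 2 * (real CARD('d) * S p)\<^sup>2))"
    using S_integrable S_square_integrable by (simp add: power_mult_distrib)
  have le: "\<bar>g z\<bar> \<le> \<bar>g 0\<bar> + (real CARD('d) * A * S p + B2 / 2 * (real CARD('d) * S p)\<^sup>2)"
    if z: "\<And>i. \<bar>z $ i\<bar> \<le> S p" for z p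
  proof -
    have sum: "(\<Sum>i\<in>UNIV. \<bar>z $ i\<bar>) \<le> real CARD('d) * S p"
      using sum_bounded_above[of UNIV "\<lambda>i. \<bar>z $ i\<bar>" "S p"] z by simp
    have lin: "\<bar>\<Sum>i\<in>UNIV. z $ i * partial_deriv i g 0\<bar> \<le> (\<Sum>i\<in>(UNIV :: 'd set). A * S p)"
    proof (intro order_trans[OF sum_abs] sum_mono)
      fix i
      have "\<bar>partial_deriv i g 0\<bar> \<le> A" unfolding A_def by (rule member_le_sum) auto
      then have "\<bar>z $ i\<bar> * \<bar>partial_deriv i g 0\<bar> \<le> S p * A"
        using z[of i] S_nonneg by (intro mult_mono) auto
      then show "\<bar>z $ i * partial_deriv i g 0\<bar> \<le> A * S p" by (simp add: abs_mult mult.commute)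
    qed
    have quad: "B2 / 2 * (\<Sum>i\<in>UNIV. \<bar>z $ i\<bar>)\<^sup>2 \<le> B2 / 2 * (real CARD('d) * S p)\<^sup>2"
      using sum B2_nonneg by (intro mult_left_mono power_mono sum_nonneg) auto
    have taylor: "\<bar>g z - g 0 - (\<Sum>i\<in>UNIV. z $ i * partial_deriv i g 0)\<bar> \<le> B2 / 2 * (\<Sum>i\<in>UNIV. \<bar>z $ i\<bar>)\<^sup>2"
      using C2_Taylor[OF C2_g B2, of 0 z] by simp
    have "\<bar>g z\<bar> \<le> \<bar>g 0\<bar> + (\<bar>\<Sum>i\<in>UNIV. z $ i * partial_deriv i g 0\<bar> + \<bar>g z - g 0 - (\<Sum>i\<in>UNIV. z $ i * partial_deriv i g 0)\<bar>)"
      by linarith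
    also have "\<dots> \<le> \<bar>g 0\<bar> + ((\<Sum>i\<in>(UNIV :: 'd set). A * S p) + B2 / 2 * (real CARD('d) * S p)\<^sup>2)"
      by (intro add_left_mono add_mono lin order_trans[OF taylor quad])
    finally show ?thesis by (simp add: mult.assoc)
  qed
  show "integrable MM (\<lambda>p. g (F (fst p)))"
    by (rule Bochner_Integration.integrable_bound[OF dom], measurable)
       (use le component_le_S in \<open>simp add: order_trans[OF _ abs_ge_self]\<close>)
  show "integrable MM (\<lambda>p. g (Y (snd p)))"
    by (rule Bochner_Integration.integrable_bound[OF dom], measurable)
       (use le component_le_S in \<open>simp add: order_trans[OF _ abs_ge_self]\<close>)
qed

definition L :: "'d \<Rightarrow> real" where
  "L j = (\<Sum>l\<in>{1..N}. expectation (\<lambda>\<omega>. \<bar>P j l \<omega>\<bar> * (\<Sum>i\<in>UNIV. \<bar>D i l \<omega>\<bar>)\<^sup>2))"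

text \<open>By \<open>T_expectation\<close> this is the mean absolute deviation of
  \<open>T j i\<close>.\<close>

definition dev :: "'d \<Rightarrow> 'd \<Rightarrow> real" where
  "dev j i = expectation (\<lambda>\<omega>. \<bar>T j i \<omega> - cov_matrix M F $ i $ j\<bar>)"

lemma integrable_hessian:
  "integrable MM (\<lambda>p. partial_deriv i (partial_deriv j g) (s *\<^sub>R F (fst p) + c *\<^sub>R Y (snd p)))"
  using B2 by (intro pair.integrable_const_bound[of _ B2]) auto

lemma integrable_hessian_T:
  "integrable MM (\<lambda>p. partial_deriv i (partial_deriv j g) (s *\<^sub>R F (fst p) + c *\<^sub>R Y (snd p)) * T k l (fst p))"
proof (rule Bochner_Integration.integrable_bound)
  show "integrable MM (\<lambda>p. B2 * T k l (fst p))"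
    by (intro integrable_mult_right integrable_pair_fst T_integrable prob_space_axioms Y.prob_space_axioms)
  have [measurable]: "T k l \<in> borel_measurable M" using T_integrable by (rule borel_measurable_integrable)
  show "(\<lambda>p. partial_deriv i (partial_deriv j g) (s *\<^sub>R F (fst p) + c *\<^sub>R Y (snd p)) * T k l (fst p)) \<in> borel_measurable MM"
    by measurable
  show "AE p in MM. norm (partial_deriv i (partial_deriv j g) (s *\<^sub>R F (fst p) + c *\<^sub>R Y (snd p)) * T k l (fst p))
      \<le> norm (B2 * T k l (fst p))"
    using B2 B2_nonneg by (intro AE_I2) (simp add: abs_mult mult_right_mono)
qed

text \<open>\<open>stein_approximation\<close> is applied for each fixed value of \<open>Y\<close>;
  its error bound does not depend on that value, so it survives integration over
  \<open>M'\<close>.\<close>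

lemma expectation_F_gradient:
  assumes "\<bar>s\<bar> \<le> 1" "\<bar>c\<bar> \<le> 1"
  shows "\<bar>(\<integral>p. F (fst p) $ j * partial_deriv j g (s *\<^sub>R F (fst p) + c *\<^sub>R Y (snd p)) \<partial>MM)
      - s * (\<Sum>i\<in>UNIV. \<integral>p. partial_deriv i (partial_deriv j g) (s *\<^sub>R F (fst p) + c *\<^sub>R Y (snd p)) * T j i (fst p) \<partial>MM)\<bar>
    \<le> s\<^sup>2 * (B3 / 2 * L j)"
proof -
  define U where "U \<omega> \<omega>' = F \<omega> $ j * partial_deriv j g (s *\<^sub>R F \<omega> + c *\<^sub>R Y \<omega>')" for \<omega> \<omega>'
  define V where "V i \<omega> \<omega>' = partial_deriv i (partial_deriv j g) (s *\<^sub>R F \<omega> + c *\<^sub>R Y \<omega>') * T j i \<omega>" for i \<omega> \<omega>'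
  have U: "integrable MM (case_prod U)"
    using integrable_component_gradient(1)[OF assms, of j j] by (simp add: U_def case_prod_unfold)
  have V: "integrable MM (case_prod (V i))" for i
    using integrable_hessian_T[of i j s c j i] by (simp add: V_def case_prod_unfold)
  let ?R = "\<lambda>\<omega>'. expectation (\<lambda>\<omega>. U \<omega> \<omega>') - s * (\<Sum>i\<in>UNIV. expectation (\<lambda>\<omega>. V i \<omega> \<omega>'))"
  have R: "\<bar>?R \<omega>'\<bar> \<le> s\<^sup>2 * (B3 / 2 * L j)" for \<omega>'
    using stein_approximation[OF C2_partial[of j] B2 B3, where j = j and s = s and y = "c *\<^sub>R Y \<omega>'"]
    by (simp add: U_def V_def L_def add.commute)
  have "\<bar>\<integral>\<omega>'. ?R \<omega>' \<partial>M'\<bar> \<le> (\<integral>\<omega>'. \<bar>?R \<omega>'\<bar> \<partial>M')" by (rule integral_abs_bound)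
  also have "\<dots> \<le> (\<integral>\<omega>'. s\<^sup>2 * (B3 / 2 * L j) \<partial>M')"
    using pair.integrable_snd[OF U] pair.integrable_snd[OF V] R by (intro integral_mono) auto
  also have "\<dots> = s\<^sup>2 * (B3 / 2 * L j)" by (simp add: Y.prob_space)
  also have "(\<integral>\<omega>'. ?R \<omega>' \<partial>M') = integral\<^sup>L MM (case_prod U) - s * (\<Sum>i\<in>UNIV. integral\<^sup>L MM (case_prod (V i)))"
    using pair.integrable_snd[OF U] pair.integrable_snd[OF V] pair.integral_snd[OF U] pair.integral_snd[OF V] by simp
  finally show ?thesis by (simp add: U_def V_def case_prod_unfold)
qed

text \<open>Here the value of \<open>F\<close> is fixed, Gaussian integration by parts is applied in
  the inner integral, and Fubini's theorem returns to the product.\<close>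

lemma expectation_Y_gradient:
  assumes "\<bar>s\<bar> \<le> 1" "\<bar>c\<bar> \<le> 1"
  shows "(\<integral>p. Y (snd p) $ j * partial_deriv j g (s *\<^sub>R F (fst p) + c *\<^sub>R Y (snd p)) \<partial>MM)
    = c * (\<Sum>i\<in>UNIV. cov_matrix M F $ i $ j *
        (\<integral>p. partial_deriv i (partial_deriv j g) (s *\<^sub>R F (fst p) + c *\<^sub>R Y (snd p)) \<partial>MM))"
proof -
  have "(\<integral>p. Y (snd p) $ j * partial_deriv j g (s *\<^sub>R F (fst p) + c *\<^sub>R Y (snd p)) \<partial>MM)
      = (\<integral>\<omega>. \<integral>\<omega>'. Y \<omega>' $ j * partial_deriv j g (s *\<^sub>R F \<omega> + c *\<^sub>R Y \<omega>') \<partial>M' \<partial>M)"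
    using pair.integral_fst'[OF integrable_component_gradient(2)[OF assms, of j j]] by simp
  also have "\<dots> = (\<integral>\<omega>. c * (\<Sum>i\<in>UNIV. Y.cov i j * (\<integral>\<omega>'. partial_deriv i (partial_deriv j g) (s *\<^sub>R F \<omega> + c *\<^sub>R Y \<omega>') \<partial>M')) \<partial>M)"
    by (simp only: Y.integration_by_parts[OF C1_partial B2])
  also have "\<dots> = c * (\<Sum>i\<in>UNIV. Y.cov i j * (\<integral>\<omega>. \<integral>\<omega>'. partial_deriv i (partial_deriv j g) (s *\<^sub>R F \<omega> + c *\<^sub>R Y \<omega>') \<partial>M' \<partial>M))"
    using pair.integrable_fst'[OF integrable_hessian[of _ j s c]] by simp
  also have "\<dots> = c * (\<Sum>i\<in>UNIV. cov_matrix M F $ i $ j *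
        (\<integral>p. partial_deriv i (partial_deriv j g) (s *\<^sub>R F (fst p) + c *\<^sub>R Y (snd p)) \<partial>MM))"
    using pair.integral_fst'[OF integrable_hessian[of _ j s c]] by (simp add: Y.cov_matrix_eq[symmetric] cov_eq)
  finally show ?thesis .
qed

text \<open>The derivative in \<open>\<theta>\<close> of \<open>g\<close> along the path
  \<open>sin \<theta> *\<^sub>R F + cos \<theta> *\<^sub>R Y\<close>.\<close>

definition H :: "real \<Rightarrow> 'a \<times> 'b \<Rightarrow> real" where
  "H \<theta> p = (\<Sum>j\<in>UNIV. (cos \<theta> * F (fst p) $ j - sin \<theta> * Y (snd p) $ j) *
    partial_deriv j g (sin \<theta> *\<^sub>R F (fst p) + cos \<theta> *\<^sub>R Y (snd p)))"

lemma H_integrable: "integrable MM (H \<theta>)"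
proof -
  have "H \<theta> = (\<lambda>p. \<Sum>j\<in>UNIV. cos \<theta> * (F (fst p) $ j * partial_deriv j g (sin \<theta> *\<^sub>R F (fst p) + cos \<theta> *\<^sub>R Y (snd p)))
      - sin \<theta> * (Y (snd p) $ j * partial_deriv j g (sin \<theta> *\<^sub>R F (fst p) + cos \<theta> *\<^sub>R Y (snd p))))"
    by (simp add: H_def fun_eq_iff left_diff_distrib mult.assoc)
  then show ?thesis
    using integrable_component_gradient[of "sin \<theta>" "cos \<theta>"] by simp
qed

text \<open>Once the common factor \<open>sin \<theta> * cos \<theta>\<close> is taken out, the
  second order terms differ only by \<open>T\<close> in place of the covariance. This difference is
  tested against a bounded second derivative, so its first absolute moment suffices.\<close>

lemma H_expectation_le:
  assumes "0 \<le> sin \<theta>" "0 \<le> cos \<theta>"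
  shows "\<bar>integral\<^sup>L MM (H \<theta>)\<bar> \<le> sin \<theta> * cos \<theta> * (B2 * (\<Sum>j\<in>UNIV. \<Sum>i\<in>UNIV. dev j i))
    + (sin \<theta>)\<^sup>2 * cos \<theta> * (B3 / 2 * (\<Sum>j\<in>UNIV. L j))"
proof -
  define s c where "s = sin \<theta>" and "c = cos \<theta>"
  have sc: "\<bar>s\<bar> \<le> 1" "\<bar>c\<bar> \<le> 1" "0 \<le> s" "0 \<le> c"
    using assms by (simp_all add: s_def c_def)
  let ?Z = "\<lambda>p. s *\<^sub>R F (fst p) + c *\<^sub>R Y (snd p)"
  let ?h = "\<lambda>i j p. partial_deriv i (partial_deriv j g) (?Z p)"
  define u where "u j = (\<integral>p. F (fst p) $ j * partial_deriv j g (?Z p) \<partial>MM)" for j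
  define t where "t j i = (\<integral>p. ?h i j p * T j i (fst p) \<partial>MM)" for j i
  define k where "k j i = cov_matrix M F $ i $ j * (\<integral>p. ?h i j p \<partial>MM)" for j i
  have H: "H \<theta> = (\<lambda>p. \<Sum>j\<in>UNIV. c * (F (fst p) $ j * partial_deriv j g (?Z p)) - s * (Y (snd p) $ j * partial_deriv j g (?Z p)))"
    by (simp add: H_def fun_eq_iff left_diff_distrib mult.assoc s_def c_def)
  have "integral\<^sup>L MM (H \<theta>) = (\<Sum>j\<in>UNIV. c * u j - s * (c * (\<Sum>i\<in>UNIV. k j i)))"
    unfolding H using integrable_component_gradient[OF sc(1,2)]
    by (simp add: u_def k_def expectation_Y_gradient[OF sc(1,2)])
  \<comment> \<open>Adding and subtracting \<open>s * c * t j i\<close> separates the Taylor error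
    from the fluctuation of \<open>T\<close>.\<close>
  also have "\<dots> = (\<Sum>j\<in>UNIV. c * (u j - s * (\<Sum>i\<in>UNIV. t j i)) + s * c * (\<Sum>i\<in>UNIV. t j i - k j i))"
    by (simp add: sum_subtractf algebra_simps)
  finally have split: "integral\<^sup>L MM (H \<theta>)
      = (\<Sum>j\<in>UNIV. c * (u j - s * (\<Sum>i\<in>UNIV. t j i)) + s * c * (\<Sum>i\<in>UNIV. t j i - k j i))" .
  have "\<bar>integral\<^sup>L MM (H \<theta>)\<bar> \<le> (\<Sum>j\<in>UNIV. c * (s\<^sup>2 * (B3 / 2 * L j)) + s * c * (\<Sum>i\<in>UNIV. B2 * dev j i))"
    unfolding split
  proof (intro order_trans[OF sum_abs] sum_mono order_trans[OF abs_triangle_ineq] add_mono)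
    fix j
    have "\<bar>u j - s * (\<Sum>i\<in>UNIV. t j i)\<bar> \<le> s\<^sup>2 * (B3 / 2 * L j)"
      using expectation_F_gradient[OF sc(1,2)] by (simp add: u_def t_def)
    then show "\<bar>c * (u j - s * (\<Sum>i\<in>UNIV. t j i))\<bar> \<le> c * (s\<^sup>2 * (B3 / 2 * L j))"
      using sc by (simp only: abs_mult abs_of_nonneg mult_left_mono)
    have "\<bar>t j i - k j i\<bar> \<le> B2 * dev j i" for i
    proof -
      let ?C = "cov_matrix M F $ i $ j"
      have T_int: "integrable M (\<lambda>\<omega>. \<bar>T j i \<omega> - ?C\<bar>)" using T_integrable by simp
      have int: "integrable MM (\<lambda>p. B2 * \<bar>T j i (fst p) - ?C\<bar>)"
        using integrable_pair_fst[OF prob_space_axioms Y.prob_space_axioms T_int] by simp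
      have i1: "integrable MM (\<lambda>p. ?h i j p * T j i (fst p))"
        by (rule integrable_hessian_T)
      have i2: "integrable MM (\<lambda>p. ?C * ?h i j p)"
        by (rule integrable_mult_right, rule integrable_hessian)
      have pointwise: "\<bar>?h i j p * T j i (fst p) - ?C * ?h i j p\<bar> \<le> B2 * \<bar>T j i (fst p) - ?C\<bar>" for p
      proof -
        have "?h i j p * T j i (fst p) - ?C * ?h i j p = ?h i j p * (T j i (fst p) - ?C)"
          by (simp add: right_diff_distrib mult.commute)
        then show ?thesis
          using B2 by (simp only: abs_mult) (intro mult_right_mono, auto)
      qed
      have diff: "t j i - k j i = (\<integral>p. ?h i j p * T j i (fst p) - ?C * ?h i j p \<partial>MM)"
        by (simp only: t_def k_def Bochner_Integration.integral_diff[OF i1 i2] integral_mult_right_zero)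
      have "\<bar>t j i - k j i\<bar> \<le> (\<integral>p. \<bar>?h i j p * T j i (fst p) - ?C * ?h i j p\<bar> \<partial>MM)"
        unfolding diff by (rule integral_abs_bound)
      also have "\<dots> \<le> (\<integral>p. B2 * \<bar>T j i (fst p) - ?C\<bar> \<partial>MM)"
        by (rule integral_mono[OF integrable_abs[OF Bochner_Integration.integrable_diff[OF i1 i2]] int pointwise])
      also have "\<dots> = B2 * dev j i"
        using pair.integral_fst'[OF int, symmetric] by (simp add: dev_def Y.prob_space)
      finally show ?thesis .
    qed
    then have "\<bar>\<Sum>i\<in>UNIV. t j i - k j i\<bar> \<le> (\<Sum>i\<in>UNIV. B2 * dev j i)"
      by (intro order_trans[OF sum_abs] sum_mono)
    then show "\<bar>s * c * (\<Sum>i\<in>UNIV. t j i - k j i)\<bar> \<le> s * c * (\<Sum>i\<in>UNIV. B2 * dev j i)"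
      using sc by (simp add: abs_mult mult_left_mono)
  qed
  also have "\<dots> = s * c * (B2 * (\<Sum>j\<in>UNIV. \<Sum>i\<in>UNIV. dev j i)) + s\<^sup>2 * c * (B3 / 2 * (\<Sum>j\<in>UNIV. L j))"
    unfolding sum.distrib sum_distrib_left[symmetric] by (simp only: mult_ac add.commute)
  finally show ?thesis unfolding s_def c_def .
qed

theorem gaussian_interpolation:
  "\<bar>expectation (\<lambda>\<omega>. g (F \<omega>)) - Y.expectation (\<lambda>\<omega>. g (Y \<omega>))\<bar>
    \<le> B2 / 2 * (\<Sum>j\<in>UNIV. \<Sum>i\<in>UNIV. dev j i) + B3 / 6 * (\<Sum>j\<in>UNIV. L j)"
proof -
  let ?I = "{0..pi / 2}"
  let ?K2 = "B2 * (\<Sum>j\<in>UNIV. \<Sum>i\<in>UNIV. dev j i)" and ?K3 = "B3 / 2 * (\<Sum>j\<in>UNIV. L j)"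
  interpret Q: pair_sigma_finite lborel MM ..
  \<comment> \<open>The indicator turns the path integral into one over the whole line, so that
    Fubini's theorem for \<open>lborel\<close> and \<open>MM\<close> applies.\<close>
  define \<Phi> where "\<Phi> \<theta> p = H \<theta> p * indicator ?I \<theta>" for \<theta> p
  have \<Phi>_meas[measurable]: "case_prod \<Phi> \<in> borel_measurable (lborel \<Otimes>\<^sub>M MM)"
    unfolding \<Phi>_def H_def by measurable
  have H_bound: "\<bar>H \<theta> p\<bar> \<le> (\<Sum>j\<in>(UNIV :: 'd set). 2 * (A * S p + B2 * (S p)\<^sup>2))" for \<theta> p
    unfolding H_def
  proof (intro order_trans[OF sum_abs] sum_mono)
    fix j
    have "\<bar>cos \<theta>\<bar> * \<bar>F (fst p) $ j\<bar> \<le> 1 * S p" "\<bar>sin \<theta>\<bar> * \<bar>Y (snd p) $ j\<bar> \<le> 1 * S p"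
      by (intro mult_mono component_le_S; simp add: S_nonneg)+
    then have "\<bar>cos \<theta> * F (fst p) $ j - sin \<theta> * Y (snd p) $ j\<bar> \<le> 2 * S p"
      using abs_triangle_ineq4[of "cos \<theta> * F (fst p) $ j" "sin \<theta> * Y (snd p) $ j"] by (simp add: abs_mult)
    then have "\<bar>(cos \<theta> * F (fst p) $ j - sin \<theta> * Y (snd p) $ j) *
        partial_deriv j g (sin \<theta> *\<^sub>R F (fst p) + cos \<theta> *\<^sub>R Y (snd p))\<bar> \<le> (2 * S p) * (A + B2 * S p)"
      unfolding abs_mult by (intro mult_mono gradient_bound) (auto simp: S_nonneg)
    then show "\<bar>(cos \<theta> * F (fst p) $ j - sin \<theta> * Y (snd p) $ j) *
        partial_deriv j g (sin \<theta> *\<^sub>R F (fst p) + cos \<theta> *\<^sub>R Y (snd p))\<bar> \<le> 2 * (A * S p + B2 * (S p)\<^sup>2)"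
      by (simp add: algebra_simps power2_eq_square)
  qed
  define b where "b p = (\<Sum>j\<in>(UNIV :: 'd set). 2 * (A * S p + B2 * (S p)\<^sup>2))" for p
  have b_int: "integrable MM b"
    unfolding b_def[abs_def] using S_integrable S_square_integrable by simp
  have \<Phi>_int: "integrable (lborel \<Otimes>\<^sub>M MM) (case_prod \<Phi>)"
  proof (rule Q.Fubini_integrable[OF \<Phi>_meas])
    show "integrable lborel (\<lambda>\<theta>. \<integral>p. norm (case (\<theta>, p) of (\<theta>, p) \<Rightarrow> \<Phi> \<theta> p) \<partial>MM)"
    proof (rule Bochner_Integration.integrable_bound)
      show "integrable lborel (\<lambda>\<theta>. integral\<^sup>L MM b * indicator ?I \<theta> :: real)" by simp
      show "AE \<theta> in lborel. norm (\<integral>p. norm (case (\<theta>, p) of (\<theta>, p) \<Rightarrow> \<Phi> \<theta> p) \<partial>MM) \<le> norm (integral\<^sup>L MM b * indicator ?I \<theta> :: real)"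
      proof (rule AE_I2)
        fix \<theta> :: real
        have "(\<integral>p. \<bar>H \<theta> p\<bar> \<partial>MM) \<le> integral\<^sup>L MM b"
          using H_integrable b_int H_bound by (intro integral_mono) (auto simp: b_def)
        then show "norm (\<integral>p. norm (case (\<theta>, p) of (\<theta>, p) \<Rightarrow> \<Phi> \<theta> p) \<partial>MM) \<le> norm (integral\<^sup>L MM b * indicator ?I \<theta> :: real)"
          by (auto simp: \<Phi>_def indicator_def)
      qed
    qed measurable
    show "AE \<theta> in lborel. integrable MM (\<lambda>p. case (\<theta>, p) of (\<theta>, p) \<Rightarrow> \<Phi> \<theta> p)"
      by (intro AE_I2) (simp add: \<Phi>_def H_integrable)
  qed
  have path: "(\<integral>\<theta>. \<Phi> \<theta> p \<partial>lborel) = g (F (fst p)) - g (Y (snd p))" for p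
  proof -
    let ?f = "\<lambda>\<theta>. g (sin \<theta> *\<^sub>R F (fst p) + cos \<theta> *\<^sub>R Y (snd p))"
    have "(\<integral>\<theta>. H \<theta> p * indicator ?I \<theta> \<partial>lborel) = ?f (pi / 2) - ?f 0"
    proof (rule integral_FTC_Icc_real)
      fix \<theta> :: real
      have "((\<lambda>\<theta>. sin \<theta> *\<^sub>R F (fst p) + cos \<theta> *\<^sub>R Y (snd p)) has_vector_derivative
          cos \<theta> *\<^sub>R F (fst p) - sin \<theta> *\<^sub>R Y (snd p)) (at \<theta>)"
        by (auto intro!: derivative_eq_intros)
      from C1_has_real_derivative_compose[OF C1_g this]
      show "(?f has_real_derivative H \<theta> p) (at \<theta>)" by (simp add: H_def)
      have "continuous_on UNIV (\<lambda>\<theta>. H \<theta> p)"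
        unfolding H_def by (intro continuous_intros continuous_on_compose2[OF partial_cont]) auto
      then show "isCont (\<lambda>\<theta>. H \<theta> p) \<theta>" by (simp add: continuous_on_eq_continuous_at)
    qed simp
    then show ?thesis by (simp add: \<Phi>_def)
  qed
  have "expectation (\<lambda>\<omega>. g (F \<omega>)) - Y.expectation (\<lambda>\<omega>. g (Y \<omega>)) = (\<integral>p. g (F (fst p)) - g (Y (snd p)) \<partial>MM)"
    using integrable_g pair.integral_fst'[OF integrable_g(1)] pair.integral_fst'[OF integrable_g(2)]
    by (simp add: prob_space Y.prob_space)
  also have "\<dots> = (\<integral>p. \<integral>\<theta>. \<Phi> \<theta> p \<partial>lborel \<partial>MM)" by (simp only: path)
  also have "\<dots> = (\<integral>\<theta>. \<integral>p. \<Phi> \<theta> p \<partial>MM \<partial>lborel)" by (rule Q.Fubini_integral[OF \<Phi>_int])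
  also have "\<bar>\<dots>\<bar> \<le> (\<integral>\<theta>. \<bar>\<integral>p. \<Phi> \<theta> p \<partial>MM\<bar> \<partial>lborel)" by (rule integral_abs_bound)
  also have "\<dots> \<le> (\<integral>\<theta>. (sin \<theta> * cos \<theta> * ?K2 + (sin \<theta>)\<^sup>2 * cos \<theta> * ?K3) * indicator ?I \<theta> \<partial>lborel)"
  proof (rule integral_mono)
    show "integrable lborel (\<lambda>\<theta>. \<bar>\<integral>p. \<Phi> \<theta> p \<partial>MM\<bar>)"
      using Q.integrable_fst[OF \<Phi>_int] by simp
    have "integrable lborel (\<lambda>\<theta>. indicator ?I \<theta> *\<^sub>R (sin \<theta> * cos \<theta> * ?K2 + (sin \<theta>)\<^sup>2 * cos \<theta> * ?K3))"
      by (intro borel_integrable_compact continuous_intros) auto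
    then show "integrable lborel (\<lambda>\<theta>. (sin \<theta> * cos \<theta> * ?K2 + (sin \<theta>)\<^sup>2 * cos \<theta> * ?K3) * indicator ?I \<theta>)"
      by (simp add: mult.commute)
    fix \<theta> :: real
    show "\<bar>\<integral>p. \<Phi> \<theta> p \<partial>MM\<bar> \<le> (sin \<theta> * cos \<theta> * ?K2 + (sin \<theta>)\<^sup>2 * cos \<theta> * ?K3) * indicator ?I \<theta>"
    proof (cases "\<theta> \<in> ?I")
      case True
      then have "0 \<le> sin \<theta>" "0 \<le> cos \<theta>" by (auto intro: sin_ge_zero cos_ge_zero)
      then show ?thesis using H_expectation_le[of \<theta>] True by (simp add: \<Phi>_def)
    qed (simp add: \<Phi>_def)
  qed
  \<comment> \<open>The antiderivatives of the two weights are \<open>sin^2 / 2\<close> and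
    \<open>sin^3 / 3\<close>; their increments over the quarter circle are the factors 1/2 and
    1/3.\<close>
  also have "\<dots> = ((sin (pi / 2))\<^sup>2 / 2 * ?K2 + (sin (pi / 2)) ^ 3 / 3 * ?K3) - ((sin 0)\<^sup>2 / 2 * ?K2 + (sin 0) ^ 3 / 3 * ?K3)"
    by (rule integral_FTC_Icc_real)
       (auto intro!: derivative_eq_intros continuous_intros simp: power2_eq_square)
  also have "\<dots> = B2 / 2 * (\<Sum>j\<in>UNIV. \<Sum>i\<in>UNIV. dev j i) + B3 / 6 * (\<Sum>j\<in>UNIV. L j)" by simp
  finally show ?thesis .
qed

end

section \<open>The bound in terms of moments and coefficients\<close>

theorem theorem4p2:
  fixes n N :: nat
    and m :: "'d::{finite,linorder} \<Rightarrow> nat"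
    and M :: "'a measure" and X :: "nat \<Rightarrow> 'a \<Rightarrow> real" and \<mu> :: "nat \<Rightarrow> real"
    and a :: "'d \<Rightarrow> nat \<Rightarrow> real"
    and F :: "'a \<Rightarrow> real ^ 'd::{finite,linorder}"
    and M' :: "'b measure" and Y :: "'b \<Rightarrow> real ^ 'd::{finite,linorder}"
    and g :: "real ^ 'd::{finite,linorder} \<Rightarrow> real"
    and x1 x2 y1 y2 :: real
  assumes "2 \<le> CARD('d)" and "1 \<le> n"
    and "\<And>j. 1 \<le> m j" and "mono m"
    and "N = n + m (Max UNIV) - 1"
    and "prob_space M"
    and "prob_space.indep_vars M (\<lambda>_. borel) X {1..N}"
    and "\<And>i. i \<in> {1..N} \<Longrightarrow> integrable M (\<lambda>\<omega>. X i \<omega> ^ 4)"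
    and "\<And>i. i \<in> {1..N} \<Longrightarrow> \<mu> i = prob_space.expectation M (X i)"
    and "\<And>\<omega>. F \<omega> = (\<chi> j. window_sum n (m j) (a j) \<mu> X \<omega>)"
    and "prob_space M'"
    and "gaussian_vector M' Y" and "centered M' Y"
    and "cov_matrix M' Y = cov_matrix M F"
    and "C_k 3 g" and "deriv_norm 2 g + deriv_norm 3 g < \<infinity>"
    and "x1 = (MAX i \<in> {1..N}. prob_space.expectation M (\<lambda>\<omega>. \<bar>X i \<omega>\<bar> ^ 3))"
    and "x2 = (MAX i \<in> {1..N}. prob_space.expectation M (\<lambda>\<omega>. \<bar>X i \<omega> - \<mu> i\<bar> ^ 3))"
    and "y1 = (MAX i \<in> {1..N}. prob_space.expectation M (\<lambda>\<omega>. \<bar>X i \<omega>\<bar> ^ 4))"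
    and "y2 = (MAX i \<in> {1..N}. prob_space.expectation M (\<lambda>\<omega>. \<bar>X i \<omega> - \<mu> i\<bar> ^ 4))"
  shows "\<bar>prob_space.expectation M (\<lambda>\<omega>. g (F \<omega>)) - prob_space.expectation M' (\<lambda>\<omega>. g (Y \<omega>))\<bar>
    \<le> sqrt 2 * real_of_ereal (deriv_norm 2 g) * real CARD('d) *
          (\<Sum>j\<in>UNIV. real (m j) ^ 3 *
             sqrt (y1 ^ (m j - 1) * y2 * (\<Sum>k = 1..n. \<bar>a j k\<bar> ^ 4)))
      + real_of_ereal (deriv_norm 3 g) * real CARD('d) ^ 2 / 3 *
          (\<Sum>j\<in>UNIV. real (m j) ^ 3 * x1 ^ (m j - 1) * x2 * (\<Sum>k = 1..n. \<bar>a j k\<bar> ^ 3))"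
proof -
  interpret M: prob_space M by fact
  interpret M': prob_space M' by fact
  interpret I: independent_family M X N \<mu>
    by unfold_locales (use assms in auto)
  have m_N: "n + m j - 1 \<le> N" for j
    using assms(4,5) monoD[OF assms(4), of j "Max UNIV"] by simp
  interpret W: window_vector M X N \<mu> n m a
    by unfold_locales (use m_N assms(3) in auto)
  have F: "F = W.F"
    using assms(10) by (simp add: fun_eq_iff W.F_def)
  have C: "C_k (Suc (Suc (Suc 0))) g" "C_k (Suc (Suc 0)) g"
    using assms(15) by (auto simp: numeral_3_eq_3)
  have finite_norms: "deriv_norm 2 g < \<infinity>" "deriv_norm 3 g < \<infinity>"
    using assms(16) deriv_norm_nonneg[of 2 g] deriv_norm_nonneg[of 3 g] by auto
  define B2 B3 where "B2 = real_of_ereal (deriv_norm 2 g)" and "B3 = real_of_ereal (deriv_norm 3 g)"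
  interpret G: centered_gaussian M' Y
    by unfold_locales fact+
  interpret K: gaussian_comparison M X N \<mu> n m a M' Y g B2 B3
  proof unfold_locales
    show "cov_matrix M' Y = cov_matrix M W.F" using assms(14) F by simp
    show "\<bar>partial_deriv i (partial_deriv j g) y\<bar> \<le> B2" for i j y
      unfolding B2_def by (rule abs_partial_deriv_2_le[OF C(2) finite_norms(1)])
    show "\<bar>partial_deriv i (partial_deriv j (partial_deriv k g)) y\<bar> \<le> B3" for i j k y
      unfolding B3_def by (rule abs_partial_deriv_3_le[OF C(1) finite_norms(2)])
  qed (fact C(1))
  \<comment> \<open>The index set of the maxima contains 1, so they are bounded below by a
    nonnegative expectation.\<close>
  have "1 \<in> {1..N}" using assms(2,5) assms(3)[of "Max UNIV"] by auto
  have x1: "M.expectation (\<lambda>\<omega>. \<bar>X i \<omega>\<bar> ^ 3) \<le> x1" and x2: "M.expectation (\<lambda>\<omega>. \<bar>X i \<omega> - \<mu> i\<bar> ^ 3) \<le> x2"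
    and y1: "M.expectation (\<lambda>\<omega>. \<bar>X i \<omega>\<bar> ^ 4) \<le> y1" and y2: "M.expectation (\<lambda>\<omega>. \<bar>X i \<omega> - \<mu> i\<bar> ^ 4) \<le> y2"
    if "i \<in> {1..N}" for i
    unfolding assms(17-20) using that by (auto intro!: Max_ge)
  have nonneg: "0 \<le> x1" "0 \<le> x2" "0 \<le> y1" "0 \<le> y2"
    using \<open>1 \<in> {1..N}\<close> by (auto intro!: order_trans[OF _ x1[of 1]] order_trans[OF _ x2[of 1]]
        order_trans[OF _ y1[of 1]] order_trans[OF _ y2[of 1]])
  define Q where "Q j = real (m j) ^ 3 * (x1 ^ (m j - 1) * x2 * (\<Sum>k = 1..n. \<bar>a j k\<bar> ^ 3))" for j
  define R where "R j = real (m j) ^ 4 * (y1 ^ (m j - 1) * y2 * (\<Sum>k = 1..n. \<bar>a j k\<bar> ^ 4))" for j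
  define b where "b j = real (m j) ^ 3 * sqrt (y1 ^ (m j - 1) * y2 * (\<Sum>k = 1..n. \<bar>a j k\<bar> ^ 4))" for j
  have Q_nonneg: "0 \<le> Q j" and R_nonneg: "0 \<le> R j" for j
    unfolding Q_def R_def using nonneg by (auto intro!: mult_nonneg_nonneg sum_nonneg)
  have Q: "(\<Sum>l\<in>{1..N}. M.expectation (\<lambda>\<omega>. \<bar>W.P j l \<omega>\<bar> ^ 3)) \<le> Q j"
    "(\<Sum>l\<in>{1..N}. M.expectation (\<lambda>\<omega>. \<bar>W.D j l \<omega>\<bar> ^ 3)) \<le> Q j" for j
    unfolding Q_def W.P_def W.D_def
    by (rule I.sum_increment_moment_le[OF m_N assms(3) _ _ x1 x2 nonneg(1,2)]; simp)+
  have R: "(\<Sum>l\<in>{1..N}. M.expectation (\<lambda>\<omega>. \<bar>W.P j l \<omega>\<bar> ^ 4)) \<le> R j"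
    "(\<Sum>l\<in>{1..N}. M.expectation (\<lambda>\<omega>. \<bar>W.D j l \<omega>\<bar> ^ 4)) \<le> R j" for j
    unfolding R_def W.P_def W.D_def
    by (rule I.sum_increment_moment_le[OF m_N assms(3) _ _ y1 y2 nonneg(3,4)]; simp)+
  \<comment> \<open>\<open>R j\<close> contains \<open>m j ^ 4\<close>, whose root supplies two
    powers of \<open>m j\<close>; the third comes from the range of dependence in
    \<open>T_deviation_le\<close>.\<close>
  have b: "real (m j) * sqrt (R j) = b j" for j
    by (simp add: R_def b_def real_sqrt_mult real_sqrt_power power4_eq_xxxx power3_eq_cube)
  have "(\<Sum>j\<in>UNIV. \<Sum>i\<in>UNIV. K.dev j i) \<le> (\<Sum>j\<in>UNIV. \<Sum>i\<in>UNIV. sqrt 2 * (b j + b i))"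
  proof (intro sum_mono)
    fix j i
    show "K.dev j i \<le> sqrt 2 * (b j + b i)"
      using W.T_deviation_le[OF R(1)[of j] R(2)[of i] R_nonneg R_nonneg] by (simp add: K.dev_def b)
  qed
  \<comment> \<open>Each \<open>b j\<close> occurs in \<open>CARD('d)\<close> pairs in either
    position; the resulting 2 cancels the 1/2 of the interpolation.\<close>
  also have "\<dots> = 2 * (sqrt 2 * real CARD('d) * (\<Sum>j\<in>UNIV. b j))"
    unfolding sum_distrib_left[symmetric] sum.distrib by (simp add: sum_distrib_left[symmetric])
  finally have dev: "B2 / 2 * (\<Sum>j\<in>UNIV. \<Sum>i\<in>UNIV. K.dev j i) \<le> B2 / 2 * (2 * (sqrt 2 * real CARD('d) * (\<Sum>j\<in>UNIV. b j)))"
    using K.B2_nonneg by (intro mult_left_mono) auto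
  have "(\<Sum>j\<in>UNIV. K.L j) \<le> real CARD('d) ^ 2 * (\<Sum>j\<in>UNIV. Q j)"
    using W.third_order_sum_le[OF Q] by (simp add: K.L_def)
  then have "B3 / 6 * (\<Sum>j\<in>UNIV. K.L j) \<le> B3 / 6 * (real CARD('d) ^ 2 * (\<Sum>j\<in>UNIV. Q j))"
    using K.B3_nonneg by (intro mult_left_mono) auto
  \<comment> \<open>The interpolation yields \<open>B3 / 6\<close>, which is relaxed to the constant
    of the claim.\<close>
  also have "\<dots> \<le> B3 / 3 * (real CARD('d) ^ 2 * (\<Sum>j\<in>UNIV. Q j))"
    using K.B3_nonneg Q_nonneg by (intro mult_right_mono mult_nonneg_nonneg sum_nonneg) auto
  finally have L: "B3 / 6 * (\<Sum>j\<in>UNIV. K.L j) \<le> B3 / 3 * (real CARD('d) ^ 2 * (\<Sum>j\<in>UNIV. Q j))" .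
  have "\<bar>M.expectation (\<lambda>\<omega>. g (F \<omega>)) - M'.expectation (\<lambda>\<omega>. g (Y \<omega>))\<bar>
      \<le> B2 / 2 * (2 * (sqrt 2 * real CARD('d) * (\<Sum>j\<in>UNIV. b j))) + B3 / 3 * (real CARD('d) ^ 2 * (\<Sum>j\<in>UNIV. Q j))"
    using K.gaussian_interpolation dev L unfolding F by linarith
  also have "\<dots> = sqrt 2 * B2 * real CARD('d) * (\<Sum>j\<in>UNIV. b j) + B3 * real CARD('d) ^ 2 / 3 * (\<Sum>j\<in>UNIV. Q j)"
    by simp
  finally show ?thesis
    by (simp add: B2_def B3_def b_def Q_def mult.assoc)
qed

end
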